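(* Let $(X,\mu,T)$ be an ergodic system, let $\ell\in\mathbb{N}$ and let $a_1,\ldots,a_\ell\colon \mathbb{N}\to\mathbb{Z}$ be sequences. Then the following two conditions are equivalent: (i) The sequences $a_1,\ldots,a_\ell$ are jointly ergodic for $(X,\mu,T)$. (ii) The sequences $a_1,\ldots,a_\ell$ are good for seminorm estimates for $(X,\mu,T)$ and good for equidistribution for $(X,\mu,T)$.
   Context: $\mathbb{N}$ denotes the positive integers, $[N]:=\{1,\ldots,N\}$, $\mathbb{E}_{n\in A}c(n):=\frac{1}{|A|}\sum_{n\in A}c(n)$ for a finite non-empty set $A$, and $e(t):=e^{2\pi i t}$. A system $(X,\mu,T)$ is a Lebesgue probability space $(X,\mathcal{X},\mu)$ with an invertible, measurable, measure preserving transformation $T\colon X\to X$; for $n\in\mathbb{Z}$, $T^nf:=f\circ T^n$. It is ergodic if the only $f\in L^1(\mu)$ with $Tf=f$ are constants. $\mathrm{Spec}(T):=\{t\in[0,1)\colon Tf=e(t)f \text{ for some non-zero } f\in L^2(\mu)\}$, and $\mathcal{E}(T):=\{f\in L^\infty(\mu)\colon |f|=1 \text{ and } Tf=e(t)f \text{ for some } t\in[0,1)\}$. Ergodic seminorms: for $f\in L^\infty(\mu)$, $|||f|||_0:=\int f\,d\mu$ and, inductively for integers $s\ge 0$, $|||f|||_{s+1}\ge 0$ is defined by $|||f|||_{s+1}^{2^{s+1}}:=\lim_{N\to\infty}\mathbb{E}_{n\in[N]}|||T^nf\cdot\overline{f}|||_s^{2^s}$ (the limit is known to exist). Jointly ergodic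 for $(X,\mu,T)$: for all $f_1,\ldots,f_\ell\in L^\infty(\mu)$, $\lim_{N\to\infty}\mathbb{E}_{n\in[N]}T^{a_1(n)}f_1\cdots T^{a_\ell(n)}f_\ell=\int f_1\,d\mu\cdots\int f_\ell\,d\mu$ in $L^2(\mu)$. Good for seminorm estimates for $(X,\mu,T)$: there exists $s\in\mathbb{N}$ such that whenever $f_1,\ldots,f_\ell\in L^\infty(\mu)$ satisfy $|||f_m|||_s=0$ for some $m\in\{1,\ldots,\ell\}$ and $f_{m+1},\ldots,f_\ell\in\mathcal{E}(T)$, one has $\lim_{N\to\infty}\mathbb{E}_{n\in[N]}T^{a_1(n)}f_1\cdots T^{a_\ell(n)}f_\ell=0$ in $L^2(\mu)$. Good for equidistribution for $(X,\mu,T)$: for all $t_1,\ldots,t_\ell\in\mathrm{Spec}(T)$, not all of them $0$, $\lim_{N\to\infty}\mathbb{E}_{n\in[N]}e(a_1(n)t_1+\cdots+a_\ell(n)t_\ell)=0$. *)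

theory Defs
  imports "HOL-Probability.Probability"
begin

definition avg :: "'i set \<Rightarrow> ('i \<Rightarrow> complex) \<Rightarrow> complex" where
  "avg A c = (\<Sum>n\<in>A. c n) / of_nat (card A)"

definition e :: "real \<Rightarrow> complex" where
  "e t = exp (2 * of_real pi * \<i> * of_real t)"

definition isomorphic_mod0 :: "'a measure \<Rightarrow> 'b measure \<Rightarrow> bool" where
  "isomorphic_mod0 M N \<longleftrightarrow>
    (\<exists>A\<in>sets M. \<exists>B\<in>sets N.
      space M - A \<in> null_sets M \<and> space N - B \<in> null_sets N \<and>
      (\<exists>\<phi> \<psi>.
        \<phi> \<in> measurable (restrict_space M A) (restrict_space N B) \<and>
        \<psi> \<in> measurable (restrict_space N B) (restrict_space M A) \<and>
        (\<forall>x\<in>A. \<psi> (\<phi> x) = x) \<and> (\<forall>y\<in>B. \<phi> (\<psi> y) = y) \<and>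
        distr (restrict_space M A) (restrict_space N B) \<phi> = restrict_space N B))"

text \<open>
  Rokhlin's definition: up to null sets, the space is an interval with Lebesgue measure together
  with countably many atoms. In the model measure on the reals the interval is \<open>{0..c}\<close> and the
  atoms sit at \<open>2, 3, \<dots>\<close> with masses \<open>p 0, p 1, \<dots>\<close> (possibly zero); total mass one forces
  \<open>c \<le> 1\<close>, so they are disjoint from the interval. Authors differ on whether a Lebesgue space is
  complete; comparing completions admits both conventions.
\<close>

definition lebesgue_prob_space :: "'a measure \<Rightarrow> bool" where
  "lebesgue_prob_space M \<longleftrightarrow> prob_space M \<and>
    (\<exists>(c::real) (p :: nat \<Rightarrow> ennreal) (\<nu> :: real measure).
      0 \<le> c \<and> sets \<nu> = sets borel \<and>
      (\<forall>A\<in>sets borel. emeasure \<nu> A =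
         emeasure lborel (A \<inter> {0..c}) + (\<Sum>k. p k * indicator A (real k + 2))) \<and>
      isomorphic_mod0 (completion M) (completion \<nu>))"

definition mp_system :: "'a measure \<Rightarrow> ('a \<Rightarrow> 'a) \<Rightarrow> bool" where
  "mp_system M T \<longleftrightarrow> lebesgue_prob_space M \<and>
    bij_betw T (space M) (space M) \<and>
    T \<in> measurable M M \<and> inv_into (space M) T \<in> measurable M M \<and>
    distr M M T = M"

definition iter :: "'a measure \<Rightarrow> ('a \<Rightarrow> 'a) \<Rightarrow> int \<Rightarrow> 'a \<Rightarrow> 'a" where
  "iter M T n =
    (if n \<ge> 0 then T ^^ nat n else inv_into (space M) T ^^ nat (- n))"

text \<open>
  Elements of \<open>L\<^sup>p\<close> are represented by measurable functions, so identities between them are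
  stated almost everywhere.
\<close>

definition L2 :: "'a measure \<Rightarrow> ('a \<Rightarrow> complex) set" where
  "L2 M = {f \<in> borel_measurable M. integrable M (\<lambda>x. (cmod (f x))\<^sup>2)}"

definition Linf :: "'a measure \<Rightarrow> ('a \<Rightarrow> complex) set" where
  "Linf M = {f \<in> borel_measurable M. \<exists>C. AE x in M. cmod (f x) \<le> C}"

definition tendsto_L2 :: "'a measure \<Rightarrow> (nat \<Rightarrow> 'a \<Rightarrow> complex) \<Rightarrow> ('a \<Rightarrow> complex) \<Rightarrow> bool" where
  "tendsto_L2 M F g \<longleftrightarrow>
    (\<lambda>N. \<integral>\<^sup>+x. ennreal ((cmod (F N x - g x))\<^sup>2) \<partial>M) \<longlonglongrightarrow> 0"

definition ergodic :: "'a measure \<Rightarrow> ('a \<Rightarrow> 'a) \<Rightarrow> bool" where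
  "ergodic M T \<longleftrightarrow>
    (\<forall>f :: 'a \<Rightarrow> complex. integrable M f \<longrightarrow> (AE x in M. f (T x) = f x) \<longrightarrow>
      (\<exists>c. AE x in M. f x = c))"

definition Spec :: "'a measure \<Rightarrow> ('a \<Rightarrow> 'a) \<Rightarrow> real set" where
  "Spec M T = {t \<in> {0..<1}. \<exists>f\<in>L2 M.
     \<not> (AE x in M. f x = 0) \<and> (AE x in M. f (T x) = e t * f x)}"

definition Eig :: "'a measure \<Rightarrow> ('a \<Rightarrow> 'a) \<Rightarrow> ('a \<Rightarrow> complex) set" where
  "Eig M T = {f \<in> Linf M. (AE x in M. cmod (f x) = 1) \<and>
     (\<exists>t\<in>{0..<1}. AE x in M. f (T x) = e t * f x)}"

text \<open>
  The values are complex because the zeroth one is the integral of \<open>f\<close>; all later ones are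
  nonnegative reals. The limit is known to exist and to be a nonnegative real for \<open>f\<close> in
  \<open>Linf M\<close>.
\<close>

primrec erg_seminorm :: "'a measure \<Rightarrow> ('a \<Rightarrow> 'a) \<Rightarrow> nat \<Rightarrow> ('a \<Rightarrow> complex) \<Rightarrow> complex" where
  "erg_seminorm M T 0 f = (\<integral>x. f x \<partial>M)"
| "erg_seminorm M T (Suc s) f = complex_of_real (THE r. 0 \<le> r \<and>
     (\<lambda>N. avg {1..N} (\<lambda>n.
        erg_seminorm M T s (\<lambda>x. f (iter M T (int n) x) * cnj (f x)) ^ (2 ^ s)))
     \<longlonglongrightarrow> complex_of_real (r ^ (2 ^ Suc s)))"

text \<open>
  The sequences are \<open>a 1, \<dots>, a l\<close>, with terms \<open>a i n\<close> for \<open>n \<ge> 1\<close>; other values of \<open>a\<close> are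
  never used.
\<close>

definition mult_avg ::
  "'a measure \<Rightarrow> ('a \<Rightarrow> 'a) \<Rightarrow> nat \<Rightarrow> (nat \<Rightarrow> nat \<Rightarrow> int) \<Rightarrow> (nat \<Rightarrow> 'a \<Rightarrow> complex) \<Rightarrow> nat \<Rightarrow> 'a \<Rightarrow> complex"
where
  "mult_avg M T l a f N x = avg {1..N} (\<lambda>n. \<Prod>i=1..l. f i (iter M T (a i n) x))"

definition jointly_ergodic ::
  "'a measure \<Rightarrow> ('a \<Rightarrow> 'a) \<Rightarrow> nat \<Rightarrow> (nat \<Rightarrow> nat \<Rightarrow> int) \<Rightarrow> bool" where
  "jointly_ergodic M T l a \<longleftrightarrow>
    (\<forall>f. (\<forall>i\<in>{1..l}. f i \<in> Linf M) \<longrightarrow>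
      tendsto_L2 M (mult_avg M T l a f) (\<lambda>_. \<Prod>i=1..l. \<integral>x. f i x \<partial>M))"

definition good_for_seminorm_estimates ::
  "'a measure \<Rightarrow> ('a \<Rightarrow> 'a) \<Rightarrow> nat \<Rightarrow> (nat \<Rightarrow> nat \<Rightarrow> int) \<Rightarrow> bool" where
  "good_for_seminorm_estimates M T l a \<longleftrightarrow>
    (\<exists>s\<ge>1. \<forall>f. \<forall>m\<in>{1..l}.
      (\<forall>i\<in>{1..l}. f i \<in> Linf M) \<longrightarrow> erg_seminorm M T s (f m) = 0 \<longrightarrow>
      (\<forall>i\<in>{m<..l}. f i \<in> Eig M T) \<longrightarrow>
      tendsto_L2 M (mult_avg M T l a f) (\<lambda>_. 0))"

definition good_for_equidistribution ::
  "'a measure \<Rightarrow> ('a \<Rightarrow> 'a) \<Rightarrow> nat \<Rightarrow> (nat \<Rightarrow> nat \<Rightarrow> int) \<Rightarrow> bool" where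
  "good_for_equidistribution M T l a \<longleftrightarrow>
    (\<forall>t :: nat \<Rightarrow> real. (\<forall>i\<in>{1..l}. t i \<in> Spec M T) \<longrightarrow> (\<exists>i\<in>{1..l}. t i \<noteq> 0) \<longrightarrow>
      (\<lambda>N. avg {1..N} (\<lambda>n. e (\<Sum>i=1..l. of_int (a i n) * t i))) \<longlonglongrightarrow> 0)"

end

theory Submission
  imports Defs
begin

text \<open>Condition (ii) gives the convergence \<open>P m\<close> of the averages in which the functions after
  position \<open>m\<close> are eigenfunctions, by induction on \<open>m\<close>; the case \<open>m = 0\<close> is equidistribution. If
  the step to \<open>P m\<close> fails for some \<open>f\<^sub>m\<close> of mean zero, then \<open>f\<^sub>m\<close> correlates with a weak limit
  \<open>G\<close> of the dual functions \<open>\<E>\<^bsub>n\<^esub> T\<^bsup>-a\<^esup> (g \<cdot> \<Prod>\<^bsub>i\<noteq>m\<^esub> T\<^bsup>a\<^esup> f\<^sub>i)\<close>, which again has mean zero. The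
  seminorms of \<open>G\<close> are lowered in degree one at a time, a technique of Peluse and Prendiville in
  the ergodic form of Frantzikinakis: if \<open>\<parallel>G\<parallel>\<^bsub>s+2\<^esub> > 0\<close>, many iterated differences of \<open>G\<close>
  correlate with eigenfunctions; box norm Cauchy--Schwarz inequalities move the differences onto
  the dual functions, where \<open>P (m - 1)\<close> shows that these eigenfunctions satisfy a cocycle
  relation, so that they are of lower complexity and \<open>\<parallel>G\<parallel>\<^bsub>s+1\<^esub> > 0\<close>. As \<open>\<integral> G = 0\<close>, all seminorms
  of \<open>G\<close> vanish, and the seminorm estimate yields \<open>G = 0\<close>, a contradiction.\<close>

subsection \<open>Cesaro means of positive definite sequences\<close>

text \<open>The seminorm estimate says nothing about \<open>f m\<close>, whose seminorms need not
  vanish. It can be applied to \<open>G\<close> because a product of translates of dual functions is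
  the dual function of the products of translates; pairing it with an eigenfunction puts that
  eigenfunction at place \<open>m\<close>, which is why the induction keeps eigenfunctions at the
  later places. The limits obtained in this way have no rate, so degree lowering works in finite
  boxes of shifts fixed before the limit is taken, with sizes chosen one after the other as in the
  iterated limits behind the seminorms. That \<open>G\<close> has mean zero is not automatic: its
  mean is governed by the product of the other means times the mean of the averages. Hence the
  functions at earlier places are first split into constants and centred parts. Positive
  definiteness gives the limits that define the seminorms, and compactness of \<open>{0..1}\<close>
  gives the eigenvalues, so that no spectral theorem enters. The converse implication is short:
  estimates hold with \<open>s = 1\<close>, because the first seminorm is the modulus of the mean,
  and equidistribution follows by testing joint ergodicity on eigenfunctions.\<close>

locale pos_def_seq =
  fixes \<gamma> :: "nat \<Rightarrow> real"
  assumes bounded: "\<bar>\<gamma> n\<bar> \<le> 1"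
    and psd: "0 \<le> (\<Sum>i<R. \<Sum>j<R. c i * c j * \<gamma> ((i - j) + (j - i)))"
begin

definition mean :: "nat \<Rightarrow> real" where
  "mean N = (\<Sum>n=1..N. \<gamma> n) / real N"

text \<open>If \<open>\<gamma> \<bar>i - j\<bar>\<close> is the inner product of \<open>T\<^sup>i v\<close> and \<open>T\<^sup>j v\<close>, then \<open>corr N K\<close> is the inner
  product of the ergodic means \<open>A\<^sub>N\<close> and \<open>A\<^sub>K\<close> of \<open>v\<close>. With truncated subtraction \<open>(i - j) + (j
  - i)\<close> is \<open>\<bar>i - j\<bar>\<close>.\<close>
definition corr :: "nat \<Rightarrow> nat \<Rightarrow> real" where
  "corr N K = (\<Sum>i=1..N. \<Sum>j=1..K. \<gamma> ((i - j) + (j - i))) / (real N * real K)"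

lemma corr_commute: "corr N K = corr K N"
  unfolding corr_def by (subst sum.swap) (simp add: add.commute mult.commute)

text \<open>Raising \<open>j\<close> by one slides the window of \<open>N\<close> terms by one
  place: one bounded term leaves and one enters.\<close>

lemma shifted_sum_close: "\<bar>(\<Sum>i=1..N. \<gamma> ((i - j) + (j - i))) - (\<Sum>n=1..N. \<gamma> n)\<bar> \<le> 2 * real j"
proof (induction j)
  case (Suc j)
  have "(\<Sum>i=1..N. \<gamma> ((i - Suc j) + (Suc j - i))) = (\<Sum>i<N. \<gamma> ((i - j) + (j - i)))"
    by (rule sum.reindex_bij_witness[of _ Suc "\<lambda>i. i - 1"]) auto
  moreover have "(\<Sum>i<N. \<gamma> ((i - j) + (j - i))) + \<gamma> ((N - j) + (j - N))
      = (\<Sum>i=1..N. \<gamma> ((i - j) + (j - i))) + \<gamma> ((0 - j) + (j - 0))"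
    by (induction N) auto
  ultimately show ?case
    using Suc bounded[of "(N - j) + (j - N)"] bounded[of "(0 - j) + (j - 0)"]
        by (simp add: abs_le_iff)
qed simp

lemma corr_close_mean:
  assumes "N \<ge> 1" "K \<ge> 1"
  shows "\<bar>corr N K - mean N\<bar> \<le> 2 * real K / real N"
proof -
  have "corr N K - mean N = (\<Sum>j=1..K. ((\<Sum>i=1..N. \<gamma> ((i - j) + (j - i))) - (\<Sum>n=1..N. \<gamma> n)))
      / (real N * real K)"
    using assms unfolding corr_def mean_def
    by (subst sum.swap) (simp add: sum_subtractf diff_divide_distrib)
  also have "\<bar>\<dots>\<bar> \<le> (\<Sum>j=1..K. 2 * real K) / (real N * real K)"
    unfolding abs_divide abs_mult
    by (intro divide_mono order_trans[OF sum_abs] sum_mono order_trans[OF shifted_sum_close])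
       (use assms in auto)
  also have "\<dots> = 2 * real K / real N"
    using assms by (simp add: field_simps)
  finally show ?thesis .
qed

text \<open>The right-hand side is the squared norm of the combination of three ergodic means with
  coefficients \<open>x\<close>, \<open>y\<close>, \<open>z\<close>. It comes from
  \<open>psd\<close> with the uniform weights \<open>u\<close>, padded by zeros up to a common
  length \<open>R\<close>.\<close>

lemma corr_quadratic_form:
  assumes "N \<ge> 1" "K \<ge> 1" "L \<ge> 1"
  shows "0 \<le> x\<^sup>2 * corr N N + y\<^sup>2 * corr K K + z\<^sup>2 * corr L L
      + 2 * x * y * corr N K + 2 * x * z * corr N L + 2 * y * z * corr K L"
proof -
  define R where "R = Suc (N + K + L)"
  define u where "u A i = (if i \<in> {1..A} then 1 / real A else 0)" for A i :: nat
  define B where "B c d = (\<Sum>i<R. \<Sum>j<R. c i * d j * \<gamma> ((i - j) + (j - i)))" for c d :: "nat \<Rightarrow> real"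
  have B_u: "B (u A) (u A') = corr A A'" if "A < R" "A' < R" for A A'
  proof -
    have "B (u A) (u A') = (\<Sum>i=1..A. \<Sum>j<R. u A i * u A' j * \<gamma> ((i - j) + (j - i)))"
      unfolding B_def using that by (intro sum.mono_neutral_right) (auto simp: u_def)
    also have "\<dots> = (\<Sum>i=1..A. \<Sum>j=1..A'. u A i * u A' j * \<gamma> ((i - j) + (j - i)))"
      using that by (intro sum.cong refl sum.mono_neutral_right) (auto simp: u_def)
    also have "\<dots> = corr A A'"
      unfolding corr_def sum_divide_distrib by (intro sum.cong refl) (auto simp: u_def)
    finally show ?thesis .
  qed
  have lin1: "B (\<lambda>i. a * c i + a' * c' i) d = a * B c d + a' * B c' d"
    and lin2: "B d (\<lambda>i. a * c i + a' * c' i) = a * B d c + a' * B d c'" for a a' c c' d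
    unfolding B_def by (simp_all add: sum_distrib_left sum.distrib[symmetric] algebra_simps)
  have eq: "(\<lambda>i. x * u N i + y * u K i + z * u L i) = (\<lambda>i. 1 * (x * u N i + y * u K i) + z * u L i)"
    by simp
  have "0 \<le> B (\<lambda>i. x * u N i + y * u K i + z * u L i) (\<lambda>i. x * u N i + y * u K i + z * u L i)"
    unfolding B_def by (rule psd)
  also have "\<dots> = x\<^sup>2 * corr N N + y\<^sup>2 * corr K K + z\<^sup>2 * corr L L
      + 2 * x * y * corr N K + 2 * x * z * corr N L + 2 * y * z * corr K L"
    unfolding eq lin1 lin2
    by (subst (1 2 3 4 5 6 7 8 9) B_u)
       (auto simp: R_def algebra_simps power2_eq_square corr_commute[of K N] corr_commute[of L N]
           corr_commute[of L K])
  finally show ?thesis .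
qed

lemma abs_mean_le: "\<bar>mean N\<bar> \<le> 1"
proof -
  have "\<bar>\<Sum>n=1..N. \<gamma> n\<bar> \<le> (\<Sum>n=1..N. 1)"
    by (intro order_trans[OF sum_abs] sum_mono bounded)
  then show ?thesis by (simp add: mean_def abs_divide divide_le_eq)
qed

text \<open>The limit superior of the means.\<close>

definition top_mean :: real where
  "top_mean = Inf {b. \<forall>\<^sub>F N in sequentially. mean N \<le> b}"

lemma top_mean_bounds: "{b. \<forall>\<^sub>F N in sequentially. mean N \<le> b} \<noteq> {}"
    "bdd_below {b. \<forall>\<^sub>F N in sequentially. mean N \<le> b}"
proof -
  have "(1::real) \<in> {b. \<forall>\<^sub>F N in sequentially. mean N \<le> b}"
    using abs_mean_le by (auto simp: abs_le_iff)
  then show "{b. \<forall>\<^sub>F N in sequentially. mean N \<le> b} \<noteq> {}" by blast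
  show "bdd_below {b. \<forall>\<^sub>F N in sequentially. mean N \<le> b}"
  proof (rule bdd_belowI)
    fix b assume "b \<in> {b. \<forall>\<^sub>F N in sequentially. mean N \<le> b}"
    then obtain N where "mean N \<le> b" by (auto simp: eventually_sequentially)
    with abs_mean_le[of N] show "- 1 \<le> b" by (simp add: abs_le_iff)
  qed
qed

lemma eventually_mean_le:
  assumes "\<epsilon> > 0" shows "\<forall>\<^sub>F N in sequentially. mean N \<le> top_mean + \<epsilon>"
proof -
  obtain b where "\<forall>\<^sub>F N in sequentially. mean N \<le> b" "b < top_mean + \<epsilon>"
    using cInf_lessD[OF top_mean_bounds(1), of "top_mean + \<epsilon>"] assms unfolding top_mean_def by auto
  then show ?thesis by (auto elim: eventually_mono)
qed

lemma frequently_mean_ge: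
  assumes "\<epsilon> > 0" shows "\<exists>\<^sub>F N in sequentially. mean N > top_mean - \<epsilon>"
proof (rule ccontr)
  assume "\<not> ?thesis"
  then have "\<forall>\<^sub>F N in sequentially. mean N \<le> top_mean - \<epsilon>"
    by (simp add: frequently_def not_less)
  then have "top_mean \<le> top_mean - \<epsilon>"
    using cInf_lower[OF _ top_mean_bounds(2)] unfolding top_mean_def by blast
  with assms show False by simp
qed

text \<open>Apart from \<open>\<gamma> 0\<close>, each row of the double sum consists of two initial
  partial sums, of lengths \<open>j - 1\<close> and \<open>N - j\<close>, so the bound on the means
  applies twice. Short partial sums cost a bounded error per row, which disappears after division by
  \<open>N\<close>.\<close>

lemma eventually_corr_le:
  assumes "\<epsilon> > 0" shows "\<forall>\<^sub>F N in sequentially. corr N N \<le> top_mean + \<epsilon>"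
proof -
  define a where "a = top_mean + \<epsilon> / 2"
  obtain N0 where N0: "mean n \<le> a" if "n \<ge> N0" for n
    using eventually_mean_le[of "\<epsilon> / 2"] assms by (auto simp: a_def eventually_sequentially)
  \<comment> \<open>Allowance for sums of at most \<open>N0\<close> terms, where
    \<open>mean n \<le> a\<close> may fail: such a sum is at most \<open>N0\<close>, while
    \<open>n * a\<close> is at least \<open>- N0 * \<bar>a\<bar>\<close>.\<close>
  define C where "C = real N0 + real N0 * \<bar>a\<bar>"
  have sum_le: "(\<Sum>d=1..n. \<gamma> d) \<le> real n * a + C" for n
  proof (cases "n \<ge> N0 \<and> n > 0")
    case True
    then show ?thesis using N0[of n]
      by (simp add: mean_def divide_le_eq C_def mult.commute add_increasing2)
  next
    case False
    then have n: "n \<le> N0" by auto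
    have "(\<Sum>d=1..n. \<gamma> d) \<le> (\<Sum>d=1..n. 1)"
      using bounded by (intro sum_mono) (simp add: abs_le_iff)
    moreover have "- (real n * a) \<le> real N0 * \<bar>a\<bar>"
    proof -
      have "- (real n * a) \<le> real n * \<bar>a\<bar>"
        using mult_left_mono[of "-a" "\<bar>a\<bar>" "real n"] by simp
      also have "\<dots> \<le> real N0 * \<bar>a\<bar>" using n by (intro mult_right_mono) auto
      finally show ?thesis .
    qed
    ultimately show ?thesis using n unfolding C_def by simp
  qed
  have row: "(\<Sum>i=1..N. \<gamma> ((i - j) + (j - i))) \<le> real N * a + (2 * C + 1 + \<bar>a\<bar>)" if "j \<in> {1..N}"
      for N j
  proof -
    have "(\<Sum>i=1..N. \<gamma> ((i - j) + (j - i)))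
        = (\<Sum>i=1..<j. \<gamma> ((i - j) + (j - i))) + (\<Sum>i=j..N. \<gamma> ((i - j) + (j - i)))"
      using that by (subst sum.union_disjoint[symmetric]) (auto intro!: sum.cong)
    also have "(\<Sum>i=1..<j. \<gamma> ((i - j) + (j - i))) = (\<Sum>d=1..j-1. \<gamma> d)"
      using that by (intro sum.reindex_bij_witness[of _ "\<lambda>d. j - d" "\<lambda>i. j - i"]) auto
    also have "(\<Sum>i=j..N. \<gamma> ((i - j) + (j - i))) = (\<Sum>d=0..N-j. \<gamma> d)"
      using that by (intro sum.reindex_bij_witness[of _ "\<lambda>d. j + d" "\<lambda>i. i - j"]) auto
    also have "(\<Sum>d=0..N-j. \<gamma> d) = \<gamma> 0 + (\<Sum>d=1..N-j. \<gamma> d)"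
      by (subst sum.atLeast_Suc_atMost) auto
    finally have "(\<Sum>i=1..N. \<gamma> ((i - j) + (j - i))) \<le> real (j - 1) * a + C + 1 + real (N - j) * a
        + C"
      using sum_le[of "j-1"] sum_le[of "N-j"] bounded[of 0] by (simp add: abs_le_iff)
    also have "real (j - 1) * a + C + 1 + real (N - j) * a + C = real N * a - a + 2 * C + 1"
      using that by (simp add: of_nat_diff algebra_simps)
    finally show ?thesis by linarith
  qed
  have le: "corr N N \<le> a + (2 * C + 1 + \<bar>a\<bar>) / real N" if "N \<ge> 1" for N
  proof -
    have "corr N N \<le> (\<Sum>j=1..N. real N * a + (2 * C + 1 + \<bar>a\<bar>)) / (real N * real N)"
      unfolding corr_def by (subst sum.swap) (intro divide_right_mono sum_mono row, auto)
    also have "\<dots> = a + (2 * C + 1 + \<bar>a\<bar>) / real N" using that by (simp add: field_simps)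
    finally show ?thesis .
  qed
  have "(\<lambda>N. a + (2 * C + 1 + \<bar>a\<bar>) / real N) \<longlonglongrightarrow> a + 0"
    by (intro tendsto_intros lim_const_over_n)
  then have "\<forall>\<^sub>F N in sequentially. a + (2 * C + 1 + \<bar>a\<bar>) / real N < top_mean + \<epsilon>"
    using assms by (intro order_tendstoD) (auto simp: a_def)
  with eventually_ge_at_top[of 1] show ?thesis
    by eventually_elim (use le in fastforce)
qed

text \<open>Every convex combination \<open>w\<close> of the vectors \<open>T\<^sup>i v\<close> has \<open>\<parallel>w\<parallel>\<^sup>2 \<ge> top_mean\<close>, by expanding
  \<open>\<parallel>w - A\<^sub>N\<parallel>\<^sup>2 \<ge> 0\<close> for an ergodic mean \<open>A\<^sub>N\<close> with \<open>mean N\<close> close to \<open>top_mean\<close>.\<close>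
lemma top_mean_le_corr_pair:
  assumes "K \<ge> 1" "L \<ge> 1"
  shows "top_mean \<le> (corr K K + corr L L + 2 * corr K L) / 4"
proof (rule field_le_epsilon)
  fix \<epsilon> :: real assume "\<epsilon> > 0"
  \<comment> \<open>The two mixed terms lose \<open>2 * \<delta>\<close> each and
    \<open>corr N N\<close> loses \<open>\<delta>\<close>.\<close>
  define \<delta> where "\<delta> = \<epsilon> / 5"
  have \<delta>: "\<delta> > 0" using \<open>\<epsilon> > 0\<close> by (simp add: \<delta>_def)
  have "(\<lambda>N. (2 * real K + 2 * real L) / real N) \<longlonglongrightarrow> 0" by (rule lim_const_over_n)
  then have "\<forall>\<^sub>F N in sequentially. (2 * real K + 2 * real L) / real N < \<delta>"
    using \<delta> by (rule order_tendstoD)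
  with eventually_corr_le[OF \<delta>] eventually_ge_at_top[of 1]
  have "\<forall>\<^sub>F N in sequentially. corr N N \<le> top_mean + \<delta> \<and> N \<ge> 1 \<and> (2 * real K + 2 * real L)
      / real N < \<delta>"
    by eventually_elim auto
  with frequently_mean_ge[OF \<delta>]
  have "\<exists>\<^sub>F N in sequentially. mean N > top_mean - \<delta> \<and> corr N N \<le> top_mean + \<delta> \<and> N \<ge> 1
      \<and> (2 * real K + 2 * real L) / real N < \<delta>"
    by (rule frequently_eventually_frequently)
  then obtain N where N: "mean N > top_mean - \<delta>" "corr N N \<le> top_mean + \<delta>" "N \<ge> 1"
      "(2 * real K + 2 * real L) / real N < \<delta>"
    using frequently_ex by blast
  have small: "2 * real K / real N < \<delta>" "2 * real L / real N < \<delta>"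
    using N(4) by (simp_all add: add_divide_distrib) (smt
        (verit) divide_nonneg_nonneg of_nat_0_le_iff)+
  have "corr N K \<ge> mean N - \<delta>" "corr N L \<ge> mean N - \<delta>"
    using corr_close_mean[OF N(3) assms(1)] corr_close_mean[OF N(3) assms(2)] small by linarith+
  moreover have "0 \<le> 1 * corr N N + (1/4) * corr K K + (1/4) * corr L L
      - corr N K - corr N L + (1/2) * corr K L"
    using corr_quadratic_form[OF N(3) assms, of "-1" "1/2" "1/2"] by (simp add: power2_eq_square)
  ultimately have "(corr K K + corr L L + 2 * corr K L) / 4 \<ge> top_mean - 5 * \<delta>"
    using N(1,2) by simp
  then show "top_mean \<le> (corr K K + corr L L + 2 * corr K L) / 4 + \<epsilon>"
    unfolding \<delta>_def by (simp add: field_simps)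
qed

lemma top_mean_le_corr: "K \<ge> 1 \<Longrightarrow> top_mean \<le> corr K K"
  using top_mean_le_corr_pair[of K K] by simp

text \<open>Only the lower bound is at stake. Fix \<open>K\<close> with \<open>corr K K\<close>
  close to \<open>top_mean\<close>. The midpoint of the means of lengths \<open>N\<close> and
  \<open>K\<close> still has squared norm at least \<open>top_mean\<close>, which forces
  \<open>corr N K\<close>, and with it \<open>mean N\<close>, to be nearly as large.\<close>

lemma mean_tendsto: "mean \<longlonglongrightarrow> top_mean"
proof (rule LIMSEQ_I)
  fix \<epsilon> :: real assume "\<epsilon> > 0"
  define \<delta> where "\<delta> = \<epsilon> / 3"
  have \<delta>: "\<delta> > 0" using \<open>\<epsilon> > 0\<close> by (simp add: \<delta>_def)
  obtain K where K: "corr K K \<le> top_mean + \<delta>" "K \<ge> 1"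
    using eventually_conj[OF eventually_corr_le[OF \<delta>] eventually_ge_at_top[of 1]]
    by (auto simp: eventually_sequentially)
  have "(\<lambda>N. 2 * real K / real N) \<longlonglongrightarrow> 0" by (rule lim_const_over_n)
  then have "\<forall>\<^sub>F N in sequentially. 2 * real K / real N < \<delta>"
    using \<delta> by (rule order_tendstoD)
  with eventually_corr_le[OF \<delta>] eventually_ge_at_top[of 1] eventually_mean_le[OF \<delta>]
  have "\<forall>\<^sub>F N in sequentially. norm (mean N - top_mean) < \<epsilon>"
  proof eventually_elim
    case (elim N)
    have "corr N K \<le> mean N + \<delta>"
      using corr_close_mean[OF elim(2) K(2)] elim(4) by linarith
    then have "mean N \<ge> top_mean - 2 * \<delta>"
      using top_mean_le_corr_pair[OF elim(2) K(2)] K(1) elim(1) by simp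
    with elim(3) \<delta> show ?case unfolding \<delta>_def real_norm_def by linarith
  qed
  then show "\<exists>N0. \<forall>N\<ge>N0. norm (mean N - top_mean) < \<epsilon>"
    by (simp add: eventually_sequentially)
qed

end

subsection \<open>Averages over boxes\<close>

text \<open>A coordinate with \<open>H = 0\<close> makes the whole average 0;
  \<open>0 \<notin> set Hs\<close> excludes this where constants have to average to
  themselves.\<close>

primrec box_avg :: "nat list \<Rightarrow> (nat list \<Rightarrow> 'b::real_normed_field) \<Rightarrow> 'b" where
  "box_avg [] \<phi> = \<phi> []"
| "box_avg (H # Hs) \<phi> = (\<Sum>h=1..H. box_avg Hs (\<lambda>hs. \<phi> (h # hs))) / of_nat H"

primrec pair_avg :: "nat list \<Rightarrow> ((nat \<times> nat) list \<Rightarrow> 'b::real_normed_field) \<Rightarrow> 'b" where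
  "pair_avg [] \<phi> = \<phi> []"
| "pair_avg (H # Hs) \<phi> =
    (\<Sum>h=1..H. \<Sum>h'=1..H. pair_avg Hs (\<lambda>ps. \<phi> ((h, h') # ps))) / (of_nat H * of_nat H)"

text \<open>The product in the Gowers box norm: its vertices choose one component from each pair,
  and a vertex is conjugated once for every second component chosen.\<close>

primrec cube :: "(nat \<times> nat) list \<Rightarrow> (nat list \<Rightarrow> complex) \<Rightarrow> complex" where
  "cube [] u = u []"
| "cube (p # ps) u = cube ps (\<lambda>hs. u (fst p # hs) * cnj (u (snd p # hs)))"

text \<open>A product of \<open>t\<close> functions on \<open>t\<close>-tuples bounded by one, the \<open>j\<close>-th of which does not
  depend on the \<open>j\<close>-th coordinate.\<close>
primrec low_complexity :: "nat \<Rightarrow> (nat list \<Rightarrow> complex) \<Rightarrow> bool" where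
  "low_complexity 0 b \<longleftrightarrow> b [] = 1"
| "low_complexity (Suc t) b \<longleftrightarrow> (\<exists>b1 b'. (\<forall>hs. length hs = t \<longrightarrow> cmod (b1 hs) \<le> 1)
     \<and> (\<forall>h hs. length hs = t \<longrightarrow> b (h # hs) = b1 hs * b' h hs) \<and> (\<forall>h. low_complexity t (b' h)))"

lemma box_avg_cong:
  assumes "\<And>hs. length hs = length Hs \<Longrightarrow> \<phi> hs = \<psi> hs"
  shows "box_avg Hs \<phi> = box_avg Hs \<psi>"
  using assms
proof (induction Hs arbitrary: \<phi> \<psi>)
  case (Cons H Hs)
  show ?case unfolding box_avg.simps
    by (intro arg_cong2[where f = "(/)"] sum.cong refl Cons.IH) (simp add: Cons.prems)
qed simp

lemma box_avg_add: "box_avg Hs (\<lambda>hs. \<phi> hs + \<psi> hs) = box_avg Hs \<phi> + box_avg Hs \<psi>"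
  by (induction Hs arbitrary: \<phi> \<psi>) (auto simp: sum.distrib add_divide_distrib)

lemma box_avg_cmult: "box_avg Hs (\<lambda>hs. c * \<phi> hs) = c * box_avg Hs \<phi>"
  by (induction Hs arbitrary: \<phi>) (auto simp: sum_distrib_left[symmetric])

lemma box_avg_diff: "box_avg Hs (\<lambda>hs. \<phi> hs - \<psi> hs) = box_avg Hs \<phi> - box_avg Hs \<psi>"
  using box_avg_add[of Hs \<phi> "\<lambda>hs. (- 1) * \<psi> hs"] by (simp only: box_avg_cmult) simp

lemma box_avg_sum: "box_avg Hs (\<lambda>hs. \<Sum>i\<in>A. \<phi> i hs) = (\<Sum>i\<in>A. box_avg Hs (\<phi> i))"
proof (induction A rule: infinite_finite_induct)
  case empty
  show ?case using box_avg_cmult[of Hs 0 "\<lambda>_. 0"] by simp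
qed (auto simp: box_avg_add box_avg_cmult[of Hs 0 "\<lambda>_. 0", simplified])

lemma box_avg_divide: "box_avg Hs (\<lambda>hs. \<phi> hs / c) = box_avg Hs \<phi> / c"
  using box_avg_cmult[of Hs "inverse c" \<phi>] by (simp add: divide_inverse mult.commute)

lemma box_avg_const: "0 \<notin> set Hs \<Longrightarrow> box_avg Hs (\<lambda>_. c) = c"
  by (induction Hs) auto

lemma box_avg_mono:
  fixes \<phi> \<psi> :: "nat list \<Rightarrow> real"
  assumes "\<And>hs. length hs = length Hs \<Longrightarrow> \<phi> hs \<le> \<psi> hs"
  shows "box_avg Hs \<phi> \<le> box_avg Hs \<psi>"
  using assms
proof (induction Hs arbitrary: \<phi> \<psi>)
  case (Cons H Hs)
  show ?case unfolding box_avg.simps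
    by (intro divide_right_mono sum_mono Cons.IH) (simp_all add: Cons.prems)
qed simp

lemma box_avg_nonneg:
  fixes \<phi> :: "nat list \<Rightarrow> real"
  assumes "\<And>hs. length hs = length Hs \<Longrightarrow> 0 \<le> \<phi> hs"
  shows "0 \<le> box_avg Hs \<phi>"
  using box_avg_mono[of Hs "\<lambda>_. 0" \<phi>] assms box_avg_cmult[of Hs 0 "\<lambda>_. 0::real"] by simp

lemma box_avg_le_imp_ex:
  fixes \<phi> :: "nat list \<Rightarrow> real"
  assumes "c \<le> box_avg Hs \<phi>" "0 \<notin> set Hs"
  shows "\<exists>hs. length hs = length Hs \<and> c \<le> \<phi> hs"
proof (rule ccontr)
  assume contra: "\<not> ?thesis"
  have "box_avg Hs \<phi> < c" using assms(2) contra
  proof (induction Hs arbitrary: \<phi>)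
    case (Cons H Hs)
    have "box_avg Hs (\<lambda>hs. \<phi> (h # hs)) < c" for h
    proof (rule Cons.IH)
      show "0 \<notin> set Hs" using Cons.prems(1) by simp
      show "\<nexists>hs. length hs = length Hs \<and> c \<le> \<phi> (h # hs)"
        using Cons.prems(2) by (metis length_Cons)
    qed
    then have "(\<Sum>h=1..H. box_avg Hs (\<lambda>hs. \<phi> (h # hs))) < (\<Sum>h=1..H. c)"
      using Cons.prems by (intro sum_strict_mono) auto
    then show ?case using Cons.prems by (simp add: divide_less_eq mult.commute)
  qed (auto simp: not_le)
  with assms(1) show False by simp
qed

lemma norm_box_avg_le: "norm (box_avg Hs \<phi>) \<le> box_avg Hs (\<lambda>hs. norm (\<phi> hs))"
proof (induction Hs arbitrary: \<phi>)
  case (Cons H Hs)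
  have "norm (\<Sum>h=1..H. box_avg Hs (\<lambda>hs. \<phi> (h # hs)))
      \<le> (\<Sum>h=1..H. box_avg Hs (\<lambda>hs. norm (\<phi> (h # hs))))"
    by (intro sum_norm_le Cons.IH)
  then show ?case by (auto simp: norm_divide intro: divide_right_mono)
qed simp

lemma Re_box_avg: "Re (box_avg Hs \<phi>) = box_avg Hs (\<lambda>hs. Re (\<phi> hs))"
  by (induction Hs arbitrary: \<phi>) (auto simp: Re_divide_of_nat)

lemma pair_avg_eq_box_avg:
  "pair_avg Hs \<phi> = box_avg Hs (\<lambda>hs'. box_avg Hs (\<lambda>hs. \<phi> (zip hs hs')))"
proof (induction Hs arbitrary: \<phi>)
  case (Cons H Hs)
  have "box_avg (H # Hs) (\<lambda>hs'. box_avg (H # Hs) (\<lambda>hs. \<phi> (zip hs hs')))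
      = (\<Sum>h=1..H. \<Sum>h'=1..H. box_avg Hs (\<lambda>hs'. box_avg Hs (\<lambda>hs. \<phi> ((h, h') # zip hs hs')))) /
          (of_nat H * of_nat H)"
    by (simp add: box_avg_divide box_avg_sum sum_divide_distrib[symmetric])
  then show ?case unfolding pair_avg.simps Cons.IH by simp
qed simp

lemma pair_avg_add: "pair_avg Hs (\<lambda>ps. \<phi> ps + \<psi> ps) = pair_avg Hs \<phi> + pair_avg Hs \<psi>"
  unfolding pair_avg_eq_box_avg by (simp add: box_avg_add)

lemma pair_avg_const: "0 \<notin> set Hs \<Longrightarrow> pair_avg Hs (\<lambda>_. c) = c"
  unfolding pair_avg_eq_box_avg by (simp add: box_avg_const)

lemma Re_pair_avg: "Re (pair_avg Hs \<phi>) = pair_avg Hs (\<lambda>ps. Re (\<phi> ps))"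
  unfolding pair_avg_eq_box_avg by (simp add: Re_box_avg)

lemma cube_mult: "cube ps (\<lambda>hs. u hs * v hs) = cube ps u * cube ps v"
proof (induction ps arbitrary: u v)
  case (Cons p ps)
  show ?case
    by (simp add: Cons.IH[symmetric] mult.assoc mult.left_commute)
qed simp

lemma cube_cnj: "cube ps (\<lambda>hs. cnj (u hs)) = cnj (cube ps u)"
proof (induction ps arbitrary: u)
  case (Cons p ps)
  show ?case by (simp add: Cons.IH[symmetric])
qed simp

lemma cube_prod: "cube ps (\<lambda>hs. \<Prod>i\<in>A. u i hs) = (\<Prod>i\<in>A. cube ps (u i))"
proof (induction A rule: infinite_finite_induct)
  case empty
  have "cube ps (\<lambda>_. 1) = 1" by (induction ps) auto
  then show ?case by simp
next
  case (infinite A)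
  have "cube ps (\<lambda>_. 1) = 1" by (induction ps) auto
  with infinite show ?case by simp
qed (auto simp: cube_mult)

lemma norm_cube_le:
  assumes "\<And>hs. cmod (u hs) \<le> 1" shows "cmod (cube ps u) \<le> 1"
  using assms
proof (induction ps arbitrary: u)
  case (Cons p ps)
  show ?case unfolding cube.simps
    by (rule Cons.IH) (use Cons.prems in \<open>auto simp: norm_mult intro: mult_le_one\<close>)
qed simp

text \<open>All vertices except the top one \<open>map fst ps\<close>, grouped by the first place at
  which the second component is chosen.\<close>

primrec cube_rest :: "(nat \<times> nat) list \<Rightarrow> (nat list \<Rightarrow> complex) \<Rightarrow> complex" where
  "cube_rest [] u = 1"
| "cube_rest (p # ps) u = cnj (cube ps (\<lambda>hs. u (snd p # hs))) * cube_rest ps (\<lambda>hs. u (fst p # hs))"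

lemma cube_eq_top_times_rest: "cube ps u = u (map fst ps) * cube_rest ps u"
  by (induction ps arbitrary: u) (auto simp: cube_mult cube_cnj)

text \<open>With \<open>hs'\<close> fixed, the vertices whose first second component is at place
  \<open>j\<close> do not involve the \<open>j\<close>-th entry of \<open>hs\<close>.\<close>

lemma low_complexity_cube_rest:
  assumes "\<And>hs. cmod (u hs) \<le> 1"
  shows "low_complexity (length hs') (\<lambda>hs. cube_rest (zip hs hs') u)"
  using assms
proof (induction hs' arbitrary: u)
  case (Cons h' hs')
  show ?case unfolding length_Cons low_complexity.simps
    by (rule exI[of _ "\<lambda>hs. cnj (cube (zip hs hs') (\<lambda>hs. u (h' # hs)))"],
        rule exI[of _ "\<lambda>h hs. cube_rest (zip hs hs') (\<lambda>hs. u (h # hs))"])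
       (use Cons in \<open>auto intro!: norm_cube_le\<close>)
qed simp

lemma low_complexity_mult:
  "low_complexity t b \<Longrightarrow> low_complexity t c \<Longrightarrow> low_complexity t (\<lambda>hs. b hs * c hs)"
proof (induction t arbitrary: b c)
  case (Suc t)
  obtain b1 b' where b: "\<forall>hs. length hs = t \<longrightarrow> cmod (b1 hs) \<le> 1"
    "\<forall>h hs. length hs = t \<longrightarrow> b (h # hs) = b1 hs * b' h hs" "\<forall>h. low_complexity t (b' h)"
    using Suc.prems(1) by auto
  obtain c1 c' where c: "\<forall>hs. length hs = t \<longrightarrow> cmod (c1 hs) \<le> 1"
    "\<forall>h hs. length hs = t \<longrightarrow> c (h # hs) = c1 hs * c' h hs" "\<forall>h. low_complexity t (c' h)"
    using Suc.prems(2) by auto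
  show ?case unfolding low_complexity.simps
    by (rule exI[of _ "\<lambda>hs. b1 hs * c1 hs"], rule exI[of _ "\<lambda>h hs. b' h hs * c' h hs"])
       (use b c in \<open>auto simp: norm_mult intro!: mult_le_one Suc.IH\<close>)
qed auto

lemma low_complexity_cnj: "low_complexity t b \<Longrightarrow> low_complexity t (\<lambda>hs. cnj (b hs))"
proof (induction t arbitrary: b)
  case (Suc t)
  obtain b1 b' where b: "\<forall>hs. length hs = t \<longrightarrow> cmod (b1 hs) \<le> 1"
    "\<forall>h hs. length hs = t \<longrightarrow> b (h # hs) = b1 hs * b' h hs" "\<forall>h. low_complexity t (b' h)"
    using Suc.prems by auto
  show ?case unfolding low_complexity.simps
    by (rule exI[of _ "\<lambda>hs. cnj (b1 hs)"], rule exI[of _ "\<lambda>h hs. cnj (b' h hs)"])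
       (use b in \<open>auto intro!: Suc.IH\<close>)
qed auto

section \<open>Power means and the Cauchy--Schwarz inequality on boxes\<close>

lemma square_mean_le:
  fixes x :: "'i \<Rightarrow> real"
  shows "((\<Sum>i\<in>A. x i) / card A)\<^sup>2 \<le> (\<Sum>i\<in>A. (x i)\<^sup>2) / card A"
proof (cases "card A = 0")
  case False
  have "(\<Sum>i\<in>A. x i)\<^sup>2 \<le> (\<Sum>i\<in>A. (x i)\<^sup>2) * card A"
    using Cauchy_Schwarz_ineq_sum[of x "\<lambda>_. 1" A] by (simp add: mult.commute)
  then show ?thesis using False by (simp add: power_divide power2_eq_square field_simps)
qed auto

lemma power_mean_le:
  fixes x :: "'i \<Rightarrow> real"
  shows "((\<Sum>i\<in>A. x i) / card A) ^ (2 ^ k) \<le> (\<Sum>i\<in>A. (x i) ^ (2 ^ k)) / card A"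
proof (induction k arbitrary: x)
  case (Suc k)
  have "((\<Sum>i\<in>A. x i) / card A) ^ (2 ^ Suc k) = (((\<Sum>i\<in>A. x i) / card A)\<^sup>2) ^ (2 ^ k)"
    by (simp add: power_mult)
  also have "\<dots> \<le> ((\<Sum>i\<in>A. (x i)\<^sup>2) / card A) ^ (2 ^ k)"
    by (intro power_mono square_mean_le) auto
  also have "\<dots> \<le> (\<Sum>i\<in>A. ((x i)\<^sup>2) ^ (2 ^ k)) / card A" by (rule Suc.IH)
  finally show ?case by (simp add: power_mult)
qed simp

lemma box_avg_square_le:
  fixes \<phi> :: "nat list \<Rightarrow> real"
  shows "(box_avg Hs \<phi>)\<^sup>2 \<le> box_avg Hs (\<lambda>hs. (\<phi> hs)\<^sup>2)"
proof (induction Hs arbitrary: \<phi>)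
  case (Cons H Hs)
  have "(box_avg (H # Hs) \<phi>)\<^sup>2 \<le> (\<Sum>h=1..H. (box_avg Hs (\<lambda>hs. \<phi> (h # hs)))\<^sup>2) / H"
    using square_mean_le[of "\<lambda>h. box_avg Hs (\<lambda>hs. \<phi> (h # hs))" "{1..H}"] by simp
  also have "\<dots> \<le> box_avg (H # Hs) (\<lambda>hs. (\<phi> hs)\<^sup>2)"
    by (auto intro!: divide_right_mono sum_mono Cons.IH)
  finally show ?case .
qed simp

text \<open>One coordinate is eliminated at a time: the factor not depending on it is removed by
  Cauchy--Schwarz. Real parts are taken since the right-hand side need not be real if \<open>Hs = []\<close>.\<close>
lemma box_cauchy_schwarz:
  assumes "0 \<notin> set Hs" "low_complexity (length Hs) b"
  shows "(Re (box_avg Hs (\<lambda>hs. u hs * b hs))) ^ (2 ^ length Hs) \<le> Re (pair_avg Hs (\<lambda>ps. cube ps u))"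
  using assms
proof (induction Hs arbitrary: u b)
  case (Cons H Hs)
  have H: "H \<ge> 1" using Cons.prems by (cases H) auto
  define t where "t = length Hs"
  obtain b1 b' where b: "\<And>hs. length hs = t \<Longrightarrow> cmod (b1 hs) \<le> 1"
    "\<And>h hs. length hs = t \<Longrightarrow> b (h # hs) = b1 hs * b' h hs" "\<And>h. low_complexity t (b' h)"
    using Cons.prems(2) unfolding t_def by auto
  define X where "X = box_avg (H # Hs) (\<lambda>hs. u hs * b hs)"
  define v where "v h hs = u (h # hs) * b' h hs" for h hs
  define Y where "Y h h' = box_avg Hs (\<lambda>hs. (u (h # hs) * cnj (u (h' # hs)))
      * (b' h hs * cnj (b' h' hs)))" for h h'
  \<comment> \<open>\<open>b1\<close> does not depend on \<open>h\<close>, so the average over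
    \<open>h\<close> moves inside; there \<open>b1\<close> is discarded by its bound.\<close>
  have X: "X = box_avg Hs (\<lambda>hs. b1 hs * ((\<Sum>h=1..H. v h hs) / of_nat H))"
  proof -
    have "X = (\<Sum>h=1..H. box_avg Hs (\<lambda>hs. b1 hs * v h hs)) / of_nat H"
      unfolding X_def box_avg.simps v_def using b(2)
      by (intro arg_cong2[where f = "(/)"] sum.cong box_avg_cong refl) (simp add: t_def ac_simps)
    then show ?thesis
      by (simp add: box_avg_sum[symmetric] box_avg_divide[symmetric] sum_distrib_left)
  qed
  have "(Re X)\<^sup>2 \<le> (cmod X)\<^sup>2"
    by (metis abs_Re_le_cmod abs_norm_cancel abs_le_square_iff)
  also have "\<dots> \<le> (box_avg Hs (\<lambda>hs. cmod ((\<Sum>h=1..H. v h hs) / of_nat H)))\<^sup>2"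
  proof (intro power_mono norm_ge_zero)
    have "cmod X \<le> box_avg Hs (\<lambda>hs. cmod (b1 hs * ((\<Sum>h=1..H. v h hs) / of_nat H)))"
      unfolding X by (rule norm_box_avg_le)
    also have "\<dots> \<le> box_avg Hs (\<lambda>hs. cmod ((\<Sum>h=1..H. v h hs) / of_nat H))"
      unfolding norm_mult using b(1) by (intro box_avg_mono) (auto simp: t_def
          intro!: mult_left_le_one_le)
    finally show "cmod X \<le> \<dots>" .
  qed
  also have "\<dots> \<le> box_avg Hs (\<lambda>hs. (cmod ((\<Sum>h=1..H. v h hs) / of_nat H))\<^sup>2)"
    by (rule box_avg_square_le)
  also have "\<dots> = box_avg Hs (\<lambda>hs. Re ((\<Sum>h=1..H. \<Sum>h'=1..H. v h hs * cnj (v h' hs))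
      / (of_nat H * of_nat H)))"
  proof (intro arg_cong[where f = "box_avg Hs"] ext)
    fix hs
    have "complex_of_real ((cmod ((\<Sum>h=1..H. v h hs) / of_nat H))\<^sup>2)
        = (\<Sum>h=1..H. \<Sum>h'=1..H. v h hs * cnj (v h' hs)) / (of_nat H * of_nat H)"
      by (subst complex_norm_square) (simp add: sum_product)
    then show "(cmod ((\<Sum>h=1..H. v h hs) / of_nat H))\<^sup>2
        = Re ((\<Sum>h=1..H. \<Sum>h'=1..H. v h hs * cnj (v h' hs)) / (of_nat H * of_nat H))"
      by (metis Re_complex_of_real)
  qed
  also have "\<dots> = Re ((\<Sum>h=1..H. \<Sum>h'=1..H. Y h h') / (of_nat H * of_nat H))"
    unfolding Re_box_avg[symmetric]
    by (simp add: box_avg_divide box_avg_sum Y_def v_def ac_simps)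
  also have "\<dots> = (\<Sum>p\<in>{1..H}\<times>{1..H}. Re (Y (fst p) (snd p))) / card ({1..H}\<times>{1..H})"
    by (simp add: sum.cartesian_product' Re_divide_of_nat flip: of_nat_mult)
  finally have sq: "(Re X)\<^sup>2 \<le> (\<Sum>p\<in>{1..H}\<times>{1..H}. Re (Y (fst p) (snd p))) / card ({1..H}\<times>{1..H})" .
  \<comment> \<open>One of the \<open>Suc t\<close> squarings has been used. The remaining power
    \<open>2 ^ t\<close> passes to the single pairs by convexity, and the induction hypothesis
    treats each pair.\<close>
  have "Re X ^ 2 ^ length (H # Hs) = ((Re X)\<^sup>2) ^ 2 ^ t"
    by (simp add: power_mult t_def)
  also have "\<dots> \<le> ((\<Sum>p\<in>{1..H}\<times>{1..H}. Re (Y (fst p) (snd p))) / card ({1..H}\<times>{1..H})) ^ 2 ^ t"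
    by (intro power_mono sq) simp
  also have "\<dots> \<le> (\<Sum>p\<in>{1..H}\<times>{1..H}. Re (Y (fst p) (snd p)) ^ 2 ^ t) / card ({1..H}\<times>{1..H})"
    by (rule power_mean_le)
  also have "\<dots> \<le> (\<Sum>p\<in>{1..H}\<times>{1..H}. Re (pair_avg Hs (\<lambda>ps. cube (p # ps) u))) / card ({1..H}\<times>{1..H})"
  proof (intro divide_right_mono sum_mono)
    fix p :: "nat \<times> nat"
    show "Re (Y (fst p) (snd p)) ^ 2 ^ t \<le> Re (pair_avg Hs (\<lambda>ps. cube (p # ps) u))"
      unfolding Y_def t_def cube.simps using Cons.prems b(3)
      by (intro Cons.IH low_complexity_mult low_complexity_cnj) (auto simp: t_def)
  qed simp
  also have "\<dots> = Re (pair_avg (H # Hs) (\<lambda>ps. cube ps u))"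
    by (simp add: sum.cartesian_product' Re_divide_of_nat flip: of_nat_mult)
  finally show ?case unfolding X_def .
qed simp

subsection \<open>Nested limits\<close>

text \<open>The first entry is the outermost variable: how large a later entry has to be may depend
  on the earlier ones, as in an iterated limit.\<close>

primrec nested_ev :: "nat \<Rightarrow> (nat list \<Rightarrow> bool) \<Rightarrow> bool" where
  "nested_ev 0 P \<longleftrightarrow> P []"
| "nested_ev (Suc t) P \<longleftrightarrow> (\<forall>\<^sub>F H in sequentially. nested_ev t (\<lambda>Hs. P (H # Hs)))"

lemma nested_ev_mono:
  assumes "nested_ev t P" "\<And>Hs. length Hs = t \<Longrightarrow> P Hs \<Longrightarrow> Q Hs"
  shows "nested_ev t Q"
  using assms
proof (induction t arbitrary: P Q)
  case (Suc t)
  show ?case unfolding nested_ev.simps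
    by (rule eventually_mono[OF Suc.prems(1)[unfolded nested_ev.simps]])
       (erule Suc.IH, use Suc.prems(2) in auto)
qed auto

lemma nested_ev_conj:
  assumes "nested_ev t P" "nested_ev t Q"
  shows "nested_ev t (\<lambda>Hs. P Hs \<and> Q Hs)"
  using assms
proof (induction t arbitrary: P Q)
  case (Suc t)
  show ?case unfolding nested_ev.simps
    by (rule eventually_mono[OF eventually_conj[OF Suc.prems[unfolded nested_ev.simps]]])
       (auto intro: Suc.IH)
qed auto

lemma nested_ev_all: "(\<And>Hs. P Hs) \<Longrightarrow> nested_ev t P"
  by (induction t arbitrary: P) auto

lemma nested_ev_finite:
  assumes "finite I" "\<And>i. i \<in> I \<Longrightarrow> nested_ev t (P i)"
  shows "nested_ev t (\<lambda>Hs. \<forall>i\<in>I. P i Hs)"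
  using assms
proof (induction I rule: finite_induct)
  case empty
  show ?case by (rule nested_ev_all) simp
next
  case (insert i I)
  have "nested_ev t (\<lambda>Hs. P i Hs \<and> (\<forall>i\<in>I. P i Hs))"
    using insert by (intro nested_ev_conj) auto
  then show ?case by simp
qed

lemma nested_ev_ex: "nested_ev t P \<Longrightarrow> \<exists>Hs. length Hs = t \<and> 0 \<notin> set Hs \<and> P Hs"
proof (induction t arbitrary: P)
  case (Suc t)
  obtain H where H: "H \<ge> 1" "nested_ev t (\<lambda>Hs. P (H # Hs))"
    using eventually_conj[OF Suc.prems[unfolded nested_ev.simps] eventually_ge_at_top[of 1]]
    by (auto simp: eventually_sequentially)
  obtain Hs where "length Hs = t" "0 \<notin> set Hs" "P (H # Hs)" using Suc.IH[OF H(2)] by auto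
  with H(1) show ?case by (intro exI[of _ "H # Hs"]) auto
qed auto

subsection \<open>Bounded functions and weak cluster points\<close>

definition bounded_funs :: "'a measure \<Rightarrow> ('a \<Rightarrow> complex) set" where
  "bounded_funs M = {f \<in> borel_measurable M. \<exists>C. \<forall>x. cmod (f x) \<le> C}"

text \<open>The bound holds at every point, not almost everywhere, so that pointwise inequalities
  for cubes and averages carry no exceptional null sets.\<close>

definition unit_funs :: "'a measure \<Rightarrow> ('a \<Rightarrow> complex) set" where
  "unit_funs M = {f \<in> borel_measurable M. \<forall>x. cmod (f x) \<le> 1}"

lemma unit_funs_measurable [measurable_dest]: "f \<in> unit_funs M \<Longrightarrow> f \<in> borel_measurable M"
  and unit_funs_le: "f \<in> unit_funs M \<Longrightarrow> cmod (f x) \<le> 1"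
  by (auto simp: unit_funs_def)

lemma bounded_funs_measurable [measurable_dest]: "f \<in> bounded_funs M \<Longrightarrow> f \<in> borel_measurable M"
  by (auto simp: bounded_funs_def)

lemma bounded_funsI: "f \<in> borel_measurable M \<Longrightarrow> (\<And>x. cmod (f x) \<le> C) \<Longrightarrow> f \<in> bounded_funs M"
  by (auto simp: bounded_funs_def)

lemma bounded_funsE:
  assumes "f \<in> bounded_funs M"
  obtains C where "C > 0" "\<And>x. cmod (f x) \<le> C"
proof -
  obtain C where "\<forall>x. cmod (f x) \<le> C" using assms by (auto simp: bounded_funs_def)
  then have "cmod (f x) \<le> \<bar>C\<bar> + 1" for x by (smt (verit))
  then show ?thesis by (intro that[of "\<bar>C\<bar> + 1"]) auto
qed

lemma unit_funs_subset: "f \<in> unit_funs M \<Longrightarrow> f \<in> bounded_funs M"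
  by (auto simp: unit_funs_def bounded_funs_def)

lemma borel_measurable_cnj [measurable (raw)]:
  "f \<in> borel_measurable M \<Longrightarrow> (\<lambda>x. cnj (f x)) \<in> borel_measurable M"
  by (rule borel_measurable_continuous_on[OF _ _]) (auto intro: continuous_intros)

lemma bounded_funs_const [simp]: "(\<lambda>_. c) \<in> bounded_funs M"
  by (auto simp: bounded_funs_def)

lemma bounded_funs_add:
  assumes "f \<in> bounded_funs M" "g \<in> bounded_funs M" shows "(\<lambda>x. f x + g x) \<in> bounded_funs M"
proof -
  obtain C D where "\<And>x. cmod (f x) \<le> C" "\<And>x. cmod (g x) \<le> D"
    using assms by (metis bounded_funsE)
  then have "cmod (f x + g x) \<le> C + D" for x by (intro norm_triangle_le add_mono)
  with assms show ?thesis by (intro bounded_funsI) (auto dest: bounded_funs_measurable)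
qed

lemma bounded_funs_mult:
  assumes "f \<in> bounded_funs M" "g \<in> bounded_funs M" shows "(\<lambda>x. f x * g x) \<in> bounded_funs M"
proof -
  obtain C D where "C > 0" "\<And>x. cmod (f x) \<le> C" "\<And>x. cmod (g x) \<le> D"
    using assms by (metis bounded_funsE)
  then have "cmod (f x * g x) \<le> C * D" for x
    unfolding norm_mult by (intro mult_mono) (auto intro: less_imp_le)
  with assms show ?thesis by (intro bounded_funsI) (auto dest: bounded_funs_measurable)
qed

lemma bounded_funs_cnj: "f \<in> bounded_funs M \<Longrightarrow> (\<lambda>x. cnj (f x)) \<in> bounded_funs M"
  by (auto simp: bounded_funs_def)

lemma bounded_funs_cmult: "f \<in> bounded_funs M \<Longrightarrow> (\<lambda>x. c * f x) \<in> bounded_funs M"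
  by (intro bounded_funs_mult bounded_funs_const)

lemma bounded_funs_diff:
  "f \<in> bounded_funs M \<Longrightarrow> g \<in> bounded_funs M \<Longrightarrow> (\<lambda>x. f x - g x) \<in> bounded_funs M"
  using bounded_funs_add[OF _ bounded_funs_cmult[of g M "-1"], of f] by simp

lemma bounded_funs_divide: "f \<in> bounded_funs M \<Longrightarrow> (\<lambda>x. f x / c) \<in> bounded_funs M"
  using bounded_funs_cmult[of f M "inverse c"] by (simp add: divide_inverse mult.commute)

lemma bounded_funs_sum:
  "(\<And>i. i \<in> A \<Longrightarrow> f i \<in> bounded_funs M) \<Longrightarrow> (\<lambda>x. \<Sum>i\<in>A. f i x) \<in> bounded_funs M"
  by (induction A rule: infinite_finite_induct) (auto intro: bounded_funs_add)

lemma bounded_funs_box_avg: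
  assumes "\<And>hs. f hs \<in> bounded_funs M"
  shows "(\<lambda>x. box_avg Hs (\<lambda>hs. f hs x)) \<in> bounded_funs M"
  using assms
proof (induction Hs arbitrary: f)
  case (Cons H Hs)
  show ?case unfolding box_avg.simps
    by (intro bounded_funs_divide bounded_funs_sum Cons.IH Cons.prems)
qed simp

lemma unit_funs_mult: "f \<in> unit_funs M \<Longrightarrow> g \<in> unit_funs M \<Longrightarrow> (\<lambda>x. f x * g x) \<in> unit_funs M"
  by (auto simp: unit_funs_def norm_mult intro: mult_le_one)

lemma unit_funs_const: "cmod c \<le> 1 \<Longrightarrow> (\<lambda>_. c) \<in> unit_funs M"
  by (auto simp: unit_funs_def)

lemma unit_funs_prod:
  "(\<And>i. i \<in> A \<Longrightarrow> f i \<in> unit_funs M) \<Longrightarrow> (\<lambda>x. \<Prod>i\<in>A. f i x) \<in> unit_funs M"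
  by (induction A rule: infinite_finite_induct) (auto intro: unit_funs_mult simp: unit_funs_const)

lemma unit_funs_cnj: "f \<in> unit_funs M \<Longrightarrow> (\<lambda>x. cnj (f x)) \<in> unit_funs M"
  by (auto simp: unit_funs_def)

lemma norm_mean_le:
  fixes z :: "'i \<Rightarrow> complex"
  assumes "\<And>i. i \<in> A \<Longrightarrow> cmod (z i) \<le> C" "0 \<le> C"
  shows "cmod ((\<Sum>i\<in>A. z i) / of_nat (card A)) \<le> C"
proof -
  have "cmod (\<Sum>i\<in>A. z i) \<le> (\<Sum>i\<in>A. C)" by (intro sum_norm_le assms)
  then show ?thesis using assms(2)
    by (cases "card A = 0") (auto simp: norm_divide divide_le_eq mult.commute)
qed

lemma unit_funs_mean:
  assumes "\<And>i. i \<in> A \<Longrightarrow> f i \<in> unit_funs M"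
  shows "(\<lambda>x. (\<Sum>i\<in>A. f i x) / of_nat (card A)) \<in> unit_funs M"
  using assms unfolding unit_funs_def
  by (auto intro!: norm_mean_le borel_measurable_divide borel_measurable_sum)

lemmas unit_funs_avg = unit_funs_mean[folded avg_def]

text \<open>Midpoints stand for general convex combinations: the parallelogram law uses only these,
  and half-spaces and the unit ball are closed under them.\<close>

inductive_set mid_hull :: "(nat \<Rightarrow> 'a \<Rightarrow> complex) \<Rightarrow> nat \<Rightarrow> ('a \<Rightarrow> complex) set"
  for F :: "nat \<Rightarrow> 'a \<Rightarrow> complex" and k :: nat where
  base: "k \<le> j \<Longrightarrow> F j \<in> mid_hull F k"
| mid: "u \<in> mid_hull F k \<Longrightarrow> v \<in> mid_hull F k \<Longrightarrow> (\<lambda>x. (u x + v x) / 2) \<in> mid_hull F k"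

lemma mid_hull_mono: "k \<le> k' \<Longrightarrow> mid_hull F k' \<subseteq> mid_hull F k"
proof
  fix u assume "k \<le> k'" "u \<in> mid_hull F k'"
  from this(2) this(1) show "u \<in> mid_hull F k"
    by induction (auto intro: mid_hull.intros)
qed

lemma mid_hull_unit_funs:
  assumes "\<And>k. F k \<in> unit_funs M" "u \<in> mid_hull F k" shows "u \<in> unit_funs M"
  using assms(2)
proof induction
  case (mid u v)
  have "cmod ((u x + v x) / 2) \<le> 1" for x
    using norm_triangle_ineq[of "u x" "v x"] unit_funs_le[OF mid.IH(1), of x] unit_funs_le[OF
        mid.IH(2), of x]
    by (simp add: norm_divide)
  with mid.IH show ?case by (auto simp: unit_funs_def)
qed (rule assms)

context prob_space begin

lemma bounded_funs_integrable: "f \<in> bounded_funs M \<Longrightarrow> integrable M f"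
  by (auto simp: bounded_funs_def intro: integrable_const_bound)

lemma unit_funs_integrable: "f \<in> unit_funs M \<Longrightarrow> integrable M f"
  by (intro bounded_funs_integrable unit_funs_subset)

lemma integrable_bounded_norm:
  assumes "f \<in> bounded_funs M"
  shows "integrable M (\<lambda>x. cmod (f x))" "integrable M (\<lambda>x. (cmod (f x))\<^sup>2)"
proof -
  show "integrable M (\<lambda>x. cmod (f x))" by (intro integrable_norm bounded_funs_integrable assms)
  obtain C where "\<And>x. cmod (f x) \<le> C" using assms by (metis bounded_funsE)
  then have "(cmod (f x))\<^sup>2 \<le> C\<^sup>2" for x by (simp add: power_mono)
  then show "integrable M (\<lambda>x. (cmod (f x))\<^sup>2)"
    using assms by (intro integrable_const_bound[of _ "C\<^sup>2"]) (auto dest: bounded_funs_measurable)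
qed

lemma norm_integral_le:
  assumes "\<And>x. cmod (f x) \<le> C" shows "cmod (\<integral>x. f x \<partial>M) \<le> C"
proof (cases "integrable M f")
  case True
  have "cmod (\<integral>x. f x \<partial>M) \<le> (\<integral>x. cmod (f x) \<partial>M)" by (rule integral_norm_bound)
  also have "\<dots> \<le> (\<integral>x. C \<partial>M)"
    using True assms by (intro integral_mono) auto
  finally show ?thesis by (simp add: prob_space)
next
  case False
  then show ?thesis using order_trans[OF norm_ge_zero assms]
      by (simp add: not_integrable_integral_eq)
qed

lemma L1_less_of_L2_less:
  assumes f: "f \<in> bounded_funs M" and "(\<integral>x. (cmod (f x))\<^sup>2 \<partial>M) < \<epsilon>\<^sup>2" "\<epsilon> > 0"
  shows "(\<integral>x. cmod (f x) \<partial>M) < \<epsilon>"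
proof -
  have amgm: "y \<le> \<epsilon> / 2 + y\<^sup>2 / (2 * \<epsilon>)" for y :: real
  proof -
    have "0 \<le> (y - \<epsilon>)\<^sup>2" by simp
    then have "2 * \<epsilon> * y \<le> \<epsilon>\<^sup>2 + y\<^sup>2" by (simp add: power2_diff algebra_simps)
    then show ?thesis using \<open>\<epsilon> > 0\<close> by (simp add: field_simps power2_eq_square)
  qed
  have "(\<integral>x. cmod (f x) \<partial>M) \<le> (\<integral>x. \<epsilon> / 2 + (cmod (f x))\<^sup>2 / (2 * \<epsilon>) \<partial>M)"
    using integrable_bounded_norm[OF f] amgm by (intro integral_mono) auto
  also have "\<dots> = \<epsilon> / 2 + (\<integral>x. (cmod (f x))\<^sup>2 \<partial>M) / (2 * \<epsilon>)"
    using integrable_bounded_norm[OF f] by (simp add: prob_space)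
  also have "\<dots> < \<epsilon> / 2 + \<epsilon>\<^sup>2 / (2 * \<epsilon>)"
    using assms by (intro add_strict_left_mono divide_strict_right_mono) auto
  also have "\<dots> = \<epsilon>" using \<open>\<epsilon> > 0\<close> by (simp add: power2_eq_square)
  finally show ?thesis .
qed

text \<open>A substitute for weak compactness: almost minimal elements of the convex hulls of the
  tails converge strongly, by the parallelogram law.\<close>
lemma weak_cluster_point:
  assumes F: "\<And>k. F k \<in> unit_funs M"
  obtains G where "G \<in> unit_funs M"
    "\<And>w c. w \<in> bounded_funs M \<Longrightarrow> (\<forall>\<^sub>F k in sequentially. Re (\<integral>x. w x * F k x \<partial>M) \<le> c)
       \<Longrightarrow> Re (\<integral>x. w x * G x \<partial>M) \<le> c"
proof -
  define Q where "Q u = (\<integral>x. (cmod (u x))\<^sup>2 \<partial>M)" for u :: "'a \<Rightarrow> complex"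
  define \<delta> where "\<delta> k = Inf (Q ` mid_hull F k)" for k
  have Q0: "0 \<le> Q u" for u unfolding Q_def by simp
  have bdd: "bdd_below (Q ` mid_hull F k)" for k using Q0 by (intro bdd_belowI[of _ 0]) auto
  have ne: "Q ` mid_hull F k \<noteq> {}" for k using mid_hull.base[of k k F] by auto
  have unit: "u \<in> unit_funs M" if "u \<in> mid_hull F k" for u k
    using mid_hull_unit_funs F that by blast
  have Q1: "Q u \<le> 1" if "u \<in> unit_funs M" for u
  proof -
    have "Q u \<le> (\<integral>x. 1 \<partial>M)" unfolding Q_def
      using unit_funs_le[OF that] integrable_bounded_norm[OF unit_funs_subset[OF that]]
      by (intro integral_mono) (auto simp: power_le_one)
    then show ?thesis by (simp add: prob_space)
  qed
  \<comment> \<open>The hulls shrink with \<open>k\<close>, so their least energies increase; being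
    bounded, they form a Cauchy sequence.\<close>
  have "\<delta> k \<le> \<delta> k'" if "k \<le> k'" for k k'
    unfolding \<delta>_def using that by (intro cInf_superset_mono ne bdd image_mono mid_hull_mono)
  moreover have "\<bar>\<delta> k\<bar> \<le> 1" for k
  proof -
    have "0 \<le> \<delta> k" unfolding \<delta>_def using Q0 ne by (intro cInf_greatest) auto
    moreover have "\<delta> k \<le> Q (F k)"
      unfolding \<delta>_def using bdd mid_hull.base[of k k F] by (intro cInf_lower) auto
    ultimately show ?thesis using Q1[OF F[of k]] by simp
  qed
  ultimately have "convergent \<delta>"
    by (intro Bseq_monoseq_convergent) (auto simp: monoseq_def intro!: BseqI'[of _ 1])
  then have \<delta>: "Cauchy \<delta>" by (rule convergent_Cauchy)
  have "\<exists>u\<in>mid_hull F k. Q u < \<delta> k + 1 / real (Suc k)" for k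
    using cInf_lessD[OF ne, of k "\<delta> k + 1 / real (Suc k)"] unfolding \<delta>_def by auto
  then obtain w where w: "\<And>k. w k \<in> mid_hull F k" "\<And>k. Q (w k) < \<delta> k + 1 / real (Suc k)"
    by metis
  have w_unit: "w k \<in> unit_funs M" for k using unit w by blast
  have int2: "integrable M (\<lambda>x. (cmod (w k x))\<^sup>2)" for k
    by (intro integrable_bounded_norm unit_funs_subset w_unit)
  have mid_Q: "Q (\<lambda>x. w i x - w j x) \<le> 2 * Q (w i) + 2 * Q (w j) - 4 * \<delta> k" if "k \<le> i" "k \<le> j"
      for i j k
  proof -
    define v where "v = (\<lambda>x. (w i x + w j x) / 2)"
    have v: "v \<in> mid_hull F k"
      unfolding v_def using w(1) mid_hull_mono that by (intro mid_hull.mid) blast+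
    have "Q (\<lambda>x. w i x - w j x) = (\<integral>x. 2 * (cmod (w i x))\<^sup>2 + 2 * (cmod (w j x))\<^sup>2 - 4
        * (cmod (v x))\<^sup>2 \<partial>M)"
      unfolding Q_def v_def cmod_power2 by (intro Bochner_Integration.integral_cong refl)
        (simp add: power2_eq_square field_simps)
    also have "\<dots> = 2 * Q (w i) + 2 * Q (w j) - 4 * Q v"
      unfolding Q_def using int2 integrable_bounded_norm(2)[OF unit_funs_subset[OF unit[OF v]]]
          by simp
    finally have "Q (\<lambda>x. w i x - w j x) = 2 * Q (w i) + 2 * Q (w j) - 4 * Q v" .
    moreover have "\<delta> k \<le> Q v" unfolding \<delta>_def using v bdd by (intro cInf_lower) auto
    ultimately show ?thesis by simp
  qed
  have "\<exists>N. \<forall>i\<ge>N. \<forall>j\<ge>N. (\<integral>x. cmod (w i x - w j x) \<partial>M) < \<epsilon>" if "\<epsilon> > 0" for \<epsilon>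
  proof -
    \<comment> \<open>Energies below \<open>\<delta> N + 2 * \<eta>\<close> make the squared
      distance in \<open>mid_Q\<close> less than \<open>8 * \<eta>\<close>, which is half of the
      square of \<open>\<epsilon>\<close>.\<close>
    define \<eta> where "\<eta> = \<epsilon>\<^sup>2 / 16"
    have \<eta>: "\<eta> > 0" using that by (simp add: \<eta>_def)
    obtain N1 where N1: "\<And>i j. i \<ge> N1 \<Longrightarrow> j \<ge> N1 \<Longrightarrow> dist (\<delta> i) (\<delta> j) < \<eta>"
      using \<delta> \<eta> unfolding Cauchy_def by blast
    obtain N2 where N2: "1 / real (Suc N2) < \<eta>" using \<eta> nat_approx_posE by blast
    define N where "N = max N1 N2"
    have close: "Q (w i) < \<delta> N + 2 * \<eta>" if "i \<ge> N" for i
    proof -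
      have "1 / real (Suc i) \<le> 1 / real (Suc N2)" using that by (simp add: N_def frac_le)
      then show ?thesis using w(2)[of i] N1[of i N] N2 that by (simp add: N_def dist_real_def)
    qed
    have "(\<integral>x. cmod (w i x - w j x) \<partial>M) < \<epsilon>" if "i \<ge> N" "j \<ge> N" for i j
    proof (rule L1_less_of_L2_less)
      have "Q (\<lambda>x. w i x - w j x) < 8 * \<eta>"
        using mid_Q[OF that] close[OF that(1)] close[OF that(2)] by simp
      also have "8 * \<eta> \<le> \<epsilon>\<^sup>2" by (simp add: \<eta>_def)
      finally show "(\<integral>x. (cmod (w i x - w j x))\<^sup>2 \<partial>M) < \<epsilon>\<^sup>2" by (simp add: Q_def)
    qed (use w_unit \<open>\<epsilon> > 0\<close> in \<open>auto intro: bounded_funs_diff unit_funs_subset\<close>)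
    then show ?thesis by blast
  qed
  then obtain r where r: "strict_mono r" "AE x in M. Cauchy (\<lambda>i. w (r i) x)"
    using cauchy_L1_AE_cauchy_subseq[of M w] w_unit unit_funs_integrable by metis
  have [measurable]: "w k \<in> borel_measurable M" for k using w_unit by (rule unit_funs_measurable)
  define G where "G x = (if Cauchy (\<lambda>i. w (r i) x) then lim (\<lambda>i. w (r i) x) else 0)" for x
  have G_lim: "(\<lambda>i. w (r i) x) \<longlonglongrightarrow> G x" if "Cauchy (\<lambda>i. w (r i) x)" for x
    using that convergent_LIMSEQ_iff[THEN iffD1, OF Cauchy_convergent[OF that]] by (simp add: G_def)
  have "cmod (G x) \<le> 1" for x
  proof (cases "Cauchy (\<lambda>i. w (r i) x)")
    case True
    show ?thesis
      using tendsto_upperbound[OF tendsto_norm[OF G_lim[OF True]], of 1] unit_funs_le[OF w_unit]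
          by simp
  qed (simp add: G_def)
  moreover have G_meas: "G \<in> borel_measurable M" unfolding G_def by measurable
  ultimately have G: "G \<in> unit_funs M" by (simp add: unit_funs_def)
  show ?thesis
  proof (rule that[OF G])
    fix h c assume h: "h \<in> bounded_funs M" and ev: "\<forall>\<^sub>F k in sequentially. Re (\<integral>x. h x * F k x \<partial>M)
        \<le> c"
    obtain K where K: "\<And>k. k \<ge> K \<Longrightarrow> Re (\<integral>x. h x * F k x \<partial>M) \<le> c"
      using ev by (auto simp: eventually_sequentially)
    \<comment> \<open>A half-space that contains a tail of \<open>F\<close> contains the hull of
      this tail; dominated convergence then carries the bound over to \<open>G\<close>.\<close>
    have hull: "Re (\<integral>x. h x * u x \<partial>M) \<le> c" if "u \<in> mid_hull F K" for u
      using that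
    proof induction
      case (mid u v)
      have "integrable M (\<lambda>x. h x * u x)" "integrable M (\<lambda>x. h x * v x)"
        using mid h by (auto intro!: bounded_funs_integrable bounded_funs_mult
            intro: unit_funs_subset unit)
      then have "(\<integral>x. h x * ((u x + v x) / 2) \<partial>M) = ((\<integral>x. h x * u x \<partial>M) + (\<integral>x. h x * v x \<partial>M)) / 2"
        by (simp add: distrib_left add_divide_distrib)
      with mid.IH show ?case by simp
    qed (rule K)
    obtain C where C: "C > 0" "\<And>x. cmod (h x) \<le> C" using h by (metis bounded_funsE)
    have "(\<lambda>i. \<integral>x. h x * w (r i) x \<partial>M) \<longlonglongrightarrow> (\<integral>x. h x * G x \<partial>M)"
    proof (rule integral_dominated_convergence[where w = "\<lambda>_. C"])
      show "AE x in M. (\<lambda>i. h x * w (r i) x) \<longlonglongrightarrow> h x * G x"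
        using r(2) by eventually_elim (intro tendsto_intros G_lim)
      show "AE x in M. cmod (h x * w (r i) x) \<le> C" for i
        using C unit_funs_le[OF w_unit]
            by (intro AE_I2) (auto simp: norm_mult
            intro!: mult_left_le order_trans[OF mult_left_le])
      show "(\<lambda>x. h x * G x) \<in> borel_measurable M" "\<And>i. (\<lambda>x. h x * w (r i) x) \<in> borel_measurable M"
        using h G_meas by (auto dest: bounded_funs_measurable)
    qed auto
    then have "(\<lambda>i. Re (\<integral>x. h x * w (r i) x \<partial>M)) \<longlonglongrightarrow> Re (\<integral>x. h x * G x \<partial>M)"
      by (rule tendsto_Re)
    moreover have "\<forall>\<^sub>F i in sequentially. Re (\<integral>x. h x * w (r i) x \<partial>M) \<le> c"
      using eventually_ge_at_top[of K]
    proof eventually_elim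
      case (elim i)
      then have "w (r i) \<in> mid_hull F K"
        using w(1)[of "r i"] mid_hull_mono[of K "r i" F] seq_suble[OF r(1), of i] by auto
      then show ?case by (rule hull)
    qed
    ultimately show "Re (\<integral>x. h x * G x \<partial>M) \<le> c"
      by (rule tendsto_upperbound) simp
  qed
qed

end

lemma tendsto_of_subsequential_limits:
  fixes z :: "nat \<Rightarrow> complex"
  assumes bdd: "\<And>n. cmod (z n) \<le> C"
    and lim: "\<And>r L'. strict_mono r \<Longrightarrow> (z \<circ> r) \<longlonglongrightarrow> L' \<Longrightarrow> L' = L"
  shows "z \<longlonglongrightarrow> L"
proof (rule ccontr)
  assume "\<not> z \<longlonglongrightarrow> L"
  then obtain \<epsilon> where \<epsilon>: "\<epsilon> > 0" "\<And>N. \<exists>n\<ge>N. \<epsilon> \<le> dist (z n) L"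
    unfolding lim_sequentially by (meson not_less)
  then have "infinite {n. \<epsilon> \<le> dist (z n) L}"
    unfolding infinite_nat_iff_unbounded_le by simp
  then obtain r :: "nat \<Rightarrow> nat" where r: "strict_mono r" "\<And>n. r n \<in> {n. \<epsilon> \<le> dist (z n) L}"
    using infinite_enumerate by blast
  have "bounded (range (z \<circ> r))" using bdd by (intro boundedI[of _ C]) auto
  then obtain L' r' where r': "strict_mono r'" "((z \<circ> r) \<circ> r') \<longlonglongrightarrow> L'"
    using bounded_imp_convergent_subsequence by blast
  have "L' = L" using r' r(1) by (intro lim[of "r \<circ> r'"]) (auto simp: strict_mono_o o_assoc)
  with r'(2) have "(\<lambda>n. dist (z (r (r' n))) L) \<longlonglongrightarrow> dist L L"
      by (intro tendsto_intros) (simp add: o_def)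
  then have "\<epsilon> \<le> dist L L" by (rule tendsto_lowerbound) (use r(2) in auto)
  with \<epsilon>(1) show False by simp
qed

context prob_space begin

text \<open>\<open>G\<close> need not be the weak limit of a subsequence. It only inherits eventual
  upper bounds for real parts of linear functionals; changing the sign of \<open>w\<close> gives
  lower bounds, and \<open>weak_cluster_lim\<close> gives limits.\<close>

definition weak_cluster :: "(nat \<Rightarrow> 'a \<Rightarrow> complex) \<Rightarrow> ('a \<Rightarrow> complex) \<Rightarrow> bool" where
  "weak_cluster F G \<longleftrightarrow> G \<in> unit_funs M \<and> (\<forall>w\<in>bounded_funs M. \<forall>c.
     (\<forall>\<^sub>F k in sequentially. Re (\<integral>x. w x * F k x \<partial>M) \<le> c) \<longrightarrow> Re (\<integral>x. w x * G x \<partial>M) \<le> c)"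

lemma weak_cluster_ex: "(\<And>k. F k \<in> unit_funs M) \<Longrightarrow> \<exists>G. weak_cluster F G"
  unfolding weak_cluster_def by (metis weak_cluster_point)

lemma weak_cluster_unit: "weak_cluster F G \<Longrightarrow> G \<in> unit_funs M"
  by (simp add: weak_cluster_def)

lemma weak_cluster_le:
  "weak_cluster F G \<Longrightarrow> w \<in> bounded_funs M \<Longrightarrow>
    (\<forall>\<^sub>F k in sequentially. Re (\<integral>x. w x * F k x \<partial>M) \<le> c) \<Longrightarrow> Re (\<integral>x. w x * G x \<partial>M) \<le> c"
  by (auto simp: weak_cluster_def)

lemma weak_cluster_lim:
  assumes G: "weak_cluster F G" and w: "w \<in> bounded_funs M"
    and lim: "(\<lambda>k. \<integral>x. w x * F k x \<partial>M) \<longlonglongrightarrow> L"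
  shows "(\<integral>x. w x * G x \<partial>M) = L"
proof -
  \<comment> \<open>With this factor in the test function the difference to be killed becomes its
    own squared modulus, so an upper bound on a real part is enough.\<close>
  define z where "z = cnj ((\<integral>x. w x * G x \<partial>M) - L)"
  have "(\<lambda>k. Re (z * (\<integral>x. w x * F k x \<partial>M))) \<longlonglongrightarrow> Re (z * L)"
    by (intro tendsto_intros lim)
  then have lim': "(\<lambda>k. Re (\<integral>x. (z * w x) * F k x \<partial>M)) \<longlonglongrightarrow> Re (z * L)"
    by (simp add: mult.assoc)
  have "Re (\<integral>x. (z * w x) * G x \<partial>M) \<le> Re (z * L)"
  proof (rule field_le_epsilon)
    fix \<epsilon> :: real assume "\<epsilon> > 0"
    then have "\<forall>\<^sub>F k in sequentially. Re (\<integral>x. (z * w x) * F k x \<partial>M) < Re (z * L) + \<epsilon>"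
      by (intro order_tendstoD(2)[OF lim']) simp
    then show "Re (\<integral>x. (z * w x) * G x \<partial>M) \<le> Re (z * L) + \<epsilon>"
      by (intro weak_cluster_le[OF G] bounded_funs_cmult w) (auto elim: eventually_mono)
  qed
  then have "Re (z * ((\<integral>x. w x * G x \<partial>M) - L)) \<le> 0"
    by (simp add: mult.assoc right_diff_distrib)
  then have "(cmod ((\<integral>x. w x * G x \<partial>M) - L))\<^sup>2 \<le> 0"
    unfolding z_def by (metis Re_complex_of_real complex_norm_square mult.commute)
  then show ?thesis by simp
qed

lemma AE_zero_of_square_integral:
  assumes "d \<in> bounded_funs M" "(\<integral>x. cnj (d x) * d x \<partial>M) = 0"
  shows "AE x in M. d x = 0"
proof -
  have "complex_of_real (\<integral>x. (cmod (d x))\<^sup>2 \<partial>M) = (\<integral>x. cnj (d x) * d x \<partial>M)"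
    unfolding integral_complex_of_real[symmetric] complex_norm_square by (simp add: mult.commute)
  then have "(\<integral>x. (cmod (d x))\<^sup>2 \<partial>M) = 0" using assms(2) by (metis of_real_eq_0_iff)
  then show ?thesis
    using integral_nonneg_eq_0_iff_AE[OF integrable_bounded_norm(2)[OF assms(1)]] by simp
qed

end

subsection \<open>Ergodic actions and seminorms\<close>

locale ergodic_action = prob_space M for M :: "'a measure" +
  fixes \<tau> :: "int \<Rightarrow> 'a \<Rightarrow> 'a"
  assumes action_add: "\<tau> m (\<tau> n x) = \<tau> (m + n) x"
    and action_0 [simp]: "\<tau> 0 x = x"
    and action_measurable [measurable]: "\<tau> n \<in> measurable M M"
    and action_distr: "distr M M (\<tau> n) = M"
    and ergodic: "f \<in> unit_funs M \<Longrightarrow> AE x in M. f (\<tau> 1 x) = f x \<Longrightarrow> \<exists>c. AE x in M. f x = c"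
begin

lemma integral_action:
  fixes f :: "'a \<Rightarrow> complex"
  assumes "f \<in> borel_measurable M" shows "(\<integral>x. f (\<tau> n x) \<partial>M) = (\<integral>x. f x \<partial>M)"
  using integral_distr[OF action_measurable assms, of n] by (simp add: action_distr)

lemma integral_action_real:
  fixes f :: "'a \<Rightarrow> real"
  assumes "f \<in> borel_measurable M" shows "(\<integral>x. f (\<tau> n x) \<partial>M) = (\<integral>x. f x \<partial>M)"
  using integral_distr[OF action_measurable assms, of n] by (simp add: action_distr)

lemma AE_action: "AE x in M. P x \<Longrightarrow> AE x in M. P (\<tau> n x)"
  by (rule AE_distrD[OF action_measurable]) (simp only: action_distr)

lemma unit_funs_action: "f \<in> unit_funs M \<Longrightarrow> (\<lambda>x. f (\<tau> n x)) \<in> unit_funs M"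
  by (auto simp: unit_funs_def intro: measurable_compose[OF action_measurable])

lemma bounded_funs_action: "f \<in> bounded_funs M \<Longrightarrow> (\<lambda>x. f (\<tau> n x)) \<in> bounded_funs M"
  by (auto simp: bounded_funs_def intro: measurable_compose[OF action_measurable])

lemma integral_AE_const:
  assumes "f \<in> bounded_funs M" "AE x in M. f x = c" shows "(\<integral>x. f x \<partial>M) = (c :: complex)"
proof -
  have "(\<integral>x. f x \<partial>M) = (\<integral>x. c \<partial>M)"
    using assms by (intro integral_cong_AE) (auto dest: bounded_funs_measurable)
  then show ?thesis by (simp add: prob_space)
qed

text \<open>The relation is tested against its own defect \<open>d\<close>: pairing with
  \<open>w\<close> equals pairing \<open>cnj d\<close> with the defect of the other function. For
  \<open>F k\<close> this tends to 0, and for \<open>G\<close> it is the integral of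
  \<open>\<bar>d\<bar>\<close> squared.\<close>

lemma weak_cluster_eigen:
  assumes G: "weak_cluster F G" and F: "\<And>k. F k \<in> unit_funs M"
    and bound: "\<And>k x. cmod (F k (\<tau> 1 x) - c * F k x) \<le> \<epsilon> k" "\<epsilon> \<longlonglongrightarrow> 0"
  shows "AE x in M. G (\<tau> 1 x) = c * G x"
proof -
  define d where "d x = G (\<tau> 1 x) - c * G x" for x
  define w where "w x = cnj (d (\<tau> (-1) x)) - c * cnj (d x)" for x
  note bounded_rules = bounded_funs_diff bounded_funs_cmult bounded_funs_action bounded_funs_cnj
      bounded_funs_mult
  have Gu: "G \<in> unit_funs M" using G by (rule weak_cluster_unit)
  have d: "d \<in> bounded_funs M" unfolding d_def by (intro bounded_rules unit_funs_subset[OF Gu])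
  have w: "w \<in> bounded_funs M" unfolding w_def by (intro bounded_rules d)
  have move: "(\<integral>x. w x * u x \<partial>M) = (\<integral>x. cnj (d x) * (u (\<tau> 1 x) - c * u x) \<partial>M)"
      if "u \<in> unit_funs M" for u
  proof -
    have u: "u \<in> bounded_funs M" using that by (rule unit_funs_subset)
    have "(\<integral>x. cnj (d (\<tau> (-1) x)) * u x \<partial>M) = (\<integral>x. cnj (d (\<tau> (-1) (\<tau> 1 x))) * u (\<tau> 1 x) \<partial>M)"
      by (subst integral_action[where f = "\<lambda>x. cnj (d (\<tau> (-1) x)) * u x", symmetric])
         (auto intro!: bounded_funs_measurable bounded_rules d u)
    then have *: "(\<integral>x. cnj (d (\<tau> (-1) x)) * u x \<partial>M) = (\<integral>x. cnj (d x) * u (\<tau> 1 x) \<partial>M)"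
      by (simp add: action_add)
    have i: "integrable M (\<lambda>x. cnj (d (\<tau> (-1) x)) * u x)" "integrable M (\<lambda>x. cnj (d x) * u (\<tau> 1 x))"
      "integrable M (\<lambda>x. cnj (d x) * u x)"
      by (intro bounded_funs_integrable bounded_rules d u)+
    have "(\<integral>x. w x * u x \<partial>M) = (\<integral>x. cnj (d (\<tau> (-1) x)) * u x - c * (cnj (d x) * u x) \<partial>M)"
      unfolding w_def by (simp add: algebra_simps)
    also have "\<dots> = (\<integral>x. cnj (d x) * u (\<tau> 1 x) - c * (cnj (d x) * u x) \<partial>M)"
      using i * by simp
    finally show ?thesis by (simp add: algebra_simps)
  qed
  obtain C where C: "C > 0" "\<And>x. cmod (d x) \<le> C" using d by (metis bounded_funsE)
  have "(\<lambda>k. \<integral>x. w x * F k x \<partial>M) \<longlonglongrightarrow> 0"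
  proof (rule Lim_null_comparison)
    show "(\<lambda>k. C * \<epsilon> k) \<longlonglongrightarrow> 0" using tendsto_mult_left[OF bound(2), of C] by simp
    show "\<forall>\<^sub>F k in sequentially. cmod (\<integral>x. w x * F k x \<partial>M) \<le> C * \<epsilon> k"
      unfolding move[OF F] using C bound(1)
      by (intro always_eventually allI norm_integral_le) (auto simp: norm_mult intro!: mult_mono)
  qed
  from weak_cluster_lim[OF G w this] have "(\<integral>x. cnj (d x) * d x \<partial>M) = 0"
    unfolding move[OF Gu] d_def .
  then show ?thesis using AE_zero_of_square_integral[OF d] by (simp add: d_def)
qed

section \<open>Multiplicative derivatives and ergodic seminorms\<close>

definition deriv_by :: "nat \<Rightarrow> ('a \<Rightarrow> complex) \<Rightarrow> 'a \<Rightarrow> complex" where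
  "deriv_by n f x = f (\<tau> (int n) x) * cnj (f x)"

primrec derivs :: "nat list \<Rightarrow> ('a \<Rightarrow> complex) \<Rightarrow> 'a \<Rightarrow> complex" where
  "derivs [] f = f"
| "derivs (h # hs) f = derivs hs (deriv_by h f)"

text \<open>\<open>seminorm_pow s f\<close> is \<open>\<parallel>f\<parallel>\<^bsub>s+1\<^esub>\<close> raised to the power \<open>2\<^bsup>s+1\<^esup>\<close>, for the ergodic seminorms.\<close>
primrec seminorm_pow :: "nat \<Rightarrow> ('a \<Rightarrow> complex) \<Rightarrow> real" where
  "seminorm_pow 0 f = (cmod (\<integral>x. f x \<partial>M))\<^sup>2"
| "seminorm_pow (Suc s) f = lim (\<lambda>N. (\<Sum>n=1..N. seminorm_pow s (deriv_by n f)) / real N)"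

lemma deriv_by_eq: "deriv_by n f = (\<lambda>x. f (\<tau> (int n) x) * cnj (f x))"
  by (rule ext) (rule deriv_by_def)

lemma deriv_by_unit: "f \<in> unit_funs M \<Longrightarrow> deriv_by n f \<in> unit_funs M"
  unfolding deriv_by_def by (intro unit_funs_mult unit_funs_action unit_funs_cnj)

lemma derivs_unit: "f \<in> unit_funs M \<Longrightarrow> derivs hs f \<in> unit_funs M"
  by (induction hs arbitrary: f) (auto intro: deriv_by_unit)

lemma derivs_mult: "derivs hs (\<lambda>x. f x * g x) = (\<lambda>x. derivs hs f x * derivs hs g x)"
proof (induction hs arbitrary: f g)
  case (Cons h hs)
  have "deriv_by h (\<lambda>x. f x * g x) = (\<lambda>x. deriv_by h f x * deriv_by h g x)"
    by (auto simp: deriv_by_def)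
  then show ?case by (simp add: Cons.IH)
qed simp

lemma derivs_cnj: "derivs hs (\<lambda>x. cnj (f x)) = (\<lambda>x. cnj (derivs hs f x))"
proof (induction hs arbitrary: f)
  case (Cons h hs)
  have "deriv_by h (\<lambda>x. cnj (f x)) = (\<lambda>x. cnj (deriv_by h f x))"
    by (auto simp: deriv_by_def)
  then show ?case by (simp add: Cons.IH)
qed simp

lemma deriv_by_action: "deriv_by h (\<lambda>x. f (\<tau> n x)) = (\<lambda>x. deriv_by h f (\<tau> n x))"
  by (auto simp: deriv_by_def action_add add.commute)

lemma derivs_action: "derivs hs (\<lambda>x. f (\<tau> n x)) = (\<lambda>x. derivs hs f (\<tau> n x))"
  by (induction hs arbitrary: f) (auto simp: deriv_by_action)

lemma seminorm_pow_action:
  "f \<in> unit_funs M \<Longrightarrow> seminorm_pow s (\<lambda>x. f (\<tau> n x)) = seminorm_pow s f"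
  by (induction s arbitrary: f)
     (auto simp: integral_action unit_funs_measurable deriv_by_action deriv_by_unit)

lemma seminorm_pow_cnj: "seminorm_pow s (\<lambda>x. cnj (f x)) = seminorm_pow s f"
proof (induction s arbitrary: f)
  case (Suc s)
  have "deriv_by n (\<lambda>x. cnj (f x)) = (\<lambda>x. cnj (deriv_by n f x))" for n
    by (auto simp: deriv_by_def)
  then show ?case by (simp add: Suc.IH)
qed simp

text \<open>Up to translation and conjugation the product is the derivative by the distance of
  \<open>i\<close> and \<open>j\<close>. This gives the matrix of seminorms the shape required in
  \<open>pos_def_seq\<close>.\<close>

lemma seminorm_pow_translates:
  "seminorm_pow s (\<lambda>x. f (\<tau> (int i) x) * cnj (f (\<tau> (int j) x)))
      = seminorm_pow s (deriv_by ((i - j) + (j - i)) f)"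
  if f: "f \<in> unit_funs M"
proof (cases "j \<le> i")
  case True
  have "(\<lambda>x. f (\<tau> (int i) x) * cnj (f (\<tau> (int j) x))) = (\<lambda>x. deriv_by (i - j) f (\<tau> (int j) x))"
    using True by (auto simp: deriv_by_def action_add of_nat_diff)
  then show ?thesis using True f by (simp add: seminorm_pow_action deriv_by_unit)
next
  case False
  have "(\<lambda>x. f (\<tau> (int i) x) * cnj (f (\<tau> (int j) x)))
      = (\<lambda>x. cnj (deriv_by (j - i) f (\<tau> (int i) x)))"
    using False by (auto simp: deriv_by_def action_add of_nat_diff)
  then show ?thesis using False f
    by (simp add: seminorm_pow_action deriv_by_unit seminorm_pow_cnj)
qed

text \<open>Along a subsequence on which the correlations converge, a weak cluster point of the
  ergodic averages is invariant, hence constant, and the constant is the mean of \<open>f\<close>.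
  Testing against \<open>cnj f\<close> identifies the limit.\<close>

lemma mean_ergodic:
  assumes f: "f \<in> unit_funs M"
  shows "(\<lambda>N. avg {1..N} (\<lambda>n. \<integral>x. f (\<tau> (int n) x) * cnj (f x) \<partial>M))
      \<longlonglongrightarrow> complex_of_real ((cmod (\<integral>x. f x \<partial>M))\<^sup>2)"
proof (rule tendsto_of_subsequential_limits)
  note unit_rules = unit_funs_mult unit_funs_action unit_funs_cnj f
  show "cmod (avg {1..N} (\<lambda>n. \<integral>x. f (\<tau> (int n) x) * cnj (f x) \<partial>M)) \<le> 1" for N
    unfolding avg_def using unit_funs_le[OF deriv_by_unit[OF f]]
    by (intro norm_mean_le norm_integral_le) (auto simp: deriv_by_def)
  fix r :: "nat \<Rightarrow> nat" and L
  assume r: "strict_mono r"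
    and L: "((\<lambda>N. avg {1..N} (\<lambda>n. \<integral>x. f (\<tau> (int n) x) * cnj (f x) \<partial>M)) \<circ> r) \<longlonglongrightarrow> L"
  define F where "F k x = avg {1..r k} (\<lambda>n. f (\<tau> (int n) x))" for k x
  have F: "F k \<in> unit_funs M" for k unfolding F_def by (intro unit_funs_avg unit_rules)
  obtain G where G: "weak_cluster F G" using weak_cluster_ex[of F] F by auto
  have "AE x in M. G (\<tau> 1 x) = 1 * G x"
  proof (rule weak_cluster_eigen[OF G F])
    show "(\<lambda>k. 2 / real (r k)) \<longlonglongrightarrow> 0"
      using LIMSEQ_subseq_LIMSEQ[OF lim_const_over_n[of "2 :: real"] r] by (simp add: o_def)
    fix k x
    have tele: "(\<Sum>n=1..m. f (\<tau> (int (Suc n)) x)) - (\<Sum>n=1..m. f (\<tau> (int n) x))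
        = f (\<tau> (int (Suc m)) x) - f (\<tau> 1 x)" for m
      by (induction m) (auto simp: algebra_simps)
    have "F k (\<tau> 1 x) - 1 * F k x = ((\<Sum>n=1..r k. f (\<tau> (int (Suc n)) x))
        - (\<Sum>n=1..r k. f (\<tau> (int n) x))) / of_nat (r k)"
      by (simp add: F_def avg_def diff_divide_distrib action_add add.commute)
    also have "(\<Sum>n=1..r k. f (\<tau> (int (Suc n)) x)) - (\<Sum>n=1..r k. f (\<tau> (int n) x))
        = f (\<tau> (int (Suc (r k))) x) - f (\<tau> 1 x)"
      by (rule tele)
    also have "cmod ((f (\<tau> (int (Suc (r k))) x) - f (\<tau> 1 x)) / of_nat (r k)) \<le> 2 / real (r k)"
      unfolding norm_divide norm_of_nat
      by (intro divide_right_mono order_trans[OF norm_triangle_ineq4] order_trans[OF add_mono[OF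
          unit_funs_le[OF f] unit_funs_le[OF f]]]) auto
    finally show "cmod (F k (\<tau> 1 x) - 1 * F k x) \<le> 2 / real (r k)" .
  qed
  then obtain c where c: "AE x in M. G x = c"
    using ergodic[OF weak_cluster_unit[OF G]] by auto
  have Gb: "G \<in> bounded_funs M" using G by (intro unit_funs_subset weak_cluster_unit)
  have int_F: "(\<integral>x. w x * F k x \<partial>M) = avg {1..r k} (\<lambda>n. \<integral>x. f (\<tau> (int n) x) * w x \<partial>M)"
      if "w \<in> unit_funs M" for w k
  proof -
    have "integrable M (\<lambda>x. f (\<tau> (int n) x) * w x)" for n
      by (intro unit_funs_integrable unit_rules that)
    moreover have "(\<integral>x. w x * F k x \<partial>M)
        = (\<integral>x. (\<Sum>n=1..r k. f (\<tau> (int n) x) * w x) / of_nat (r k) \<partial>M)"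
      unfolding F_def avg_def by (simp add: sum_distrib_left mult.commute)
    ultimately show ?thesis by (simp add: avg_def)
  qed
  have "c = (\<integral>x. f x \<partial>M)"
  proof -
    have "\<forall>\<^sub>F k in sequentially. (\<integral>x. 1 * F k x \<partial>M) = (\<integral>x. f x \<partial>M)"
      using eventually_ge_at_top[of 1]
    proof eventually_elim
      case (elim k)
      then have "r k \<ge> 1" using seq_suble[OF r, of k] by simp
      then show ?case
        using int_F[of "\<lambda>_. 1" k] f by (simp add: avg_def integral_action unit_funs_measurable
            unit_funs_const)
    qed
    then have "(\<lambda>k. \<integral>x. 1 * F k x \<partial>M) \<longlonglongrightarrow> (\<integral>x. f x \<partial>M)" by (rule tendsto_eventually)
    from weak_cluster_lim[OF G _ this] show ?thesis using integral_AE_const[OF Gb c] by simp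
  qed
  moreover have "(\<lambda>k. \<integral>x. cnj (f x) * F k x \<partial>M) \<longlonglongrightarrow> L"
    using L unfolding int_F[OF unit_funs_cnj[OF f]] by (simp add: o_def)
  from weak_cluster_lim[OF G _ this] have "(\<integral>x. cnj (f x) * G x \<partial>M) = L"
    using f by (simp add: bounded_funs_cnj unit_funs_subset)
  moreover have "(\<integral>x. cnj (f x) * G x \<partial>M) = (\<integral>x. c * cnj (f x) \<partial>M)"
  proof (rule integral_cong_AE)
    show "AE x in M. cnj (f x) * G x = c * cnj (f x)" using c by eventually_elim simp
  qed (use f Gb in \<open>auto intro: borel_measurable_cnj borel_measurable_times
      dest: unit_funs_measurable bounded_funs_measurable\<close>)
  ultimately show "L = complex_of_real ((cmod (\<integral>x. f x \<partial>M))\<^sup>2)"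
    unfolding complex_norm_square by simp
qed

text \<open>This adds one outer variable to an iterated limit. \<open>V\<close> is left open because
  it is used both for the complex valued integral and for the real valued
  \<open>seminorm_pow s\<close>.\<close>

lemma nested_step:
  fixes V :: "('a \<Rightarrow> complex) \<Rightarrow> 'b::real_normed_field"
  assumes lim: "\<And>f. f \<in> unit_funs M \<Longrightarrow>
      (\<lambda>N. (\<Sum>n=1..N. seminorm_pow s (deriv_by n f)) / real N) \<longlonglongrightarrow> seminorm_pow (Suc s) f"
    and approx: "\<And>f \<delta>. f \<in> unit_funs M \<Longrightarrow> \<delta> > 0 \<Longrightarrow>
      nested_ev k (\<lambda>Hs. norm (box_avg Hs (\<lambda>hs. V (derivs hs f)) - of_real (seminorm_pow s f)) \<le> \<delta>)"
    and f: "f \<in> unit_funs M" and "\<delta> > 0"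
  shows "nested_ev (Suc k) (\<lambda>Hs. norm (box_avg Hs (\<lambda>hs. V (derivs hs f))
      - of_real (seminorm_pow (Suc s) f)) \<le> \<delta>)"
proof -
  have "\<forall>\<^sub>F N in sequentially. dist ((\<Sum>n=1..N. seminorm_pow s (deriv_by n f))
      / real N) (seminorm_pow (Suc s) f) < \<delta> / 2"
    using \<open>\<delta> > 0\<close> by (intro tendstoD[OF lim[OF f]]) simp
  with eventually_ge_at_top[of 1] show ?thesis
    unfolding nested_ev.simps
  proof eventually_elim
    case (elim H)
    have "nested_ev k (\<lambda>Hs. \<forall>h\<in>{1..H}.
        norm (box_avg Hs (\<lambda>hs. V (derivs hs (deriv_by h f))) - of_real (seminorm_pow s
            (deriv_by h f))) \<le> \<delta> / 2)"
      using \<open>\<delta> > 0\<close> by (intro nested_ev_finite approx deriv_by_unit f) auto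
    then show ?case
    proof (rule nested_ev_mono)
      fix Hs assume *: "\<forall>h\<in>{1..H}.
        norm (box_avg Hs (\<lambda>hs. V (derivs hs (deriv_by h f))) - of_real (seminorm_pow s
            (deriv_by h f))) \<le> \<delta> / 2"
      define m where "m = (\<Sum>n=1..H. seminorm_pow s (deriv_by n f)) / real H"
      have "box_avg (H # Hs) (\<lambda>hs. V (derivs hs f)) - of_real m
          = (\<Sum>h=1..H. box_avg Hs (\<lambda>hs. V (derivs hs (deriv_by h f))) - of_real (seminorm_pow s
              (deriv_by h f))) / of_nat H"
        by (simp add: m_def sum_subtractf diff_divide_distrib)
      also have "norm \<dots> \<le> (\<Sum>h=1..H. \<delta> / 2) / real H"
        unfolding norm_divide norm_of_nat using * by (intro divide_right_mono sum_norm_le) auto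
      also have "\<dots> = \<delta> / 2" using elim(1) by simp
      finally have "norm (box_avg (H # Hs) (\<lambda>hs. V (derivs hs f)) - of_real m) \<le> \<delta> / 2" .
      moreover have "norm (of_real m - of_real (seminorm_pow (Suc s) f) :: 'b) \<le> \<delta> / 2"
        unfolding of_real_diff[symmetric] norm_of_real using elim(2)
            by (simp add: m_def dist_real_def)
      ultimately show "norm (box_avg (H # Hs) (\<lambda>hs. V (derivs hs f))
          - of_real (seminorm_pow (Suc s) f)) \<le> \<delta>"
        using norm_diff_triangle_le by fastforce
    qed
  qed
qed

text \<open>Bundled for an induction on \<open>s\<close>: the approximation by box averages of
  integrals makes the seminorms of the derivatives positive definite, and positive definiteness
  gives the limit in the next degree.\<close>

definition seminorm_regular :: "nat \<Rightarrow> bool" where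
  "seminorm_regular s \<longleftrightarrow> (\<forall>f\<in>unit_funs M. 0 \<le> seminorm_pow s f \<and> seminorm_pow s f \<le> 1 \<and>
     (\<forall>\<delta>>0. nested_ev (Suc s) (\<lambda>Hs.
        cmod (box_avg Hs (\<lambda>hs. \<integral>x. derivs hs f x \<partial>M) - complex_of_real (seminorm_pow s f)) \<le> \<delta>)))"

text \<open>Positive definiteness holds because \<open>derivs hs\<close> is multiplicative: for \<open>g = derivs hs f\<close>
  the quadratic form is the integral of \<open>\<bar>\<Sum>i. c i * g \<circ> \<tau> i\<bar>\<^sup>2\<close>.\<close>
lemma seminorm_pow_pos_def:
  assumes reg: "seminorm_regular s" and f: "f \<in> unit_funs M"
  shows "pos_def_seq (\<lambda>n. seminorm_pow s (deriv_by n f))"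
proof
  show "\<bar>seminorm_pow s (deriv_by n f)\<bar> \<le> 1" for n
    using reg deriv_by_unit[OF f, of n] unfolding seminorm_regular_def by auto
  fix c :: "nat \<Rightarrow> real" and R :: nat
  define g where "g i j x = f (\<tau> (int i) x) * cnj (f (\<tau> (int j) x))" for i j x
  have g: "g i j \<in> unit_funs M" for i j
    unfolding g_def by (intro unit_funs_mult unit_funs_action unit_funs_cnj f)
  \<comment> \<open>One choice of boxes approximates all the seminorms within
    \<open>\<delta>\<close> at once, so the quadratic form is off by at most
    \<open>\<delta> * B\<close>.\<close>
  define B where "B = (\<Sum>i<R. \<Sum>j<R. \<bar>c i * c j\<bar>)"
  have B: "B \<ge> 0" unfolding B_def by (intro sum_nonneg) auto
  have eq: "seminorm_pow s (deriv_by ((i - j) + (j - i)) f) = seminorm_pow s (g i j)" for i j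
    unfolding g_def using seminorm_pow_translates[OF f] by simp
  have almost: "- (\<delta> * B) \<le> (\<Sum>i<R. \<Sum>j<R. c i * c j * seminorm_pow s (g i j))" if "\<delta> > 0" for \<delta>
  proof -
    have "nested_ev (Suc s) (\<lambda>Hs. \<forall>p\<in>{..<R}\<times>{..<R}.
        cmod (box_avg Hs (\<lambda>hs. \<integral>x. derivs hs (g (fst p) (snd p)) x \<partial>M) - complex_of_real
            (seminorm_pow s (g (fst p) (snd p)))) \<le> \<delta>)"
      using reg g that unfolding seminorm_regular_def by (intro nested_ev_finite) auto
    from nested_ev_ex[OF this] obtain Hs where
      Hs: "\<And>i j. i < R \<Longrightarrow> j < R \<Longrightarrow> cmod (box_avg Hs (\<lambda>hs. \<integral>x. derivs hs (g i j) x \<partial>M)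
          - complex_of_real (seminorm_pow s (g i j))) \<le> \<delta>"
      by auto
    have pos: "0 \<le> Re (\<Sum>i<R. \<Sum>j<R. complex_of_real (c i * c j) * (\<integral>x. derivs hs (g i j) x \<partial>M))"
        for hs
    proof -
      define h where "h = derivs hs f"
      have h: "h \<in> unit_funs M" unfolding h_def by (intro derivs_unit f)
      have D: "derivs hs (g i j) x = h (\<tau> (int i) x) * cnj (h (\<tau> (int j) x))" for i j x
        unfolding g_def h_def derivs_mult derivs_cnj derivs_action by simp
      have i: "integrable M (\<lambda>x. complex_of_real (c i * c j)
          * (h (\<tau> (int i) x) * cnj (h (\<tau> (int j) x))))" for i j
        by (intro bounded_funs_integrable bounded_funs_cmult bounded_funs_mult bounded_funs_cnj
            bounded_funs_action unit_funs_subset h)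
      have "(\<Sum>i<R. \<Sum>j<R. complex_of_real (c i * c j) * (\<integral>x. derivs hs (g i j) x \<partial>M))
          = (\<Sum>i<R. \<Sum>j<R. (\<integral>x. complex_of_real (c i * c j) * (h (\<tau> (int i) x) * cnj (h (\<tau>
              (int j) x))) \<partial>M))"
        unfolding D by simp
      also have "\<dots> = (\<integral>x. (\<Sum>i<R. \<Sum>j<R. complex_of_real (c i * c j)
          * (h (\<tau> (int i) x) * cnj (h (\<tau> (int j) x)))) \<partial>M)"
        using i by (subst Bochner_Integration.integral_sum, auto
            intro!: Bochner_Integration.integrable_sum sum.cong simp del: of_real_mult)
      also have "\<dots> = (\<integral>x. complex_of_real ((cmod (\<Sum>i<R. c i * h (\<tau> (int i) x)))\<^sup>2) \<partial>M)"
        unfolding complex_norm_square by (simp add: sum_product ac_simps)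
      finally show ?thesis by (simp del: of_real_power)
    qed
    have "0 \<le> box_avg Hs (\<lambda>hs. Re (\<Sum>i<R. \<Sum>j<R. complex_of_real (c i * c j)
        * (\<integral>x. derivs hs (g i j) x \<partial>M)))"
      by (intro box_avg_nonneg pos)
    also have "\<dots> = (\<Sum>i<R. \<Sum>j<R. c i * c j * Re (box_avg Hs (\<lambda>hs. \<integral>x. derivs hs (g i j) x \<partial>M)))"
      unfolding Re_box_avg[symmetric] box_avg_sum box_avg_cmult by simp
    also have "\<dots> \<le> (\<Sum>i<R. \<Sum>j<R. c i * c j * seminorm_pow s (g i j) + \<bar>c i * c j\<bar> * \<delta>)"
    proof (intro sum_mono)
      fix i j assume "i \<in> {..<R}" "j \<in> {..<R}"
      then have "\<bar>Re (box_avg Hs (\<lambda>hs. \<integral>x. derivs hs (g i j) x \<partial>M)) - seminorm_pow s (g i j)\<bar> \<le> \<delta>"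
        using Hs[of i j] abs_Re_le_cmod order_trans by (fastforce simp del: box_avg.simps)
      then have "\<bar>c i * c j * (Re (box_avg Hs (\<lambda>hs. \<integral>x. derivs hs (g i j) x \<partial>M))
          - seminorm_pow s (g i j))\<bar> \<le> \<bar>c i * c j\<bar> * \<delta>"
        unfolding abs_mult by (intro mult_left_mono) auto
      then show "c i * c j * Re (box_avg Hs (\<lambda>hs. \<integral>x. derivs hs (g i j) x \<partial>M))
          \<le> c i * c j * seminorm_pow s (g i j) + \<bar>c i * c j\<bar> * \<delta>"
        by (simp add: right_diff_distrib abs_le_iff)
    qed
    also have "\<dots> = (\<Sum>i<R. \<Sum>j<R. c i * c j * seminorm_pow s (g i j)) + \<delta> * B"
      unfolding B_def by (simp add: sum.distrib sum_distrib_left mult.commute)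
    finally show ?thesis by simp
  qed
  have "0 \<le> (\<Sum>i<R. \<Sum>j<R. c i * c j * seminorm_pow s (g i j))"
  proof (rule field_le_epsilon)
    fix \<epsilon> :: real assume "\<epsilon> > 0"
    have "\<epsilon> / (B + 1) * B \<le> \<epsilon>" using B \<open>\<epsilon> > 0\<close> by (simp add: field_simps)
    with almost[of "\<epsilon> / (B + 1)"] B \<open>\<epsilon> > 0\<close>
    show "0 \<le> (\<Sum>i<R. \<Sum>j<R. c i * c j * seminorm_pow s (g i j)) + \<epsilon>" by simp
  qed
  then show "0 \<le> (\<Sum>i<R. \<Sum>j<R. c i * c j * seminorm_pow s (deriv_by ((i - j) + (j - i)) f))"
    unfolding eq .
qed

text \<open>The second bound holds for every single \<open>N\<close>, not only in the limit. In
  degree zero it bounds \<open>seminorm_pow 1\<close> by averages of squared correlations, which is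
  the input of the inverse theorem.\<close>

lemma seminorm_pow_lim_aux:
  assumes "seminorm_regular s" "f \<in> unit_funs M"
  shows "(\<lambda>N. (\<Sum>n=1..N. seminorm_pow s (deriv_by n f)) / real N) \<longlonglongrightarrow> seminorm_pow (Suc s) f"
    and "N \<ge> 1 \<Longrightarrow> seminorm_pow (Suc s) f \<le>
      (\<Sum>i=1..N. \<Sum>j=1..N. seminorm_pow s (\<lambda>x. f (\<tau> (int i) x) * cnj (f (\<tau> (int j) x)))) /
          (real N * real N)"
proof -
  interpret pos_def_seq "\<lambda>n. seminorm_pow s (deriv_by n f)"
    using assms by (rule seminorm_pow_pos_def)
  have *: "(\<lambda>N. (\<Sum>n=1..N. seminorm_pow s (deriv_by n f)) / real N) \<longlonglongrightarrow> top_mean"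
    using mean_tendsto unfolding mean_def .
  then have "seminorm_pow (Suc s) f = top_mean" by (simp add: limI)
  with * show "(\<lambda>N. (\<Sum>n=1..N. seminorm_pow s (deriv_by n f)) / real N) \<longlonglongrightarrow> seminorm_pow (Suc s) f"
      by simp
  show "seminorm_pow (Suc s) f \<le>
      (\<Sum>i=1..N. \<Sum>j=1..N. seminorm_pow s (\<lambda>x. f (\<tau> (int i) x) * cnj (f (\<tau> (int j) x)))) /
          (real N * real N)"
    if "N \<ge> 1"
    unfolding seminorm_pow_translates[OF assms(2)] \<open>seminorm_pow (Suc s) f = top_mean\<close>
    using top_mean_le_corr[OF that] by (simp add: corr_def)
qed

lemma seminorm_regular: "seminorm_regular s"
proof (induction s)
  case 0
  show ?case unfolding seminorm_regular_def
  proof (intro ballI conjI allI impI)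
    fix f assume f: "f \<in> unit_funs M"
    show "0 \<le> seminorm_pow 0 f" by simp
    show "seminorm_pow 0 f \<le> 1" using norm_integral_le[OF unit_funs_le[OF f]]
        by (simp add: power_le_one)
    fix \<delta> :: real assume "\<delta> > 0"
    have "\<forall>\<^sub>F N in sequentially. dist (avg {1..N} (\<lambda>n. \<integral>x. f (\<tau> (int n) x) * cnj (f x) \<partial>M))
        (complex_of_real ((cmod (\<integral>x. f x \<partial>M))\<^sup>2)) < \<delta>"
      by (intro tendstoD[OF mean_ergodic[OF f]] \<open>\<delta> > 0\<close>)
    then show "nested_ev (Suc 0) (\<lambda>Hs. cmod (box_avg Hs (\<lambda>hs. \<integral>x. derivs hs f x \<partial>M)
        - complex_of_real (seminorm_pow 0 f)) \<le> \<delta>)"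
      unfolding nested_ev.simps
      by eventually_elim (simp add: avg_def dist_norm deriv_by_eq)
  qed
next
  case (Suc s)
  note lim = seminorm_pow_lim_aux(1)[OF Suc.IH]
  have bounds: "0 \<le> seminorm_pow s (deriv_by n f) \<and> seminorm_pow s (deriv_by n f) \<le> 1"
      if "f \<in> unit_funs M" for f n
    using Suc.IH deriv_by_unit[OF that] unfolding seminorm_regular_def by auto
  show ?case unfolding seminorm_regular_def
  proof (intro ballI conjI allI impI)
    fix f assume f: "f \<in> unit_funs M"
    show "0 \<le> seminorm_pow (Suc s) f"
      using bounds[OF f] by (intro tendsto_lowerbound[OF lim[OF f]] always_eventually allI
          divide_nonneg_nonneg sum_nonneg) auto
    have "(\<Sum>n=1..N. seminorm_pow s (deriv_by n f)) / real N \<le> 1" for N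
    proof -
      have "(\<Sum>n=1..N. seminorm_pow s (deriv_by n f)) \<le> (\<Sum>n=1..N. 1)"
        using bounds[OF f] by (intro sum_mono) auto
      then show ?thesis by (simp add: divide_le_eq)
    qed
    then show "seminorm_pow (Suc s) f \<le> 1"
      by (intro tendsto_upperbound[OF lim[OF f]] always_eventually) auto
    fix \<delta> :: real assume "\<delta> > 0"
    show "nested_ev (Suc (Suc s)) (\<lambda>Hs. cmod (box_avg Hs (\<lambda>hs. \<integral>x. derivs hs f x \<partial>M)
        - complex_of_real (seminorm_pow (Suc s) f)) \<le> \<delta>)"
      using Suc.IH f \<open>\<delta> > 0\<close> unfolding seminorm_regular_def
      by (intro nested_step[where V = "\<lambda>g. \<integral>x. g x \<partial>M"] lim) auto
  qed
qed

lemmas seminorm_pow_lim = seminorm_pow_lim_aux(1)[OF seminorm_regular]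
lemmas seminorm_pow_le_corr = seminorm_pow_lim_aux(2)[OF seminorm_regular]

lemma seminorm_pow_bounds:
  "f \<in> unit_funs M \<Longrightarrow> 0 \<le> seminorm_pow s f" "f \<in> unit_funs M \<Longrightarrow> seminorm_pow s f \<le> 1"
  using seminorm_regular[of s] unfolding seminorm_regular_def by auto

lemma seminorm_pow_nested:
  assumes "f \<in> unit_funs M" "\<delta> > 0"
  shows "nested_ev t (\<lambda>Hs. \<bar>box_avg Hs (\<lambda>hs. seminorm_pow s (derivs hs f))
      - seminorm_pow (s + t) f\<bar> \<le> \<delta>)"
  using assms
proof (induction t arbitrary: f \<delta>)
  case (Suc t)
  have "nested_ev (Suc t) (\<lambda>Hs. norm (box_avg Hs (\<lambda>hs. seminorm_pow s (derivs hs f))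
      - of_real (seminorm_pow (Suc (s + t)) f)) \<le> \<delta>)"
    using Suc by (intro nested_step[where V = "seminorm_pow s"] seminorm_pow_lim) auto
  then show ?case by simp
qed simp

end

subsection \<open>Eigenfunctions and the inverse theorem\<close>

lemma e_add: "e (s + t) = e s * e t"
  by (simp add: e_def distrib_left exp_add)

lemma e_0 [simp]: "e 0 = 1"
  by (simp add: e_def)

lemma norm_e [simp]: "cmod (e t) = 1"
  using norm_exp_i_times[of "2 * pi * t"] by (simp add: e_def mult_ac)

lemma e_nonzero [simp]: "e t \<noteq> 0"
  by (simp add: e_def)

lemma cnj_e: "cnj (e t) = e (- t)"
  by (simp add: e_def exp_cnj)

lemma e_minus_mult [simp]: "e (- t) * e t = 1"
  using e_add[of "-t" t] by simp

lemma e_eq_1_iff: "e t = 1 \<longleftrightarrow> t \<in> \<int>"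
proof -
  have "e t = 1 \<longleftrightarrow> (\<exists>n::int. t = of_int n)"
    unfolding e_def exp_eq_1 by (auto simp: mult_ac)
  then show ?thesis by (auto simp: Ints_def)
qed

lemma e_of_int [simp]: "e (of_int n) = 1"
  by (simp add: e_eq_1_iff)

lemma e_frac: "e (frac t) = e t"
  using e_add[of "frac t" "of_int \<lfloor>t\<rfloor>"] by (simp add: frac_def)

lemma e_power: "e t ^ n = e (real n * t)"
  by (induction n) (auto simp: e_add distrib_right)

lemma continuous_on_e [continuous_intros]: "continuous_on A g \<Longrightarrow> continuous_on A (\<lambda>t. e (g t))"
  unfolding e_def by (intro continuous_intros)

lemma avg_diff_cmult: "avg A f - c * avg A g = avg A (\<lambda>j. f j - c * g j)"
  by (simp add: avg_def sum_subtractf sum_distrib_left diff_divide_distrib)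

lemma int_dvd_small_iff: "\<bar>m\<bar> < int R \<Longrightarrow> int R dvd m \<longleftrightarrow> m = 0"
  using dvd_imp_le_int[of m "int R"] by auto

lemma sum_e_roots:
  assumes "R > 0"
  shows "(\<Sum>r<R. e (of_int m * (real r / real R))) = (if int R dvd m then of_nat R else 0)"
proof -
  define z where "z = e (of_int m / real R)"
  have pow: "e (of_int m * (real r / real R)) = z ^ r" for r
    unfolding z_def e_power by (simp add: field_simps)
  have "z ^ R = 1" unfolding pow[symmetric] using assms by simp
  have iff: "z = 1 \<longleftrightarrow> int R dvd m"
  proof
    assume "z = 1"
    then obtain k where "of_int m / real R = of_int k" unfolding z_def e_eq_1_iff
        by (auto elim: Ints_cases)
    then have "(of_int m :: real) = of_int (int R * k)" using assms by (simp add: field_simps)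
    then show "int R dvd m" unfolding of_int_eq_iff by simp
  next
    assume "int R dvd m"
    then show "z = 1" using assms unfolding z_def e_eq_1_iff by (auto elim!: dvdE)
  qed
  show ?thesis
  proof (cases "z = 1")
    case True
    then show ?thesis unfolding pow using iff by simp
  next
    case False
    then have "(\<Sum>r<R. z ^ r) = 0" using geometric_sum[of z R] \<open>z ^ R = 1\<close> by simp
    then show ?thesis unfolding pow using False iff by simp
  qed
qed

context ergodic_action begin

text \<open>Modulus one is required at every point and the eigenvalue relation only almost
  everywhere, so factors cancel pointwise in products. The exponent \<open>t\<close> is any real
  number, since exponents add under multiplication.\<close>

definition eigenfun :: "('a \<Rightarrow> complex) \<Rightarrow> bool" where
  "eigenfun \<xi> \<longleftrightarrow> \<xi> \<in> borel_measurable M \<and> (\<forall>x. cmod (\<xi> x) = 1) \<and>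
     (\<exists>t. AE x in M. \<xi> (\<tau> 1 x) = e t * \<xi> x)"

lemma eigenfun_unit: "eigenfun \<xi> \<Longrightarrow> \<xi> \<in> unit_funs M"
  by (simp add: eigenfun_def unit_funs_def)

lemma eigenfun_norm: "eigenfun \<xi> \<Longrightarrow> cmod (\<xi> x) = 1"
  by (simp add: eigenfun_def)

lemma eigenfun_const: "cmod c = 1 \<Longrightarrow> eigenfun (\<lambda>_. c)"
  unfolding eigenfun_def by (auto intro!: exI[of _ 0])

lemma eigenfun_mult:
  assumes "eigenfun \<xi>" "eigenfun \<psi>" shows "eigenfun (\<lambda>x. \<xi> x * \<psi> x)"
proof -
  obtain s where s: "AE x in M. \<xi> (\<tau> 1 x) = e s * \<xi> x" using assms(1) by (auto simp: eigenfun_def)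
  obtain t where t: "AE x in M. \<psi> (\<tau> 1 x) = e t * \<psi> x" using assms(2) by (auto simp: eigenfun_def)
  from s t have "AE x in M. \<xi> (\<tau> 1 x) * \<psi> (\<tau> 1 x) = e (s + t) * (\<xi> x * \<psi> x)"
    by eventually_elim (simp add: e_add)
  then show ?thesis using assms by (auto simp: eigenfun_def norm_mult)
qed

lemma eigenfun_cnj:
  assumes "eigenfun \<xi>" shows "eigenfun (\<lambda>x. cnj (\<xi> x))"
proof -
  obtain s where s: "AE x in M. \<xi> (\<tau> 1 x) = e s * \<xi> x" using assms(1) by (auto simp: eigenfun_def)
  then have "AE x in M. cnj (\<xi> (\<tau> 1 x)) = e (- s) * cnj (\<xi> x)"
    by eventually_elim (simp add: cnj_e)
  then show ?thesis using assms by (auto simp: eigenfun_def intro: borel_measurable_cnj)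
qed

lemma eigenfun_action:
  assumes "eigenfun \<xi>" shows "eigenfun (\<lambda>x. \<xi> (\<tau> n x))"
proof -
  obtain s where s: "AE x in M. \<xi> (\<tau> 1 x) = e s * \<xi> x" using assms(1) by (auto simp: eigenfun_def)
  from AE_action[OF this, of n] have "AE x in M. \<xi> (\<tau> n (\<tau> 1 x)) = e s * \<xi> (\<tau> n x)"
    by (simp add: action_add add.commute)
  then show ?thesis using assms by (auto simp: eigenfun_def
      intro: measurable_compose[OF action_measurable])
qed

lemma eigenfun_cube:
  assumes "\<And>hs. eigenfun (\<xi> hs)" shows "eigenfun (\<lambda>x. cube ps (\<lambda>hs. \<xi> hs x))"
  using assms
proof (induction ps arbitrary: \<xi>)
  case (Cons p ps)
  show ?case unfolding cube.simps by (intro Cons.IH eigenfun_mult eigenfun_cnj Cons.prems)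
qed simp

lemma eigenfun_const_or_mean_zero:
  assumes \<xi>: "eigenfun \<xi>" and t: "AE x in M. \<xi> (\<tau> 1 x) = e t * \<xi> x"
  shows "e t = 1 \<Longrightarrow> AE x in M. \<xi> x = (\<integral>x. \<xi> x \<partial>M)" "e t \<noteq> 1 \<Longrightarrow> (\<integral>x. \<xi> x \<partial>M) = 0"
proof -
  have [measurable]: "\<xi> \<in> borel_measurable M" using \<xi> by (simp add: eigenfun_def)
  have "(\<integral>x. \<xi> x \<partial>M) = (\<integral>x. e t * \<xi> x \<partial>M)"
    unfolding integral_action[of \<xi> 1, OF \<open>\<xi> \<in> borel_measurable M\<close>, symmetric]
    using t by (subst (1) integral_cong_AE[OF _ _ t]) (auto simp: integral_action)
  then show "e t \<noteq> 1 \<Longrightarrow> (\<integral>x. \<xi> x \<partial>M) = 0" by simp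
  assume "e t = 1"
  then obtain c where c: "AE x in M. \<xi> x = c"
    using ergodic[OF eigenfun_unit[OF \<xi>]] t by auto
  then show "AE x in M. \<xi> x = (\<integral>x. \<xi> x \<partial>M)"
    using integral_AE_const[OF unit_funs_subset[OF eigenfun_unit[OF \<xi>]] c] by simp
qed

lemma eigenfun_nonzero_mean:
  assumes "eigenfun \<xi>" "(\<integral>x. \<xi> x \<partial>M) \<noteq> 0"
  shows "AE x in M. \<xi> x = (\<integral>x. \<xi> x \<partial>M)"
proof -
  obtain t where "AE x in M. \<xi> (\<tau> 1 x) = e t * \<xi> x" using assms(1) by (auto simp: eigenfun_def)
  from eigenfun_const_or_mean_zero[OF assms(1) this] assms(2) show ?thesis by auto
qed

section \<open>Spectral energies and the inverse theorem\<close>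

definition autocorr :: "('a \<Rightarrow> complex) \<Rightarrow> int \<Rightarrow> complex" where
  "autocorr f d = (\<integral>x. f (\<tau> d x) * cnj (f x) \<partial>M)"

text \<open>In spectral terms, the integral of a normalised Fejer kernel centred at \<open>t\<close>
  against the spectral measure of \<open>f\<close>; \<open>twisted_energy_eq\<close> writes it as a
  trigonometric polynomial in \<open>t\<close>.\<close>

definition twisted_energy :: "('a \<Rightarrow> complex) \<Rightarrow> nat \<Rightarrow> real \<Rightarrow> real" where
  "twisted_energy f N t = (\<integral>x. (cmod (avg {1..N} (\<lambda>j. e (- real j * t) * f (\<tau> (int j) x))))\<^sup>2 \<partial>M)"

lemma autocorr_eq:
  assumes f: "f \<in> unit_funs M"
  shows "(\<integral>x. f (\<tau> i x) * cnj (f (\<tau> j x)) \<partial>M) = autocorr f (i - j)"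
proof -
  have "(\<integral>x. f (\<tau> i x) * cnj (f (\<tau> j x)) \<partial>M) = (\<integral>x. f (\<tau> (i - j) (\<tau> j x)) * cnj (f (\<tau> j x)) \<partial>M)"
    by (simp add: action_add)
  also have "\<dots> = autocorr f (i - j)" unfolding autocorr_def
    by (subst integral_action[where f = "\<lambda>x. f (\<tau> (i - j) x) * cnj (f x)"])
       (auto intro!: unit_funs_measurable unit_funs_mult unit_funs_action unit_funs_cnj f)
  finally show ?thesis .
qed

lemma twisted_energy_eq:
  assumes f: "f \<in> unit_funs M"
  shows "complex_of_real (twisted_energy f N t)
    = (\<Sum>j=1..N. \<Sum>k=1..N. autocorr f (int j - int k) * e (of_int (int k - int j) * t)) /
        (of_nat N * of_nat N)"
proof -
  have i: "integrable M (\<lambda>x. e (of_int (int k - int j) * t)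
      * (f (\<tau> (int j) x) * cnj (f (\<tau> (int k) x))))" for j k
    by (intro bounded_funs_integrable bounded_funs_cmult bounded_funs_mult bounded_funs_cnj
        bounded_funs_action unit_funs_subset[OF f])
  have "complex_of_real (twisted_energy f N t)
      = (\<integral>x. (\<Sum>j=1..N. \<Sum>k=1..N. e (of_int (int k - int j) * t) * (f (\<tau> (int j) x) * cnj (f (\<tau>
          (int k) x)))) / (of_nat N * of_nat N) \<partial>M)"
    unfolding twisted_energy_def integral_complex_of_real[symmetric]
  proof (intro Bochner_Integration.integral_cong refl)
    fix x
    have "e (- real j * t) * cnj (e (- real k * t)) = e (of_int (int k - int j) * t)" for j k
      unfolding cnj_e e_add[symmetric] by (simp add: algebra_simps)
    then show "complex_of_real ((cmod (avg {1..N} (\<lambda>j. e (- real j * t) * f (\<tau> (int j) x))))\<^sup>2)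
       = (\<Sum>j=1..N. \<Sum>k=1..N. e (of_int (int k - int j) * t) * (f (\<tau> (int j) x) * cnj (f (\<tau>
           (int k) x)))) / (of_nat N * of_nat N)"
      unfolding complex_norm_square avg_def
      by (simp add: sum_product mult.assoc mult.left_commute flip: of_nat_mult) (simp add: mult_ac)
  qed
  also have "\<dots> = (\<Sum>j=1..N. \<Sum>k=1..N. e (of_int (int k - int j) * t)
      * (\<integral>x. f (\<tau> (int j) x) * cnj (f (\<tau> (int k) x)) \<partial>M)) / (of_nat N * of_nat N)"
    using i by simp
  finally show ?thesis unfolding autocorr_eq[OF f] by (simp add: mult.commute)
qed

lemma norm_autocorr_le: "f \<in> unit_funs M \<Longrightarrow> cmod (autocorr f d) \<le> 1"
  unfolding autocorr_def using unit_funs_le[of f M]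
  by (intro norm_integral_le) (auto simp: norm_mult intro!: mult_le_one)

lemma twisted_energy_nonneg: "0 \<le> twisted_energy f N t"
  by (simp add: twisted_energy_def)

text \<open>Pairing the Fejer-type polynomials \<open>twisted_energy f N\<close> and \<open>twisted_energy f (2 * N)\<close>
  over the multiples of \<open>1 / (3 * N)\<close>; their frequencies differ by less than \<open>3 * N\<close>, so there
  is no aliasing.\<close>
lemma twisted_energy_large:
  assumes f: "f \<in> unit_funs M" and N: "N \<ge> 1"
  shows "\<exists>t\<in>{0..1}. seminorm_pow 1 f / 2 \<le> twisted_energy f N t"
proof -
  define K where "K = 2 * N"
  define R where "R = 3 * N"
  define \<beta> where "\<beta> = autocorr f"
  define q where "q r = twisted_energy f N (real r / real R)" for r :: nat
  define p where "p r = twisted_energy f K (real r / real R)" for r :: nat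
  have pos: "K > 0" "R > 0" using N by (auto simp: K_def R_def)
  \<comment> \<open>The energy is real, so its coefficients may be conjugated; in the product with
    \<open>q\<close> matching frequencies then contribute a squared modulus of
    \<open>\<beta>\<close>.\<close>
  have p_eq: "complex_of_real (p r)
      = (\<Sum>i=1..K. \<Sum>j=1..K. cnj (\<beta> (int i - int j)) * e (of_int (int i - int j) *
          (real r / real R))) / (of_nat K * of_nat K)" for r
  proof -
    have "complex_of_real (p r) = cnj (complex_of_real (p r))" by simp
    then show ?thesis unfolding p_def twisted_energy_eq[OF f] \<beta>_def
      by (simp add: cnj_e) (simp add: algebra_simps minus_divide_left)
  qed
  \<comment> \<open>The nonnegative numbers \<open>p r\<close> are weights of total mass at most
    \<open>R / K\<close>. A lower bound for the weighted sum of \<open>q\<close> therefore makes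
    some \<open>q r\<close> large.\<close>
  have "complex_of_real (\<Sum>r<R. p r)
      = (\<Sum>i=1..K. \<Sum>j=1..K. cnj (\<beta> (int i - int j)) * (\<Sum>r<R. e (of_int (int i - int j) *
          (real r / real R)))) / (of_nat K * of_nat K)"
    unfolding of_real_sum p_eq sum_divide_distrib[symmetric]
    by (simp only: sum_distrib_left sum.swap[of _ "{..<R}"])
  also have "\<dots> = (\<Sum>i=1..K. \<Sum>j=1..K. if i = j then cnj (\<beta> 0) * of_nat R else 0)
      / (of_nat K * of_nat K)"
  proof (intro arg_cong2[where f = "(/)"] sum.cong refl)
    fix i j assume ij: "i \<in> {1..K}" "j \<in> {1..K}"
    have "int R dvd (int i - int j) \<longleftrightarrow> i = j"
      using ij by (subst int_dvd_small_iff) (auto simp: K_def R_def)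
    then show "cnj (\<beta> (int i - int j)) * (\<Sum>r<R. e (of_int (int i - int j) * (real r / real R)))
       = (if i = j then cnj (\<beta> 0) * of_nat R else 0)"
      unfolding sum_e_roots[OF pos(2)] by auto
  qed
  also have "\<dots> = cnj (\<beta> 0) * of_nat R / of_nat K"
    using pos by simp
  finally have "complex_of_real (\<Sum>r<R. p r) = cnj (\<beta> 0) * of_nat R / of_nat K" .
  then have "cmod (complex_of_real (\<Sum>r<R. p r)) \<le> real R / real K"
    using norm_autocorr_le[OF f, of 0]
        by (simp add: norm_mult norm_divide \<beta>_def divide_right_mono mult_left_le_one_le)
  then have sum_p: "(\<Sum>r<R. p r) \<le> real R / real K"
    unfolding norm_of_real by linarith
  have "complex_of_real (\<Sum>r<R. q r * p r)
      = (\<Sum>r<R. (\<Sum>j=1..N. \<Sum>k=1..N. \<Sum>i=1..K. \<Sum>i'=1..K. \<beta> (int j - int k) * cnj (\<beta> (int i - int i'))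
          * e (of_int (int k - int j + int i - int i') * (real r / real R))) /
              (of_nat N * of_nat N * of_nat K * of_nat K))"
    unfolding of_real_sum of_real_mult p_eq unfolding q_def twisted_energy_eq[OF f] \<beta>_def
  proof (intro sum.cong refl)
    fix r
    have e_comb: "e (of_int (int k - int j) * (real r / real R)) * e (of_int (int i - int i')
        * (real r / real R))
        = e (of_int (int k - int j + int i - int i') * (real r / real R))" for i i' j k
      unfolding e_add[symmetric] by (simp add: algebra_simps add_divide_distrib diff_divide_distrib)
    have "(\<Sum>j=1..N. \<Sum>k=1..N. autocorr f (int j - int k) * e (of_int (int k - int j)
        * (real r / real R)))
      * (\<Sum>i=1..K. \<Sum>i'=1..K. cnj (autocorr f (int i - int i')) * e (of_int (int i - int i') *
          (real r / real R)))
      = (\<Sum>j=1..N. \<Sum>k=1..N. \<Sum>i=1..K. \<Sum>i'=1..K. (autocorr f (int j - int k) * e (of_int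
          (int k - int j) * (real r / real R)))
         * (cnj (autocorr f (int i - int i')) * e (of_int (int i - int i') * (real r / real R))))"
      unfolding sum_distrib_right unfolding sum_distrib_left ..
    also have "\<dots> = (\<Sum>j=1..N. \<Sum>k=1..N. \<Sum>i=1..K. \<Sum>i'=1..K. autocorr f (int j - int k)
        * cnj (autocorr f (int i - int i'))
          * e (of_int (int k - int j + int i - int i') * (real r / real R)))"
      unfolding e_comb[symmetric] by (simp only: mult_ac)
    finally show "(\<Sum>j=1..N. \<Sum>k=1..N. autocorr f (int j - int k) * e (of_int (int k - int j)
        * (real r / real R))) / (of_nat N * of_nat N)
      * ((\<Sum>i=1..K. \<Sum>i'=1..K. cnj (autocorr f (int i - int i')) * e (of_int (int i - int i') *
          (real r / real R))) / (of_nat K * of_nat K))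
      = (\<Sum>j=1..N. \<Sum>k=1..N. \<Sum>i=1..K. \<Sum>i'=1..K. autocorr f (int j - int k) * cnj (autocorr f
          (int i - int i'))
          * e (of_int (int k - int j + int i - int i') * (real r / real R))) /
              (of_nat N * of_nat N * of_nat K * of_nat K)"
      by (simp only: times_divide_times_eq mult.assoc)
  qed
  also have "\<dots> = (\<Sum>j=1..N. \<Sum>k=1..N. \<Sum>i=1..K. \<Sum>i'=1..K. \<beta> (int j - int k) * cnj (\<beta> (int i - int i'))
          * (\<Sum>r<R. e (of_int (int k - int j + int i - int i') * (real r / real R)))) /
              (of_nat N * of_nat N * of_nat K * of_nat K)"
    unfolding sum_divide_distrib[symmetric] by (simp only: sum_distrib_left sum.swap[of _ "{..<R}"])
  also have "\<dots> = (\<Sum>j=1..N. \<Sum>k=1..N. \<Sum>i=1..K. \<Sum>i'=1..K.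
       complex_of_real (if int i - int i' = int j - int k then real R * (cmod (\<beta>
           (int j - int k)))\<^sup>2 else 0)) / (of_nat N * of_nat N * of_nat K * of_nat K)"
  proof (intro arg_cong2[where f = "(/)"] sum.cong refl)
    fix i i' j k assume *: "j \<in> {1..N}" "k \<in> {1..N}" "i \<in> {1..K}" "i' \<in> {1..K}"
    have "int R dvd (int k - int j + int i - int i') \<longleftrightarrow> int i - int i' = int j - int k"
      using * by (subst int_dvd_small_iff) (auto simp: K_def R_def)
    then show "\<beta> (int j - int k) * cnj (\<beta> (int i - int i'))
        * (\<Sum>r<R. e (of_int (int k - int j + int i - int i') * (real r / real R)))
        = complex_of_real (if int i - int i' = int j - int k then real R * (cmod (\<beta>
            (int j - int k)))\<^sup>2 else 0)"
      unfolding sum_e_roots[OF pos(2)]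
          by (auto simp: complex_norm_square mult_ac simp del: of_real_power)
  qed
  finally have "complex_of_real (\<Sum>r<R. q r * p r)
      = complex_of_real ((\<Sum>j=1..N. \<Sum>k=1..N. \<Sum>i=1..K. \<Sum>i'=1..K.
       if int i - int i' = int j - int k then real R * (cmod (\<beta> (int j - int k)))\<^sup>2 else 0) /
           (real N * real N * real K * real K))"
    by (simp only: of_real_sum of_real_divide of_real_mult of_real_of_nat_eq)
  then have "(\<Sum>r<R. q r * p r) = (\<Sum>j=1..N. \<Sum>k=1..N. \<Sum>i=1..K. \<Sum>i'=1..K.
       if int i - int i' = int j - int k then real R * (cmod (\<beta> (int j - int k)))\<^sup>2 else 0) /
           (real N * real N * real K * real K)"
    unfolding of_real_eq_iff .
  also have "\<dots> \<ge> (\<Sum>j=1..N. \<Sum>k=1..N. real N * (real R * (cmod (\<beta> (int j - int k)))\<^sup>2))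
      / (real N * real N * real K * real K)"
  proof (intro divide_right_mono sum_mono)
    fix j k assume jk: "j \<in> {1..N}" "k \<in> {1..N}"
    define v where "v = real R * (cmod (\<beta> (int j - int k)))\<^sup>2"
    have v: "v \<ge> 0" by (simp add: v_def)
    \<comment> \<open>The \<open>N\<close> pairs \<open>(j + s, k + s)\<close> all have the required
      difference, and they fit into the box because \<open>K = 2 * N\<close>. The ratio
      \<open>N / K\<close> is the factor 1/2 in the statement.\<close>
    have "real N * v = (\<Sum>x\<in>(\<lambda>s. (j + s, k + s)) ` {1..N}. v)"
      by (subst sum.reindex) (auto simp: inj_on_def)
    also have "\<dots> = (\<Sum>(i,i')\<in>(\<lambda>s. (j + s, k + s)) ` {1..N}. if int i - int i'
        = int j - int k then v else 0)"
      by (intro sum.cong) auto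
    also have "\<dots> \<le> (\<Sum>(i,i')\<in>{1..K}\<times>{1..K}. if int i - int i' = int j - int k then v else 0)"
      using jk v by (intro sum_mono2) (auto simp: K_def)
    finally show "real N * v \<le> (\<Sum>i=1..K. \<Sum>i'=1..K. if int i - int i' = int j - int k then v else 0)"
      by (simp add: sum.cartesian_product)
  qed simp
  finally have "(\<Sum>j=1..N. \<Sum>k=1..N. real N * (real R * (cmod (\<beta> (int j - int k)))\<^sup>2))
      / (real N * real N * real K * real K) \<le> (\<Sum>r<R. q r * p r)" .
  also have "(\<Sum>j=1..N. \<Sum>k=1..N. real N * (real R * (cmod (\<beta> (int j - int k)))\<^sup>2))
      / (real N * real N * real K * real K)
      = ((\<Sum>j=1..N. \<Sum>k=1..N. (cmod (\<beta> (int j - int k)))\<^sup>2) / (real N * real N)) *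
          (real R / real K) / 2"
    using N unfolding sum_distrib_left[symmetric] by (simp add: K_def field_simps)
  finally have "((\<Sum>j=1..N. \<Sum>k=1..N. (cmod (\<beta> (int j - int k)))\<^sup>2) / (real N * real N))
      * (real R / real K) / 2 \<le> (\<Sum>r<R. q r * p r)" .
  moreover have "seminorm_pow 1 f \<le> (\<Sum>j=1..N. \<Sum>k=1..N. (cmod (\<beta> (int j - int k)))\<^sup>2)
      / (real N * real N)"
    using seminorm_pow_le_corr[OF f N, of 0] by (simp add: autocorr_eq[OF f] \<beta>_def)
  ultimately have lower: "seminorm_pow 1 f / 2 * (real R / real K) \<le> (\<Sum>r<R. q r * p r)"
    using pos by (smt (verit) divide_right_mono mult_right_mono divide_nonneg_nonneg
        of_nat_0_le_iff times_divide_eq_left)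
  define m where "m = Max (q ` {..<R})"
  have m: "q r \<le> m" if "r < R" for r unfolding m_def using that by (intro Max_ge) auto
  have "m \<in> q ` {..<R}" unfolding m_def using pos by (intro Max_in) auto
  then obtain r where r: "r < R" "q r = m" by auto
  have "(\<Sum>r<R. q r * p r) \<le> (\<Sum>r<R. m * p r)"
    using m by (intro sum_mono mult_right_mono) (auto simp: p_def twisted_energy_nonneg)
  also have "\<dots> = m * (\<Sum>r<R. p r)" by (simp add: sum_distrib_left)
  also have "\<dots> \<le> m * (real R / real K)"
    using sum_p r by (intro mult_left_mono) (auto simp: q_def twisted_energy_nonneg)
  finally have "seminorm_pow 1 f / 2 * (real R / real K) \<le> m * (real R / real K)" using lower
      by simp
  then have "seminorm_pow 1 f / 2 \<le> m" by (rule mult_right_le_imp_le) (use pos in simp)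
  then show ?thesis using r pos by (intro bexI[of _ "real r / real R"]) (auto simp: q_def)
qed

text \<open>The mean over \<open>2 * N\<close> terms is the midpoint of the mean over
  \<open>N\<close> terms and a rotated translate of it, which has the same norm.\<close>

lemma twisted_energy_double:
  assumes f: "f \<in> unit_funs M" and N: "N \<ge> 1"
  shows "twisted_energy f (2 * N) t \<le> twisted_energy f N t"
proof -
  define A where "A x = avg {1..N} (\<lambda>j. e (- real j * t) * f (\<tau> (int j) x))" for x
  have A: "A \<in> unit_funs M" unfolding A_def
    by (intro unit_funs_avg unit_funs_mult unit_funs_const unit_funs_action f) simp
  have split: "avg {1..2*N} (\<lambda>j. e (- real j * t) * f (\<tau> (int j) x))
      = (A x + e (- real N * t) * A (\<tau> (int N) x)) / 2" for x
  proof -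
    have "(\<Sum>j=1..2*N. e (- real j * t) * f (\<tau> (int j) x))
        = (\<Sum>j=1..N. e (- real j * t) * f (\<tau> (int j) x)) + (\<Sum>j=N+1..2*N. e (- real j * t) * f (\<tau>
            (int j) x))"
      by (subst sum.union_disjoint[symmetric]) (auto intro!: sum.cong)
    also have "(\<Sum>j=N+1..2*N. e (- real j * t) * f (\<tau> (int j) x))
        = (\<Sum>j=1..N. e (- real N * t) * (e (- real j * t) * f (\<tau> (int j) (\<tau> (int N) x))))"
      by (rule sum.reindex_bij_witness[of _ "\<lambda>j. j + N" "\<lambda>j. j - N"])
         (auto simp: action_add e_add[symmetric] of_nat_diff algebra_simps simp flip: mult.assoc)
    finally show ?thesis using N
      by (simp add: avg_def A_def sum_distrib_left add_divide_distrib mult.commute[of 2])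
  qed
  have mid: "(cmod ((u + v) / 2))\<^sup>2 \<le> ((cmod u)\<^sup>2 + (cmod v)\<^sup>2) / 2" for u v
  proof -
    have "(cmod ((u + v) / 2))\<^sup>2 \<le> ((cmod u + cmod v) / 2)\<^sup>2"
      by (intro power_mono) (auto simp: norm_divide intro: norm_triangle_ineq)
    also have "\<dots> \<le> ((cmod u)\<^sup>2 + (cmod v)\<^sup>2) / 2"
      using zero_le_power2[of "cmod u - cmod v"] by (simp add: power2_eq_square field_simps)
    finally show ?thesis .
  qed
  have int: "integrable M (\<lambda>x. (cmod (A x))\<^sup>2)" "integrable M (\<lambda>x. (cmod (A (\<tau> (int N) x)))\<^sup>2)"
    "integrable M (\<lambda>x. (cmod ((A x + e (- real N * t) * A (\<tau> (int N) x)) / 2))\<^sup>2)"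
    by (intro integrable_bounded_norm bounded_funs_divide bounded_funs_add bounded_funs_cmult
        bounded_funs_action unit_funs_subset[OF A])+
  have "twisted_energy f (2 * N) t
      = (\<integral>x. (cmod ((A x + e (- real N * t) * A (\<tau> (int N) x)) / 2))\<^sup>2 \<partial>M)"
    unfolding twisted_energy_def split ..
  also have "\<dots> \<le> (\<integral>x. ((cmod (A x))\<^sup>2 + (cmod (A (\<tau> (int N) x)))\<^sup>2) / 2 \<partial>M)"
  proof (intro integral_mono int)
    show "(cmod ((A x + e (- real N * t) * A (\<tau> (int N) x)) / 2))\<^sup>2
        \<le> ((cmod (A x))\<^sup>2 + (cmod (A (\<tau> (int N) x)))\<^sup>2) / 2" for x
      using mid[of "A x" "e (- real N * t) * A (\<tau> (int N) x)"] by (simp add: norm_mult)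
  qed (use int in auto)
  also have "\<dots> = ((\<integral>x. (cmod (A x))\<^sup>2 \<partial>M) + (\<integral>x. (cmod (A (\<tau> (int N) x)))\<^sup>2 \<partial>M)) / 2"
    using int by simp
  also have "(\<integral>x. (cmod (A (\<tau> (int N) x)))\<^sup>2 \<partial>M) = (\<integral>x. (cmod (A x))\<^sup>2 \<partial>M)"
    by (rule integral_action_real[where f = "\<lambda>x. (cmod (A x))\<^sup>2"]) (use A in \<open>auto
        dest: unit_funs_measurable\<close>)
  finally show ?thesis by (simp add: twisted_energy_def A_def)
qed

text \<open>The sets of good frequencies are nested along the powers of two by
  \<open>twisted_energy_double\<close>, so compactness yields one frequency for all these scales.
  This is the origin of the eigenvalue.\<close>

lemma twisted_energy_uniformly_large:
  assumes f: "f \<in> unit_funs M"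
  shows "\<exists>t. \<forall>k. seminorm_pow 1 f / 2 \<le> twisted_energy f (2 ^ k) t"
proof -
  define K where "K k = {t\<in>{0..1}. seminorm_pow 1 f / 2 \<le> twisted_energy f (2 ^ k) t}" for k :: nat
  have cont: "continuous_on UNIV (twisted_energy f N)" for N
  proof -
    have "twisted_energy f N = (\<lambda>t. Re ((\<Sum>j=1..N. \<Sum>k=1..N. autocorr f (int j - int k)
        * e (of_int (int k - int j) * t)) / (of_nat N * of_nat N)))"
      unfolding twisted_energy_eq[OF f, symmetric] by simp
    then show ?thesis
      by (cases "N = 0") (auto intro!: continuous_intros)
  qed
  have "(\<Inter>k\<in>UNIV. K k) \<noteq> {}"
  proof (rule compact_nest)
    show "compact (K k)" for k
    proof -
      have "closed {t. seminorm_pow 1 f / 2 \<le> twisted_energy f (2 ^ k) t}"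
        by (intro closed_Collect_le continuous_on_const cont)
      then have "compact ({0..1} \<inter> {t. seminorm_pow 1 f / 2 \<le> twisted_energy f (2 ^ k) t})"
        by (intro compact_Int_closed) auto
      then show ?thesis unfolding K_def Int_def by simp
    qed
    show "K k \<noteq> {}" for k
      using twisted_energy_large[OF f, of "2 ^ k"] by (auto simp: K_def)
    have "K (Suc k) \<subseteq> K k" for k
      using twisted_energy_double[OF f, of "2 ^ k"] by (fastforce simp: K_def intro: order_trans)
    then show "K n \<subseteq> K m" if "m \<le> n" for m n
      using lift_Suc_antimono_le[of K m n] that by blast
  qed
  then show ?thesis by (auto simp: K_def)
qed

text \<open>The eigenfunction is a weak limit of \<open>\<E>\<^bsub>i,j\<in>[N]\<^esub> e ((j - i) t) T\<^bsup>i-j\<^esup> f\<close>, whose inner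
  product with \<open>f\<close> is \<open>twisted_energy f N t\<close>.\<close>
theorem inverse_theorem:
  assumes f: "f \<in> unit_funs M"
  shows "\<exists>\<xi>. eigenfun \<xi> \<and> seminorm_pow 1 f / 2 \<le> Re (\<integral>x. f x * \<xi> x \<partial>M)"
proof (cases "seminorm_pow 1 f > 0")
  case False
  define z where "z = (\<integral>x. f x \<partial>M)"
  \<comment> \<open>Here only a nonnegative real part is wanted; the constant rotates the mean of
    \<open>f\<close> onto the nonnegative axis.\<close>
  define c where "c = (if z = 0 then 1 else cnj z / cmod z)"
  have "Re (\<integral>x. f x * c \<partial>M) = Re (z * c)" by (simp add: z_def)
  also have "\<dots> \<ge> 0"
  proof (cases "z = 0")
    case False
    have "z * c = complex_of_real ((cmod z)\<^sup>2) / cmod z" using False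
        by (simp add: c_def complex_norm_square del: of_real_power)
    then show ?thesis by simp
  qed simp
  finally show ?thesis using False
    by (intro exI[of _ "\<lambda>_. c"]) (auto intro!: eigenfun_const simp: c_def norm_divide)
next
  case True
  obtain t where t: "\<And>k. seminorm_pow 1 f / 2 \<le> twisted_energy f (2 ^ k) t"
    using twisted_energy_uniformly_large[OF f] by auto
  define g where "g i j x = e (of_int (int j - int i) * t) * f (\<tau> (int i - int j) x)" for i j x
  have g: "g i j \<in> unit_funs M" for i j unfolding g_def
    by (intro unit_funs_mult unit_funs_const unit_funs_action f) simp
  define F where "F k x = avg {1..2^k} (\<lambda>j. avg {1..2^k} (\<lambda>i. g i j x))" for k :: nat and x
  have F: "F k \<in> unit_funs M" for k unfolding F_def by (intro unit_funs_avg g)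
  obtain G where G: "weak_cluster F G" using weak_cluster_ex[of F] F by auto
  have Gu: "G \<in> unit_funs M" using G by (rule weak_cluster_unit)
  have [measurable]: "G \<in> borel_measurable M" "f \<in> borel_measurable M" using Gu f
      by (auto dest: unit_funs_measurable)
  have eig: "AE x in M. G (\<tau> 1 x) = e t * G x"
  proof (rule weak_cluster_eigen[OF G F])
    show "(\<lambda>k. 2 / 2 ^ k) \<longlonglongrightarrow> (0::real)"
      using tendsto_mult_left[OF LIMSEQ_inverse_realpow_zero[of 2], of 2]
          by (simp add: divide_inverse)
    fix k x
    define N :: nat where "N = 2 ^ k"
    have step: "g i j (\<tau> 1 x) = e t * g (Suc i) j x" for i j
    proof -
      have "e t * e (of_int (int j - int (Suc i)) * t) = e (of_int (int j - int i) * t)"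
        unfolding e_add[symmetric] by (simp add: algebra_simps)
      moreover have "\<tau> (int i - int j) (\<tau> 1 x) = \<tau> (int (Suc i) - int j) x"
        by (simp add: action_add algebra_simps)
      ultimately show ?thesis unfolding g_def by (simp only: mult.assoc[symmetric])
    qed
    have "avg {1..N} (\<lambda>i. g i j (\<tau> 1 x)) - e t * avg {1..N} (\<lambda>i. g i j x)
        = e t * (g (Suc N) j x - g 1 j x) / of_nat N" for j
    proof -
      have "(\<Sum>i=1..m. g (Suc i) j x) = (\<Sum>i=1..m. g i j x) + (g (Suc m) j x - g 1 j x)" for m
        by (induction m) auto
      then show ?thesis unfolding avg_def step sum_distrib_left[symmetric]
        by (simp add: add_divide_distrib distrib_left diff_divide_distrib right_diff_distrib)
    qed
    note diff = this
    have "F k (\<tau> 1 x) - e t * F k x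
        = avg {1..N} (\<lambda>j. avg {1..N} (\<lambda>i. g i j (\<tau> 1 x)) - e t * avg {1..N} (\<lambda>i. g i j x))"
      unfolding F_def N_def[symmetric] avg_diff_cmult ..
    also have "\<dots> = avg {1..N} (\<lambda>j. e t * (g (Suc N) j x - g 1 j x) / of_nat N)"
      unfolding diff ..
    also have "cmod \<dots> \<le> 2 / real N"
      unfolding avg_def
    proof (intro norm_mean_le)
      fix j
      show "cmod (e t * (g (Suc N) j x - g 1 j x) / of_nat N) \<le> 2 / real N"
        using norm_triangle_ineq4[of "g (Suc N) j x" "g 1 j x"] unit_funs_le[OF g, of
            "Suc N" j x] unit_funs_le[OF g, of 1 j x]
        by (simp add: norm_divide norm_mult divide_right_mono)
    qed simp
    finally show "cmod (F k (\<tau> 1 x) - e t * F k x) \<le> 2 / 2 ^ k" by (simp add: N_def)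
  qed
  have "Re (\<integral>x. (- cnj (f x)) * G x \<partial>M) \<le> - (seminorm_pow 1 f / 2)"
  proof (rule weak_cluster_le[OF G])
    show "(\<lambda>x. - cnj (f x)) \<in> bounded_funs M"
      using bounded_funs_cmult[OF bounded_funs_cnj[OF unit_funs_subset[OF f]], of "-1"] by simp
    have "Re (\<integral>x. - cnj (f x) * F k x \<partial>M) \<le> - (seminorm_pow 1 f / 2)" for k
    proof -
      define N :: nat where "N = 2 ^ k"
      have i: "integrable M (\<lambda>x. g i j x * cnj (f x))" for i j
        by (intro unit_funs_integrable unit_funs_mult unit_funs_cnj g f)
      have "(\<integral>x. F k x * cnj (f x) \<partial>M)
          = (\<integral>x. (\<Sum>j=1..N. \<Sum>i=1..N. g i j x * cnj (f x)) / (of_nat N * of_nat N) \<partial>M)"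
        unfolding F_def avg_def N_def[symmetric]
            by (simp add: sum_divide_distrib[symmetric] sum_distrib_right)
      also have "\<dots> = (\<Sum>j=1..N. \<Sum>i=1..N. \<integral>x. g i j x * cnj (f x) \<partial>M) / (of_nat N * of_nat N)"
        using i by simp
      also have "\<dots> = (\<Sum>j=1..N. \<Sum>i=1..N. autocorr f (int i - int j) * e (of_int (int j - int i)
          * t)) / (of_nat N * of_nat N)"
        unfolding g_def autocorr_def by (simp add: mult.assoc) (simp add: mult.commute)
      also have "\<dots> = complex_of_real (twisted_energy f N t)"
        unfolding twisted_energy_eq[OF f] by (subst sum.swap) simp
      finally have "(\<integral>x. F k x * cnj (f x) \<partial>M) = complex_of_real (twisted_energy f N t)" .
      then have "(\<integral>x. - cnj (f x) * F k x \<partial>M) = - complex_of_real (twisted_energy f N t)"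
        by (simp add: mult.commute)
      then show ?thesis using t[of k] by (simp add: N_def)
    qed
    then show "\<forall>\<^sub>F k in sequentially. Re (\<integral>x. - cnj (f x) * F k x \<partial>M) \<le> - (seminorm_pow 1 f / 2)"
        by simp
  qed
  then have corr: "seminorm_pow 1 f / 2 \<le> Re (\<integral>x. cnj (f x) * G x \<partial>M)" by simp
  \<comment> \<open>The modulus of \<open>G\<close> is invariant, hence constant. As the constant is
    at most one, normalising \<open>G\<close> can only increase the correlation.\<close>
  have "\<exists>c. AE x in M. complex_of_real (cmod (G x)) = c"
  proof (rule ergodic)
    show "(\<lambda>x. complex_of_real (cmod (G x))) \<in> unit_funs M"
      using unit_funs_le[OF Gu] by (auto simp: unit_funs_def)
    show "AE x in M. complex_of_real (cmod (G (\<tau> 1 x))) = complex_of_real (cmod (G x))"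
      using eig by eventually_elim (simp add: norm_mult)
  qed
  then obtain c where c: "AE x in M. complex_of_real (cmod (G x)) = c" by blast
  define r where "r = Re c"
  have r: "AE x in M. cmod (G x) = r" using c by eventually_elim (auto simp: r_def)
  have "r \<le> 1" "0 \<le> r"
  proof -
    have "AE x in M. r \<le> 1 \<and> 0 \<le> r" using r by eventually_elim (use unit_funs_le[OF Gu] in auto)
    then show "r \<le> 1" "0 \<le> r" by auto
  qed
  have "r \<noteq> 0"
  proof
    assume "r = 0"
    have "AE x in M. cnj (f x) * G x = 0" using r by eventually_elim (use \<open>r = 0\<close> in auto)
    then have "(\<integral>x. cnj (f x) * G x \<partial>M) = 0" by (rule integral_eq_zero_AE)
    with corr True show False by simp
  qed
  \<comment> \<open>Conjugated because the pairing in the statement has no conjugate, which turns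
    the exponent into \<open>- t\<close>. The value 1 on the null set where \<open>G\<close>
    vanishes keeps the modulus equal to one everywhere.\<close>
  define \<xi> where "\<xi> x = (if G x = 0 then 1 else cnj (G x) / cmod (G x))" for x
  have \<xi>_AE: "AE x in M. \<xi> x = cnj (G x) / r"
    using r by eventually_elim (use \<open>r \<noteq> 0\<close> in \<open>auto simp: \<xi>_def\<close>)
  have "eigenfun \<xi>" unfolding eigenfun_def
  proof (intro conjI exI allI)
    show "\<xi> \<in> borel_measurable M" unfolding \<xi>_def by measurable
    show "cmod (\<xi> x) = 1" for x by (simp add: \<xi>_def norm_divide)
    show "AE x in M. \<xi> (\<tau> 1 x) = e (- t) * \<xi> x"
      using \<xi>_AE AE_action[OF \<xi>_AE, of 1] eig by eventually_elim (simp add: cnj_e)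
  qed
  moreover have "seminorm_pow 1 f / 2 \<le> Re (\<integral>x. f x * \<xi> x \<partial>M)"
  proof -
    have [measurable]: "\<xi> \<in> borel_measurable M" unfolding \<xi>_def by measurable
    have "(\<integral>x. f x * \<xi> x \<partial>M) = (\<integral>x. cnj (cnj (f x) * G x) / r \<partial>M)"
    proof (rule integral_cong_AE)
      show "AE x in M. f x * \<xi> x = cnj (cnj (f x) * G x) / r" using \<xi>_AE by eventually_elim simp
    qed measurable
    also have "\<dots> = cnj (\<integral>x. cnj (f x) * G x \<partial>M) / r"
      by (simp del: complex_cnj_mult)
    finally have "Re (\<integral>x. f x * \<xi> x \<partial>M) = Re (\<integral>x. cnj (f x) * G x \<partial>M) / r" by simp
    also have "\<dots> \<ge> Re (\<integral>x. cnj (f x) * G x \<partial>M)"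
      using \<open>r \<le> 1\<close> \<open>0 \<le> r\<close> \<open>r \<noteq> 0\<close> corr True by (simp add: le_divide_eq mult_left_le)
    finally show ?thesis using corr by linarith
  qed
  ultimately show ?thesis by blast
qed

end

subsection \<open>Integrated box inequalities\<close>

lemma bounded_funs_cube:
  "(\<And>hs. u hs \<in> bounded_funs M) \<Longrightarrow> (\<lambda>x. cube ps (\<lambda>hs. u hs x)) \<in> bounded_funs M"
proof (induction ps arbitrary: u)
  case (Cons p ps)
  show ?case unfolding cube.simps
    by (rule Cons.IH) (intro bounded_funs_mult bounded_funs_cnj Cons.prems)
qed simp

lemma unit_funs_cube:
  "(\<And>hs. u hs \<in> unit_funs M) \<Longrightarrow> (\<lambda>x. cube ps (\<lambda>hs. u hs x)) \<in> unit_funs M"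
proof (induction ps arbitrary: u)
  case (Cons p ps)
  show ?case unfolding cube.simps
    by (rule Cons.IH) (intro unit_funs_mult unit_funs_cnj Cons.prems)
qed simp

lemma unit_funs_cube_rest:
  "(\<And>hs. u hs \<in> unit_funs M) \<Longrightarrow> (\<lambda>x. cube_rest ps (\<lambda>hs. u hs x)) \<in> unit_funs M"
proof (induction ps arbitrary: u)
  case (Cons p ps)
  show ?case unfolding cube_rest.simps
    by (intro unit_funs_mult unit_funs_cnj unit_funs_cube Cons.IH Cons.prems)
qed (simp add: unit_funs_const)

context prob_space begin

lemma integral_box_avg:
  assumes "\<And>hs. f hs \<in> bounded_funs M"
  shows "(\<integral>x. box_avg Hs (\<lambda>hs. f hs x) \<partial>M) = box_avg Hs (\<lambda>hs. \<integral>x. f hs x \<partial>M)"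
  using assms
proof (induction Hs arbitrary: f)
  case (Cons H Hs)
  have "integrable M (\<lambda>x. box_avg Hs (\<lambda>hs. f (h # hs) x))" for h
    by (intro bounded_funs_integrable bounded_funs_box_avg Cons.prems)
  then show ?case using Cons by simp
qed simp

lemma integral_square_le:
  fixes g :: "'a \<Rightarrow> real"
  assumes [measurable]: "g \<in> borel_measurable M" and g: "\<And>x. \<bar>g x\<bar> \<le> C"
  shows "(\<integral>x. g x \<partial>M)\<^sup>2 \<le> (\<integral>x. (g x)\<^sup>2 \<partial>M)"
proof -
  have 1: "integrable M g" using g by (intro integrable_const_bound[of _ C]) auto
  have "(g x)\<^sup>2 \<le> C\<^sup>2" for x using g[of x] by (metis abs_ge_zero power2_abs power_mono)
  then have 2: "integrable M (\<lambda>x. (g x)\<^sup>2)" by (intro integrable_const_bound[of _ "C\<^sup>2"]) auto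
  define m where "m = (\<integral>x. g x \<partial>M)"
  have "0 \<le> (\<integral>x. (g x - m)\<^sup>2 \<partial>M)" by simp
  also have "\<dots> = (\<integral>x. (g x)\<^sup>2 - 2 * m * g x + m\<^sup>2 \<partial>M)"
    by (intro Bochner_Integration.integral_cong refl) (simp add: power2_diff mult_ac)
  also have "\<dots> = (\<integral>x. (g x)\<^sup>2 \<partial>M) - m\<^sup>2"
    using 1 2 by (simp add: m_def[symmetric] prob_space power2_eq_square)
  finally show ?thesis by (simp add: m_def)
qed

lemma integral_power_le:
  fixes g :: "'a \<Rightarrow> real"
  assumes "g \<in> borel_measurable M" and "\<And>x. \<bar>g x\<bar> \<le> C"
  shows "(\<integral>x. g x \<partial>M) ^ (2 ^ k) \<le> (\<integral>x. (g x) ^ (2 ^ k) \<partial>M)"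
  using assms
proof (induction k arbitrary: g C)
  case (Suc k)
  have "(\<integral>x. g x \<partial>M) ^ (2 ^ Suc k) = ((\<integral>x. g x \<partial>M)\<^sup>2) ^ (2 ^ k)"
    by (simp add: power_mult)
  also have "\<dots> \<le> (\<integral>x. (g x)\<^sup>2 \<partial>M) ^ (2 ^ k)"
    by (intro power_mono integral_square_le[OF Suc.prems]) auto
  also have "\<dots> \<le> (\<integral>x. ((g x)\<^sup>2) ^ (2 ^ k) \<partial>M)"
  proof (rule Suc.IH)
    show "\<bar>(g x)\<^sup>2\<bar> \<le> C\<^sup>2" for x
      using Suc.prems(2)[of x] by (metis abs_ge_zero abs_power2 power2_abs power_mono)
  qed (use Suc.prems in auto)
  finally show ?case by (simp add: power_mult)
qed simp

text \<open>Convexity moves the power under the integral, and then the box inequality is applied at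
  each point.\<close>

lemma box_cauchy_schwarz_integral:
  assumes Hs: "0 \<notin> set Hs" and u: "\<And>hs. u hs \<in> bounded_funs M" and b: "\<And>hs. b hs \<in> bounded_funs M"
    and low: "\<And>x. low_complexity (length Hs) (\<lambda>hs. b hs x)"
  shows "(Re (box_avg Hs (\<lambda>hs. \<integral>x. u hs x * b hs x \<partial>M))) ^ (2 ^ length Hs)
    \<le> Re (pair_avg Hs (\<lambda>ps. \<integral>x. cube ps (\<lambda>hs. u hs x) \<partial>M))"
proof -
  define X where "X x = box_avg Hs (\<lambda>hs. u hs x * b hs x)" for x
  have X: "X \<in> bounded_funs M" unfolding X_def
    by (intro bounded_funs_box_avg bounded_funs_mult u b)
  obtain C where C: "C > 0" "\<And>x. cmod (X x) \<le> C" using X by (metis bounded_funsE)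
  have ReC: "\<bar>Re (X x)\<bar> \<le> C" for x using C(2)[of x] abs_Re_le_cmod order_trans by blast
  have meas: "(\<lambda>x. Re (X x)) \<in> borel_measurable M" using X by (auto dest: bounded_funs_measurable)
  have Y: "(\<lambda>x. pair_avg Hs (\<lambda>ps. cube ps (\<lambda>hs. u hs x))) \<in> bounded_funs M"
    unfolding pair_avg_eq_box_avg by (intro bounded_funs_box_avg bounded_funs_cube u)
  have "Re (box_avg Hs (\<lambda>hs. \<integral>x. u hs x * b hs x \<partial>M)) = (\<integral>x. Re (X x) \<partial>M)"
    unfolding integral_Re[OF bounded_funs_integrable[OF X]]
    unfolding X_def integral_box_avg[OF bounded_funs_mult[OF u b]] ..
  then have "(Re (box_avg Hs (\<lambda>hs. \<integral>x. u hs x * b hs x \<partial>M))) ^ (2 ^ length Hs)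
      \<le> (\<integral>x. (Re (X x)) ^ (2 ^ length Hs) \<partial>M)"
    using integral_power_le[OF meas ReC] by simp
  also have "\<dots> \<le> (\<integral>x. Re (pair_avg Hs (\<lambda>ps. cube ps (\<lambda>hs. u hs x))) \<partial>M)"
  proof (rule integral_mono)
    have "\<bar>Re (X x) ^ n\<bar> \<le> C ^ n" for x n
      unfolding power_abs by (intro power_mono ReC) simp
    then show "integrable M (\<lambda>x. Re (X x) ^ 2 ^ length Hs)"
      using meas by (intro integrable_const_bound[of _ "C ^ (2 ^ length Hs)"]) auto
    show "integrable M (\<lambda>x. Re (pair_avg Hs (\<lambda>ps. cube ps (\<lambda>hs. u hs x))))"
      by (intro integrable_Re bounded_funs_integrable Y)
    show "Re (X x) ^ 2 ^ length Hs \<le> Re (pair_avg Hs (\<lambda>ps. cube ps (\<lambda>hs. u hs x)))" for x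
      unfolding X_def by (rule box_cauchy_schwarz[OF Hs low])
  qed
  also have "\<dots> = Re (\<integral>x. pair_avg Hs (\<lambda>ps. cube ps (\<lambda>hs. u hs x)) \<partial>M)"
    by (intro integral_Re bounded_funs_integrable Y)
  also have "(\<integral>x. pair_avg Hs (\<lambda>ps. cube ps (\<lambda>hs. u hs x)) \<partial>M)
      = pair_avg Hs (\<lambda>ps. \<integral>x. cube ps (\<lambda>hs. u hs x) \<partial>M)"
    unfolding pair_avg_eq_box_avg
    by (simp add: integral_box_avg bounded_funs_box_avg bounded_funs_cube u)
  finally show ?thesis .
qed

text \<open>The previous inequality on the product space, using \<open>\<bar>\<integral> g\<bar>\<^sup>2 = \<integral> \<integral> g x * cnj (g y)\<close>.\<close>
lemma box_cauchy_schwarz_square: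
  assumes Hs: "0 \<notin> set Hs" and u: "\<And>hs. u hs \<in> bounded_funs M" and b: "\<And>hs. b hs \<in> bounded_funs M"
    and low: "\<And>x. low_complexity (length Hs) (\<lambda>hs. b hs x)"
  shows "(box_avg Hs (\<lambda>hs. (cmod (\<integral>x. u hs x * b hs x \<partial>M))\<^sup>2)) ^ (2 ^ length Hs)
    \<le> pair_avg Hs (\<lambda>ps. (cmod (\<integral>x. cube ps (\<lambda>hs. u hs x) \<partial>M))\<^sup>2)"
proof -
  interpret P: pair_prob_space M M ..
  have fst_bounded: "(\<lambda>z. g (fst z)) \<in> bounded_funs (M \<Otimes>\<^sub>M M)"
      and snd_bounded: "(\<lambda>z. g (snd z)) \<in> bounded_funs (M \<Otimes>\<^sub>M M)"
    if "g \<in> bounded_funs M" for g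
    using that by (auto simp: bounded_funs_def)
  have sq: "(\<integral>z. g (fst z) * cnj (g (snd z)) \<partial>(M \<Otimes>\<^sub>M M)) = complex_of_real ((cmod (\<integral>x. g x \<partial>M))\<^sup>2)"
    if g: "g \<in> bounded_funs M" for g
  proof -
    have "integrable (M \<Otimes>\<^sub>M M) (\<lambda>z. g (fst z) * cnj (g (snd z)))"
      by (intro P.P.bounded_funs_integrable bounded_funs_mult bounded_funs_cnj fst_bounded
          snd_bounded g)
    from P.integral_fst'[OF this] show ?thesis
      unfolding complex_norm_square by simp
  qed
  define U where "U hs z = u hs (fst z) * cnj (u hs (snd z))" for hs z
  define B where "B hs z = b hs (fst z) * cnj (b hs (snd z))" for hs z
  have UB: "U hs z * B hs z = (u hs (fst z) * b hs (fst z)) * cnj (u hs (snd z) * b hs (snd z))"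
      for hs z
    by (simp add: U_def B_def)
  have cubeU: "cube ps (\<lambda>hs. U hs z)
      = cube ps (\<lambda>hs. u hs (fst z)) * cnj (cube ps (\<lambda>hs. u hs (snd z)))" for ps z
    unfolding U_def cube_mult cube_cnj ..
  have "(Re (box_avg Hs (\<lambda>hs. \<integral>z. U hs z * B hs z \<partial>(M \<Otimes>\<^sub>M M)))) ^ (2 ^ length Hs)
    \<le> Re (pair_avg Hs (\<lambda>ps. \<integral>z. cube ps (\<lambda>hs. U hs z) \<partial>(M \<Otimes>\<^sub>M M)))"
  proof (rule P.P.box_cauchy_schwarz_integral[OF Hs])
    show "U hs \<in> bounded_funs (M \<Otimes>\<^sub>M M)" for hs
      unfolding U_def by (intro bounded_funs_mult bounded_funs_cnj fst_bounded snd_bounded u)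
    show "B hs \<in> bounded_funs (M \<Otimes>\<^sub>M M)" for hs
      unfolding B_def by (intro bounded_funs_mult bounded_funs_cnj fst_bounded snd_bounded b)
    show "low_complexity (length Hs) (\<lambda>hs. B hs z)" for z
      unfolding B_def by (intro low_complexity_mult low_complexity_cnj low)
  qed
  then show ?thesis
    unfolding UB cubeU sq[OF bounded_funs_mult[OF u b]] sq[OF bounded_funs_cube[OF u]] Re_pair_avg
        Re_box_avg Re_complex_of_real .
qed

end

subsection \<open>Degree lowering\<close>

text \<open>A box contains finitely many pairs, so bounds that hold eventually for each
  \<open>ps\<close> separately hold eventually for the average.\<close>

lemma eventually_pair_avg_mono:
  fixes \<phi> :: "'k \<Rightarrow> (nat \<times> nat) list \<Rightarrow> real"
  assumes "\<And>ps. \<forall>\<^sub>F k in L. \<phi> k ps \<le> \<psi> ps"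
  shows "\<forall>\<^sub>F k in L. pair_avg Hs (\<phi> k) \<le> pair_avg Hs \<psi>"
  using assms
proof (induction Hs arbitrary: \<phi> \<psi>)
  case (Cons H Hs)
  have "\<forall>\<^sub>F k in L. \<forall>p\<in>{1..H}\<times>{1..H}. pair_avg Hs (\<lambda>ps. \<phi> k (p # ps))
      \<le> pair_avg Hs (\<lambda>ps. \<psi> (p # ps))"
    by (intro eventually_ball_finite ballI Cons.IH Cons.prems) auto
  then show ?case
    by eventually_elim (auto intro!: divide_right_mono sum_mono)
qed simp

text \<open>In each row a positive distance occurs at most twice and the distance 0 once.\<close>

lemma sum_distance_le:
  fixes \<phi> :: "nat \<Rightarrow> real"
  assumes \<phi>: "\<And>n. 0 \<le> \<phi> n"
  shows "(\<Sum>h=1..H. \<Sum>h'=1..H. \<phi> ((h - h') + (h' - h))) / (real H * real H)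
    \<le> 2 * ((\<Sum>d=1..H. \<phi> d) / real H) + \<phi> 0 / real H"
proof (cases "H = 0")
  case False
  have row: "(\<Sum>h'=1..H. \<phi> ((h - h') + (h' - h))) \<le> 2 * (\<Sum>d=1..H. \<phi> d) + \<phi> 0" if h: "h \<in> {1..H}"
      for h
  proof -
    have "(\<Sum>h'=1..H. \<phi> ((h - h') + (h' - h)))
        = (\<Sum>h'\<in>{1..<h}. \<phi> ((h - h') + (h' - h))) + (\<Sum>h'\<in>{h}. \<phi> ((h - h') + (h' - h))) +
            (\<Sum>h'\<in>{h<..H}. \<phi> ((h - h') + (h' - h)))"
    proof -
      have "{1..H} = ({1..<h} \<union> {h}) \<union> {h<..H}" using h by auto
      moreover have "({1..<h} \<union> {h}) \<inter> {h<..H} = {}" "{1..<h} \<inter> {h} = {}" by auto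
      ultimately show ?thesis by (simp only: sum.union_disjoint finite_Un finite_atLeastLessThan
          finite_greaterThanAtMost finite.emptyI finite.insertI simp_thms)
    qed
    also have "(\<Sum>h'\<in>{1..<h}. \<phi> ((h - h') + (h' - h))) = (\<Sum>d\<in>{1..<h}. \<phi> d)"
      using h by (intro sum.reindex_bij_witness[of _ "\<lambda>d. h - d" "\<lambda>i. h - i"]) auto
    also have "(\<Sum>h'\<in>{h<..H}. \<phi> ((h - h') + (h' - h))) = (\<Sum>d=1..H-h. \<phi> d)"
      using h by (intro sum.reindex_bij_witness[of _ "\<lambda>d. h + d" "\<lambda>i. i - h"]) auto
    also have "(\<Sum>d\<in>{1..<h}. \<phi> d) \<le> (\<Sum>d=1..H. \<phi> d)" using h \<phi> by (intro sum_mono2) auto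
    also have "(\<Sum>d=1..H-h. \<phi> d) \<le> (\<Sum>d=1..H. \<phi> d)" using h \<phi> by (intro sum_mono2) auto
    finally show ?thesis by simp
  qed
  have "(\<Sum>h=1..H. \<Sum>h'=1..H. \<phi> ((h - h') + (h' - h))) / (real H * real H)
      \<le> (\<Sum>h=1..H. 2 * (\<Sum>d=1..H. \<phi> d) + \<phi> 0) / (real H * real H)"
    by (intro divide_right_mono sum_mono row) auto
  also have "\<dots> = 2 * ((\<Sum>d=1..H. \<phi> d) / real H) + \<phi> 0 / real H"
    using False by (simp add: field_simps)
  finally show ?thesis .
qed simp

context ergodic_action begin

text \<open>The form that Cauchy--Schwarz produces: both components of a pair are shifts, while
  \<open>derivs\<close> corresponds to pairs with second component 0.\<close>

definition shift_cube :: "(nat \<times> nat) list \<Rightarrow> ('a \<Rightarrow> complex) \<Rightarrow> 'a \<Rightarrow> complex" where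
  "shift_cube ps f x = cube ps (\<lambda>hs. f (\<tau> (int (sum_list hs)) x))"

lemma shift_cube_Nil: "shift_cube [] f = f"
  by (auto simp: shift_cube_def)

lemma shift_cube_Cons:
  "shift_cube (p # ps) f = shift_cube ps (\<lambda>x. f (\<tau> (int (fst p)) x) * cnj (f (\<tau> (int (snd p)) x)))"
  by (auto simp: shift_cube_def action_add)

lemma shift_cube_mult: "shift_cube ps (\<lambda>x. f x * g x) x = shift_cube ps f x * shift_cube ps g x"
  unfolding shift_cube_def cube_mult ..

lemma shift_cube_cnj: "shift_cube ps (\<lambda>x. cnj (f x)) x = cnj (shift_cube ps f x)"
  unfolding shift_cube_def cube_cnj ..

lemma shift_cube_prod: "shift_cube ps (\<lambda>x. \<Prod>i\<in>A. f i x) x = (\<Prod>i\<in>A. shift_cube ps (f i) x)"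
  unfolding shift_cube_def cube_prod ..

lemma shift_cube_action: "shift_cube ps (\<lambda>x. f (\<tau> n x)) x = shift_cube ps f (\<tau> n x)"
  by (simp add: shift_cube_def action_add add.commute)

lemma shift_cube_unit: "f \<in> unit_funs M \<Longrightarrow> shift_cube ps f \<in> unit_funs M"
  unfolding shift_cube_def by (intro unit_funs_cube unit_funs_action)

lemma shift_cube_eigenfun: "eigenfun f \<Longrightarrow> eigenfun (shift_cube ps f)"
  unfolding shift_cube_def by (intro eigenfun_cube eigenfun_action)

text \<open>The derivative without its top vertex \<open>f (\<tau> (int (sum_list hs)) x)\<close>,
  arranged like \<open>cube_rest\<close>.\<close>

primrec derivs_rest :: "nat list \<Rightarrow> ('a \<Rightarrow> complex) \<Rightarrow> 'a \<Rightarrow> complex" where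
  "derivs_rest [] f = (\<lambda>x. 1)"
| "derivs_rest (h # hs) f = (\<lambda>x. derivs hs (\<lambda>y. cnj (f y)) x
    * derivs_rest hs (\<lambda>y. f (\<tau> (int h) y)) x)"

lemma derivs_eq_top_times_rest: "derivs hs f x = f (\<tau> (int (sum_list hs)) x) * derivs_rest hs f x"
proof (induction hs arbitrary: f)
  case (Cons h hs)
  have "derivs (h # hs) f x = derivs hs (\<lambda>y. f (\<tau> (int h) y)) x * derivs hs (\<lambda>y. cnj (f y)) x"
    by (simp add: deriv_by_eq derivs_mult)
  then show ?case by (simp add: Cons.IH[of "\<lambda>y. f (\<tau> (int h) y)"] action_add)
qed simp

lemma derivs_rest_unit: "f \<in> unit_funs M \<Longrightarrow> derivs_rest hs f \<in> unit_funs M"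
proof (induction hs arbitrary: f)
  case (Cons h hs)
  show ?case unfolding derivs_rest.simps
    by (intro unit_funs_mult derivs_unit unit_funs_cnj Cons.IH unit_funs_action Cons.prems)
qed (simp add: unit_funs_const)

lemma low_complexity_derivs_rest:
  "f \<in> unit_funs M \<Longrightarrow> low_complexity t (\<lambda>hs. derivs_rest hs f x)"
proof (induction t arbitrary: f)
  case (Suc t)
  show ?case unfolding low_complexity.simps
  proof (intro exI conjI allI impI)
    show "cmod (derivs hs (\<lambda>y. cnj (f y)) x) \<le> 1" for hs
      by (rule unit_funs_le[OF derivs_unit[OF unit_funs_cnj[OF Suc.prems]]])
    show "derivs_rest (h # hs) f x = derivs hs (\<lambda>y. cnj (f y)) x
        * derivs_rest hs (\<lambda>y. f (\<tau> (int h) y)) x" for h hs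
      by simp
    show "low_complexity t (\<lambda>hs. derivs_rest hs (\<lambda>y. f (\<tau> (int h) y)) x)" for h
      by (intro Suc.IH unit_funs_action Suc.prems)
  qed
qed simp

lemma shift_cube_integral_Cons:
  assumes f: "f \<in> unit_funs M"
  shows "cmod (\<integral>x. shift_cube ((h, h') # ps) f x \<partial>M)
      = cmod (\<integral>x. shift_cube ps (deriv_by ((h - h') + (h' - h)) f) x \<partial>M)"
proof (cases "h' \<le> h")
  case True
  have "(\<lambda>x. f (\<tau> (int h) x) * cnj (f (\<tau> (int h') x))) = (\<lambda>x. deriv_by (h - h') f (\<tau> (int h') x))"
    using True by (auto simp: deriv_by_def action_add of_nat_diff)
  then show ?thesis using True
    by (simp add: shift_cube_Cons shift_cube_action integral_action[OF unit_funs_measurable[OF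
        shift_cube_unit[OF deriv_by_unit[OF f]]]])
next
  case False
  have "(\<lambda>x. f (\<tau> (int h) x) * cnj (f (\<tau> (int h') x)))
      = (\<lambda>x. cnj (deriv_by (h' - h) f (\<tau> (int h) x)))"
    using False by (auto simp: deriv_by_def action_add of_nat_diff)
  then show ?thesis using False
    by (simp add: shift_cube_Cons shift_cube_cnj shift_cube_action integral_action[OF
        unit_funs_measurable[OF shift_cube_unit[OF deriv_by_unit[OF f]]]])
qed

text \<open>Up to translation and conjugation a pair \<open>(h, h')\<close> acts as the derivative
  by the distance of \<open>h\<close> and \<open>h'\<close>. By \<open>sum_distance_le\<close>
  passing from pairs to distances costs a factor 2 per coordinate.\<close>

lemma pair_avg_shift_cube_le:
  assumes "f \<in> unit_funs M" "\<delta> > 0"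
  shows "nested_ev t (\<lambda>Hs. pair_avg Hs (\<lambda>ps. (cmod (\<integral>x. shift_cube ps f x \<partial>M))\<^sup>2)
      \<le> 2 ^ t * seminorm_pow t f + \<delta>)"
  using assms
proof (induction t arbitrary: f \<delta>)
  case 0
  then show ?case by (simp add: shift_cube_Nil)
next
  case (Suc t)
  note f = Suc.prems(1)
  \<comment> \<open>This step adds \<open>3 * 2 ^ t * \<epsilon> = \<delta> / 2\<close>; the other
    half of \<open>\<delta>\<close> is left to the induction hypothesis.\<close>
  define \<epsilon> where "\<epsilon> = \<delta> / (6 * 2 ^ t)"
  have \<epsilon>: "\<epsilon> > 0" using Suc.prems by (simp add: \<epsilon>_def)
  have "\<forall>\<^sub>F H in sequentially. (\<Sum>n=1..H. seminorm_pow t (deriv_by n f)) / real H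
      < seminorm_pow (Suc t) f + \<epsilon>"
    using \<epsilon> by (intro order_tendstoD(2)[OF seminorm_pow_lim[OF f]]) simp
  moreover have "\<forall>\<^sub>F H in sequentially. 1 / real H < \<epsilon>"
    by (rule order_tendstoD(2)[OF lim_const_over_n \<epsilon>])
  ultimately show ?case unfolding nested_ev.simps using eventually_ge_at_top[of 1]
  proof eventually_elim
    case (elim H)
    have "nested_ev t (\<lambda>Hs. \<forall>d\<in>{..H}. pair_avg Hs
        (\<lambda>ps. (cmod (\<integral>x. shift_cube ps (deriv_by d f) x \<partial>M))\<^sup>2)
        \<le> 2 ^ t * seminorm_pow t (deriv_by d f) + \<delta> / 2)"
      using Suc.prems by (intro nested_ev_finite Suc.IH deriv_by_unit) auto
    then show ?case
    proof (rule nested_ev_mono)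
      fix Hs
      assume *: "\<forall>d\<in>{..H}. pair_avg Hs (\<lambda>ps. (cmod (\<integral>x. shift_cube ps (deriv_by d f) x \<partial>M))\<^sup>2)
        \<le> 2 ^ t * seminorm_pow t (deriv_by d f) + \<delta> / 2"
      define D where "D h h' = (h - h') + (h' - h)" for h h' :: nat
      have "pair_avg (H # Hs) (\<lambda>ps. (cmod (\<integral>x. shift_cube ps f x \<partial>M))\<^sup>2)
          = (\<Sum>h=1..H. \<Sum>h'=1..H. pair_avg Hs (\<lambda>ps. (cmod (\<integral>x. shift_cube ps (deriv_by
              (D h h') f) x \<partial>M))\<^sup>2)) / (real H * real H)"
        unfolding pair_avg.simps D_def shift_cube_integral_Cons[OF f] by simp
      also have "\<dots> \<le> (\<Sum>h=1..H. \<Sum>h'=1..H. 2 ^ t * seminorm_pow t (deriv_by (D h h') f) + \<delta> / 2)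
          / (real H * real H)"
        using * by (intro divide_right_mono sum_mono) (auto simp: D_def)
      also have "\<dots> = 2 ^ t * ((\<Sum>h=1..H. \<Sum>h'=1..H. seminorm_pow t (deriv_by (D h h') f))
          / (real H * real H)) + \<delta> / 2"
        using elim(3) by (simp add: sum.distrib sum_distrib_left[symmetric] add_divide_distrib)
      also have "\<dots> \<le> 2 ^ t * (2 * ((\<Sum>d=1..H. seminorm_pow t (deriv_by d f)) / real H)
          + seminorm_pow t (deriv_by 0 f) / real H) + \<delta> / 2"
        unfolding D_def
        by (intro add_right_mono mult_left_mono sum_distance_le seminorm_pow_bounds deriv_by_unit
            f) simp
      also have "\<dots> \<le> 2 ^ t * (2 * (seminorm_pow (Suc t) f + \<epsilon>) + \<epsilon>) + \<delta> / 2"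
      proof (intro add_right_mono mult_left_mono add_mono)
        have "seminorm_pow t (deriv_by 0 f) / real H \<le> 1 / real H"
          by (intro divide_right_mono seminorm_pow_bounds deriv_by_unit f) simp
        with elim(2) show "seminorm_pow t (deriv_by 0 f) / real H \<le> \<epsilon>" by simp
      qed (use elim in auto)
      also have "\<dots> = 2 ^ Suc t * seminorm_pow (Suc t) f + \<delta>"
        by (simp add: \<epsilon>_def field_simps del: seminorm_pow.simps)
      finally show "pair_avg (H # Hs) (\<lambda>ps. (cmod (\<integral>x. shift_cube ps f x \<partial>M))\<^sup>2)
          \<le> 2 ^ Suc t * seminorm_pow (Suc t) f + \<delta>" .
    qed
  qed
qed

declare seminorm_pow.simps(2) [simp del]

text \<open>Since \<open>cube (zip hs hs') \<xi>\<close> is an eigenfunction with non-zero mean, it is constant, so up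
  to a constant \<open>\<xi> hs\<close> is a product of functions each depending on fewer coordinates of \<open>hs\<close>.\<close>
lemma eigenfun_top_of_cube:
  assumes \<xi>: "\<And>hs. eigenfun (\<xi> hs)" and nz: "(\<integral>x. cube (zip hs hs') (\<lambda>hs. \<xi> hs x) \<partial>M) \<noteq> 0"
    and len: "length hs = length hs'" and g: "g \<in> bounded_funs M"
  shows "cmod (\<integral>x. g x * cnj (cube_rest (zip hs hs') (\<lambda>hs. \<xi> hs x)) \<partial>M)
      = cmod (\<integral>x. g x * \<xi> hs x \<partial>M)"
proof -
  define \<Xi> where "\<Xi> x = cube (zip hs hs') (\<lambda>hs. \<xi> hs x)" for x
  define R where "R x = cube_rest (zip hs hs') (\<lambda>hs. \<xi> hs x)" for x
  have \<Xi>: "eigenfun \<Xi>" unfolding \<Xi>_def by (intro eigenfun_cube \<xi>)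
  have fact: "\<Xi> x = \<xi> hs x * R x" for x
    unfolding \<Xi>_def R_def using len by (subst cube_eq_top_times_rest) simp
  have R: "cmod (R x) = 1" for x
    using fact[of x] eigenfun_norm[OF \<Xi>, of x] eigenfun_norm[OF \<xi>, of hs x] by (simp add: norm_mult)
  define \<kappa> where "\<kappa> = (\<integral>x. \<Xi> x \<partial>M)"
  have const: "AE x in M. \<Xi> x = \<kappa>"
    unfolding \<kappa>_def using nz by (intro eigenfun_nonzero_mean \<Xi>) (simp add: \<Xi>_def)
  have \<kappa>: "cmod \<kappa> = 1"
  proof -
    have "AE x in M. cmod \<kappa> = 1" using const by eventually_elim (use eigenfun_norm[OF \<Xi>] in auto)
    then show ?thesis by simp
  qed
  have "AE x in M. g x * cnj (R x) = cnj \<kappa> * (g x * \<xi> hs x)"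
    using const
  proof eventually_elim
    case (elim x)
    have "\<xi> hs x * (R x * cnj (R x)) = \<kappa> * cnj (R x)"
      using fact[of x] elim by (simp add: mult.assoc)
    then have "\<xi> hs x = \<kappa> * cnj (R x)"
      using R[of x] by (simp add: complex_norm_square[symmetric])
    then have "cnj \<kappa> * \<xi> hs x = (\<kappa> * cnj \<kappa>) * cnj (R x)" by (simp add: mult_ac)
    also have "\<kappa> * cnj \<kappa> = 1" using \<kappa> by (simp add: complex_norm_square[symmetric])
    finally show ?case by (simp add: mult_ac)
  qed
  moreover have "R \<in> unit_funs M" unfolding R_def by (intro unit_funs_cube_rest eigenfun_unit \<xi>)
  ultimately have "(\<integral>x. g x * cnj (R x) \<partial>M) = (\<integral>x. cnj \<kappa> * (g x * \<xi> hs x) \<partial>M)"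
    using g \<xi>[of hs]
    by (intro integral_cong_AE) (auto intro!: borel_measurable_times borel_measurable_cnj
        borel_measurable_const
      dest: bounded_funs_measurable unit_funs_measurable eigenfun_unit)
  then show ?thesis using \<kappa> by (simp add: R_def norm_mult)
qed

text \<open>Derivatives of \<open>G\<close> of order \<open>t\<close> correlate with eigenfunctions
  \<open>\<xi> hs\<close>. If \<open>G\<close> is replaced by the dual functions at the top vertex
  alone, a first box inequality leaves cubes of dual functions paired with cubes of the
  \<open>\<xi> hs\<close>. By \<open>vanish\<close> these can be large only if, for a positive
  proportion of pairs, the cube of the \<open>\<xi> hs\<close> has non-zero mean. Then
  \<open>\<xi> hs\<close> may be traded for a factor of low complexity, and a second box inequality
  bounds the cubes of \<open>G\<close> from below, although they are small when
  \<open>seminorm_pow t G = 0\<close>.\<close>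

lemma degree_lowering:
  assumes \<phi>: "\<And>k n. \<phi> k n \<in> unit_funs M"
    and G: "weak_cluster (\<lambda>k x. avg {1..N k} (\<lambda>n. \<phi> k n x)) G"
    and vanish: "\<And>ps \<xi>. eigenfun \<xi> \<Longrightarrow> (\<integral>x. \<xi> x \<partial>M) = 0 \<Longrightarrow>
      (\<lambda>k. avg {1..N k} (\<lambda>n. \<integral>x. shift_cube ps (\<phi> k n) x * \<xi> x \<partial>M)) \<longlonglongrightarrow> 0"
    and pos: "seminorm_pow (Suc t) G > 0"
  shows "seminorm_pow t G > 0"
proof (rule ccontr)
  assume "\<not> seminorm_pow t G > 0"
  have Gu: "G \<in> unit_funs M" using G by (rule weak_cluster_unit)
  have zero: "seminorm_pow t G = 0"
    using \<open>\<not> seminorm_pow t G > 0\<close> seminorm_pow_bounds(1)[OF Gu, of t] by simp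
  define c where "c = seminorm_pow (Suc t) G"
  have c: "c > 0" using pos by (simp add: c_def)
  \<comment> \<open>\<open>c1\<close> lies below \<open>c / 8\<close>, the correlation of
    \<open>w\<close> with \<open>G\<close> found below. Half of the resulting bound
    \<open>c1 ^ (2 ^ t)\<close> goes to errors and half, \<open>c2\<close>, is the proportion of
    good pairs. \<open>c3\<close> is this proportion times the squared correlation, and
    \<open>\<delta>\<close> is chosen to contradict the second box inequality.\<close>
  define c1 where "c1 = c / 16"
  define c2 where "c2 = c1 ^ (2 ^ t) / 2"
  define c3 where "c3 = c2 * (c / 8)\<^sup>2"
  define \<delta> where "\<delta> = c3 ^ (2 ^ t) / 2"
  have c1: "c1 > 0" using c by (simp add: c1_def)
  then have c2: "c2 > 0" by (simp add: c2_def)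
  then have c3: "c3 > 0" using c by (simp add: c3_def)
  then have \<delta>: "\<delta> > 0" by (simp add: \<delta>_def)
  have "nested_ev t (\<lambda>Hs. \<bar>box_avg Hs (\<lambda>hs. seminorm_pow 1 (derivs hs G))
      - seminorm_pow (1 + t) G\<bar> \<le> c / 2
      \<and> pair_avg Hs (\<lambda>ps. (cmod (\<integral>x. shift_cube ps G x \<partial>M))\<^sup>2) \<le> 2 ^ t * seminorm_pow t G + \<delta>)"
    using c \<delta> by (intro nested_ev_conj seminorm_pow_nested pair_avg_shift_cube_le Gu) auto
  from nested_ev_ex[OF this] obtain Hs where Hs: "length Hs = t" "0 \<notin> set Hs"
    and avg_S1: "\<bar>box_avg Hs (\<lambda>hs. seminorm_pow 1 (derivs hs G)) - c\<bar> \<le> c / 2"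
    and small: "pair_avg Hs (\<lambda>ps. (cmod (\<integral>x. shift_cube ps G x \<partial>M))\<^sup>2) \<le> \<delta>"
    unfolding zero c_def by auto
  have DG: "derivs hs G \<in> unit_funs M" for hs by (intro derivs_unit Gu)
  have "\<exists>\<xi>. \<forall>hs. eigenfun (\<xi> hs) \<and> seminorm_pow 1 (derivs hs G) / 2
      \<le> Re (\<integral>x. derivs hs G x * \<xi> hs x \<partial>M)"
    using inverse_theorem[OF DG] by (intro choice allI) blast
  then obtain \<xi> where \<xi>: "\<And>hs. eigenfun (\<xi> hs)"
    "\<And>hs. seminorm_pow 1 (derivs hs G) / 2 \<le> Re (\<integral>x. derivs hs G x * \<xi> hs x \<partial>M)" by blast
  \<comment> \<open>Selects the shifts whose derivative has a sizeable seminorm. The average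
    seminorm is at least \<open>c / 2\<close>, so dropping those below \<open>c / 4\<close> still
    leaves correlation \<open>(c / 2 - c / 4) / 2 = c / 8\<close>.\<close>
  define \<sigma> where "\<sigma> hs = (if c / 4 \<le> seminorm_pow 1 (derivs hs G) then 1 else 0 :: complex)" for hs
  have \<xi>u: "\<xi> hs \<in> unit_funs M" for hs by (intro eigenfun_unit \<xi>)
  have \<sigma>1: "cmod (\<sigma> hs) \<le> 1" for hs by (simp add: \<sigma>_def)
  define v where "v hs f x = f (\<tau> (int (sum_list hs)) x) * (\<sigma> hs * \<xi> hs x)" for hs f x
  have v_unit: "v hs f \<in> unit_funs M" if "f \<in> unit_funs M" for hs f
    unfolding v_def by (intro unit_funs_mult unit_funs_const unit_funs_action \<sigma>1 \<xi>u that)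
  \<comment> \<open>Translating back by \<open>sum_list hs\<close> frees the argument of the top
    vertex, so that the correlation becomes a fixed linear functional of \<open>G\<close> and passes
    to the averages of \<open>\<phi> k n\<close>.\<close>
  define w where "w x = box_avg Hs (\<lambda>hs. \<sigma> hs * \<xi> hs (\<tau> (- int (sum_list hs)) x)
      * derivs_rest hs G (\<tau> (- int (sum_list hs)) x))" for x
  note bounded_rules = bounded_funs_const bounded_funs_mult bounded_funs_action
  have w: "w \<in> bounded_funs M" unfolding w_def
    by (intro bounded_funs_box_avg bounded_rules unit_funs_subset[OF \<xi>u] unit_funs_subset[OF
        derivs_rest_unit[OF Gu]])
  have w_int: "(\<integral>x. w x * f x \<partial>M) = box_avg Hs (\<lambda>hs. \<integral>x. v hs f x * derivs_rest hs G x \<partial>M)"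
    if "f \<in> unit_funs M" for f
  proof -
    have f: "f \<in> bounded_funs M" using that by (rule unit_funs_subset)
    have "(\<integral>x. w x * f x \<partial>M) = (\<integral>x. box_avg Hs (\<lambda>hs. f x * (\<sigma> hs * \<xi> hs (\<tau> (- int (sum_list hs)) x)
      * derivs_rest hs G (\<tau> (- int (sum_list hs)) x))) \<partial>M)"
      unfolding w_def box_avg_cmult by (simp add: mult.commute)
    also have "\<dots> = box_avg Hs (\<lambda>hs. \<integral>x. f x * (\<sigma> hs * \<xi> hs (\<tau> (- int (sum_list hs)) x)
      * derivs_rest hs G (\<tau> (- int (sum_list hs)) x)) \<partial>M)"
      by (intro integral_box_avg bounded_rules f unit_funs_subset[OF \<xi>u] unit_funs_subset[OF
          derivs_rest_unit[OF Gu]])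
    also have "\<dots> = box_avg Hs (\<lambda>hs. \<integral>x. v hs f x * derivs_rest hs G x \<partial>M)"
    proof (rule box_avg_cong)
      fix hs
      define n where "n = int (sum_list hs)"
      have "(\<integral>x. f x * (\<sigma> hs * \<xi> hs (\<tau> (- n) x) * derivs_rest hs G (\<tau> (- n) x)) \<partial>M)
          = (\<integral>x. f (\<tau> n x) * (\<sigma> hs * \<xi> hs (\<tau> (- n) (\<tau> n x)) * derivs_rest hs G (\<tau> (- n)
              (\<tau> n x))) \<partial>M)"
        by (rule integral_action[where n = n, symmetric], rule bounded_funs_measurable)
           (intro bounded_rules f unit_funs_subset[OF \<xi>u] unit_funs_subset[OF derivs_rest_unit[OF
               Gu]])
      then show "(\<integral>x. f x * (\<sigma> hs * \<xi> hs (\<tau> (- int (sum_list hs)) x)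
          * derivs_rest hs G (\<tau> (- int (sum_list hs)) x)) \<partial>M)
          = (\<integral>x. v hs f x * derivs_rest hs G x \<partial>M)"
        by (simp add: n_def v_def action_add mult.assoc)
    qed
    finally show ?thesis .
  qed
  have "c / 8 \<le> Re (\<integral>x. w x * G x \<partial>M)"
  proof -
    have "c / 8 \<le> (box_avg Hs (\<lambda>hs. seminorm_pow 1 (derivs hs G)) - c / 4) / 2"
      using avg_S1[unfolded abs_le_iff] by (auto simp: field_simps)
    also have "\<dots> = box_avg Hs (\<lambda>hs. (seminorm_pow 1 (derivs hs G) - c / 4) / 2)"
      by (simp only: box_avg_divide[where c = 2] box_avg_diff box_avg_const[OF Hs(2)])
    also have "\<dots> \<le> box_avg Hs (\<lambda>hs. Re (\<integral>x. v hs G x * derivs_rest hs G x \<partial>M))"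
    proof (rule box_avg_mono)
      fix hs
      have "(\<integral>x. v hs G x * derivs_rest hs G x \<partial>M) = \<sigma> hs * (\<integral>x. derivs hs G x * \<xi> hs x \<partial>M)"
        unfolding v_def derivs_eq_top_times_rest[of hs G]
            by (simp add: mult_ac flip: integral_mult_right_zero)
      then show "(seminorm_pow 1 (derivs hs G) - c / 4) / 2
          \<le> Re (\<integral>x. v hs G x * derivs_rest hs G x \<partial>M)"
        using \<xi>(2)[of hs] c by (cases "c / 4 \<le> seminorm_pow 1 (derivs hs G)") (auto
            simp: \<sigma>_def simp del: seminorm_pow.simps)
    qed
    finally show ?thesis unfolding w_int[OF Gu] Re_box_avg .
  qed
  then have "\<not> Re (\<integral>x. w x * G x \<partial>M) \<le> c1" using c by (simp add: c1_def)
  then have freq: "\<exists>\<^sub>F k in sequentially. c1 < Re (\<integral>x. w x * avg {1..N k} (\<lambda>n. \<phi> k n x) \<partial>M)"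
    using weak_cluster_le[OF G w, of c1] by (auto simp: frequently_def not_less)
  define a where "a k ps = cube ps \<sigma> * avg {1..N k} (\<lambda>n. \<integral>x. shift_cube ps (\<phi> k n) x
      * cube ps (\<lambda>hs. \<xi> hs x) \<partial>M)" for k ps
  have a_lower: "c1 ^ (2 ^ t) \<le> pair_avg Hs (\<lambda>ps. Re (a k ps))"
    if k: "c1 < Re (\<integral>x. w x * avg {1..N k} (\<lambda>n. \<phi> k n x) \<partial>M)" for k
  proof -
    define X where "X n = Re (box_avg Hs (\<lambda>hs. \<integral>x. v hs (\<phi> k n) x * derivs_rest hs G x \<partial>M))" for n
    have int: "integrable M (\<lambda>x. w x * \<phi> k n x)" for n
      by (intro bounded_funs_integrable bounded_funs_mult w unit_funs_subset[OF \<phi>])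
    have w_avg: "(\<integral>x. w x * avg {1..N k} (\<lambda>n. \<phi> k n x) \<partial>M)
        = avg {1..N k} (\<lambda>n. \<integral>x. w x * \<phi> k n x \<partial>M)"
      using int by (simp add: avg_def sum_distrib_left)
    have eq: "Re (\<integral>x. w x * avg {1..N k} (\<lambda>n. \<phi> k n x) \<partial>M)
        = (\<Sum>n=1..N k. X n) / real (card {1..N k})"
      unfolding w_avg unfolding w_int[OF \<phi>] X_def avg_def by (simp add: Re_divide_of_nat)
    have "c1 ^ (2 ^ t) \<le> ((\<Sum>n=1..N k. X n) / real (card {1..N k})) ^ (2 ^ t)"
      using k c1 unfolding eq by (intro power_mono) auto
    also have "\<dots> \<le> (\<Sum>n=1..N k. X n ^ (2 ^ t)) / real (card {1..N k})"
      by (rule power_mean_le)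
    also have "\<dots> \<le> (\<Sum>n=1..N k. Re (pair_avg Hs (\<lambda>ps. \<integral>x. cube ps (\<lambda>hs. v hs (\<phi> k n) x) \<partial>M)))
        / real (card {1..N k})"
    proof (intro divide_right_mono sum_mono)
      fix n
      show "X n ^ (2 ^ t) \<le> Re (pair_avg Hs (\<lambda>ps. \<integral>x. cube ps (\<lambda>hs. v hs (\<phi> k n) x) \<partial>M))"
        unfolding X_def Hs(1)[symmetric]
        by (intro box_cauchy_schwarz_integral Hs unit_funs_subset[OF v_unit[OF \<phi>]]
            unit_funs_subset[OF derivs_rest_unit[OF Gu]] low_complexity_derivs_rest Gu)
    qed simp
    also have "\<dots> = pair_avg Hs (\<lambda>ps. Re (a k ps))"
    proof -
      have "cube ps (\<lambda>hs. v hs f x) = cube ps \<sigma> * (shift_cube ps f x * cube ps (\<lambda>hs. \<xi> hs x))"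
          for ps f x
        unfolding v_def cube_mult shift_cube_def by (simp add: mult_ac)
      then have "a k ps = avg {1..N k} (\<lambda>n. \<integral>x. cube ps (\<lambda>hs. v hs (\<phi> k n) x) \<partial>M)" for ps
        by (simp add: a_def avg_def sum_distrib_left)
      then have "pair_avg Hs (a k) = avg {1..N k}
          (\<lambda>n. pair_avg Hs (\<lambda>ps. \<integral>x. cube ps (\<lambda>hs. v hs (\<phi> k n) x) \<partial>M))"
        unfolding pair_avg_eq_box_avg avg_def by (simp add: box_avg_divide box_avg_sum)
      then show ?thesis
        unfolding Re_pair_avg[symmetric] avg_def by (simp add: Re_divide_of_nat)
    qed
    finally show ?thesis .
  qed
  \<comment> \<open>For all other pairs \<open>a k ps\<close> tends to 0: either its weight is 0 or
    \<open>vanish\<close> applies to the cube of the \<open>\<xi> hs\<close>.\<close>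
  define good where "good ps \<longleftrightarrow> cube ps \<sigma> \<noteq> 0 \<and> (\<integral>x. cube ps (\<lambda>hs. \<xi> hs x) \<partial>M) \<noteq> 0" for ps
  have a_upper: "\<forall>\<^sub>F k in sequentially. Re (a k ps) \<le> of_bool (good ps) + c2" for ps
  proof (cases "good ps")
    case True
    have "(\<lambda>x. shift_cube ps (\<phi> k n) x * cube ps (\<lambda>hs. \<xi> hs x)) \<in> unit_funs M" for k n
      by (intro unit_funs_mult shift_cube_unit \<phi> unit_funs_cube \<xi>u)
    note le1 = unit_funs_le[OF this]
    have "cmod (a k ps) \<le> 1" for k
      unfolding a_def norm_mult avg_def
      by (intro mult_le_one norm_ge_zero norm_cube_le \<sigma>1 norm_mean_le norm_integral_le le1) auto
    then have "Re (a k ps) \<le> 1" for k using complex_Re_le_cmod order_trans by blast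
    then show ?thesis using True c2 by (intro always_eventually allI) (smt (verit) of_bool_eq(2))
  next
    case False
    have "(\<lambda>k. a k ps) \<longlonglongrightarrow> 0"
    proof (cases "cube ps \<sigma> = 0")
      case False
      then have "(\<integral>x. cube ps (\<lambda>hs. \<xi> hs x) \<partial>M) = 0" using \<open>\<not> good ps\<close> by (simp add: good_def)
      from tendsto_mult_left[OF vanish[OF eigenfun_cube[of \<xi> ps, OF \<xi>(1)] this, of ps], of
          "cube ps \<sigma>"]
      show ?thesis unfolding a_def by simp
    qed (simp add: a_def)
    from tendsto_Re[OF this] have "(\<lambda>k. Re (a k ps)) \<longlonglongrightarrow> 0" by simp
    from order_tendstoD(2)[OF this c2] show ?thesis
      using False by (auto elim: eventually_mono)
  qed
  from eventually_pair_avg_mono[OF this, of Hs]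
  have "\<forall>\<^sub>F k in sequentially. pair_avg Hs (\<lambda>ps. Re (a k ps))
      \<le> pair_avg Hs (\<lambda>ps. of_bool (good ps) + c2)" .
  from frequently_ex[OF frequently_eventually_frequently[OF freq this]]
  obtain k where "c1 < Re (\<integral>x. w x * avg {1..N k} (\<lambda>n. \<phi> k n x) \<partial>M)"
    "pair_avg Hs (\<lambda>ps. Re (a k ps)) \<le> pair_avg Hs (\<lambda>ps. of_bool (good ps) + c2)" by auto
  then have "c1 ^ (2 ^ t) \<le> pair_avg Hs (\<lambda>ps. of_bool (good ps)) + c2"
    using a_lower[of k] Hs(2) by (simp add: pair_avg_add pair_avg_const)
  then have "c2 \<le> box_avg Hs (\<lambda>hs'. box_avg Hs (\<lambda>hs. of_bool (good (zip hs hs'))))"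
    unfolding pair_avg_eq_box_avg c2_def by simp
  \<comment> \<open>Freezing the second components makes the cube relation a description of
    \<open>\<xi> hs\<close> as a function of \<open>hs\<close> alone.\<close>
  from box_avg_le_imp_ex[OF this Hs(2)] obtain hs' where hs': "length hs' = t"
    "c2 \<le> box_avg Hs (\<lambda>hs. of_bool (good (zip hs hs')))" using Hs(1) by auto
  define R where "R hs x = cube_rest (zip hs hs') (\<lambda>hs. \<xi> hs x)" for hs x
  define b where "b hs x = derivs_rest hs G x * cnj (R hs x)" for hs x
  have R_unit: "R hs \<in> unit_funs M" for hs unfolding R_def by (intro unit_funs_cube_rest \<xi>u)
  have "c3 \<le> box_avg Hs (\<lambda>hs. (c / 8)\<^sup>2 * of_bool (good (zip hs hs')))"
    using hs'(2) c unfolding c3_def box_avg_cmult by (simp add: mult.commute mult_left_mono)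
  also have "\<dots> \<le> box_avg Hs (\<lambda>hs. (cmod (\<integral>x. G (\<tau> (int (sum_list hs)) x) * b hs x \<partial>M))\<^sup>2)"
  proof (rule box_avg_mono)
    fix hs :: "nat list" assume len: "length hs = length Hs"
    show "(c / 8)\<^sup>2 * of_bool (good (zip hs hs'))
        \<le> (cmod (\<integral>x. G (\<tau> (int (sum_list hs)) x) * b hs x \<partial>M))\<^sup>2"
    proof (cases "good (zip hs hs')")
      case True
      then have nz: "(\<integral>x. cube (zip hs hs') (\<lambda>hs. \<xi> hs x) \<partial>M) \<noteq> 0" "cube (zip hs hs') \<sigma> \<noteq> 0"
        by (auto simp: good_def)
      have len': "length hs = length hs'" using len hs'(1) Hs(1) by simp
      have "\<sigma> hs \<noteq> 0" using nz(2) len' by (subst (asm) cube_eq_top_times_rest) auto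
      then have "c / 4 \<le> seminorm_pow 1 (derivs hs G)" by (simp add: \<sigma>_def split: if_splits)
      then have "c / 8 \<le> Re (\<integral>x. derivs hs G x * \<xi> hs x \<partial>M)" using \<xi>(2)[of hs] by linarith
      also have "\<dots> \<le> cmod (\<integral>x. derivs hs G x * \<xi> hs x \<partial>M)" by (rule complex_Re_le_cmod)
      also have "\<dots> = cmod (\<integral>x. derivs hs G x * cnj (R hs x) \<partial>M)"
        unfolding R_def by (rule eigenfun_top_of_cube[OF \<xi>(1) nz(1) len' unit_funs_subset[OF DG],
            symmetric])
      also have "(\<lambda>x. derivs hs G x * cnj (R hs x)) = (\<lambda>x. G (\<tau> (int (sum_list hs)) x) * b hs x)"
        unfolding b_def derivs_eq_top_times_rest[of hs G] by (simp add: mult.assoc)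
      finally show ?thesis using True c by (simp add: power_mono)
    qed simp
  qed
  finally have "c3 ^ (2 ^ t) \<le> (box_avg Hs (\<lambda>hs. (cmod (\<integral>x. G (\<tau> (int (sum_list hs)) x)
      * b hs x \<partial>M))\<^sup>2)) ^ (2 ^ length Hs)"
    using c3 Hs(1) by (simp add: power_mono)
  also have "\<dots> \<le> pair_avg Hs (\<lambda>ps. (cmod (\<integral>x. cube ps (\<lambda>hs. G (\<tau> (int (sum_list hs)) x)) \<partial>M))\<^sup>2)"
  proof (rule box_cauchy_schwarz_square[OF Hs(2)])
    show "(\<lambda>x. G (\<tau> (int (sum_list hs)) x)) \<in> bounded_funs M" for hs
      by (intro bounded_funs_action unit_funs_subset Gu)
    show "b hs \<in> bounded_funs M" for hs unfolding b_def
      by (intro bounded_funs_mult bounded_funs_cnj unit_funs_subset[OF R_unit] unit_funs_subset[OF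
          derivs_rest_unit[OF Gu]])
    show "low_complexity (length Hs) (\<lambda>hs. b hs x)" for x
      unfolding b_def R_def Hs(1) hs'(1)[symmetric]
      by (intro low_complexity_mult low_complexity_cnj low_complexity_derivs_rest Gu
          low_complexity_cube_rest unit_funs_le[OF \<xi>u])
  qed
  also have "\<dots> \<le> \<delta>" using small unfolding shift_cube_def .
  finally show False using c3 by (simp add: \<delta>_def)
qed

end

subsection \<open>Multiple ergodic averages\<close>

context prob_space begin

text \<open>Meaningful for square integrable \<open>F N\<close> only: otherwise the integral is \<open>0\<close>.\<close>
definition l2_lim :: "(nat \<Rightarrow> 'a \<Rightarrow> complex) \<Rightarrow> complex \<Rightarrow> bool" where
  "l2_lim F c \<longleftrightarrow> (\<lambda>N. \<integral>x. (cmod (F N x - c))\<^sup>2 \<partial>M) \<longlonglongrightarrow> 0"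

lemma l2_lim_add:
  assumes F: "\<And>N. F N \<in> bounded_funs M" and G: "\<And>N. G N \<in> bounded_funs M"
    and "l2_lim F c" "l2_lim G d"
  shows "l2_lim (\<lambda>N x. \<alpha> * F N x + \<beta> * G N x) (\<alpha> * c + \<beta> * d)"
  unfolding l2_lim_def
proof -
  let ?u = "\<lambda>N. 2 * ((cmod \<alpha>)\<^sup>2 * (\<integral>x. (cmod (F N x - c))\<^sup>2 \<partial>M)) + 2
      * ((cmod \<beta>)\<^sup>2 * (\<integral>x. (cmod (G N x - d))\<^sup>2 \<partial>M))"
  have i: "integrable M (\<lambda>x. (cmod (F N x - c))\<^sup>2)" "integrable M (\<lambda>x. (cmod (G N x - d))\<^sup>2)"
    "integrable M (\<lambda>x. (cmod (\<alpha> * F N x + \<beta> * G N x - (\<alpha> * c + \<beta> * d)))\<^sup>2)" for N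
    by (intro integrable_bounded_norm bounded_funs_diff bounded_funs_add bounded_funs_const
        bounded_funs_cmult F G)+
  have pw: "(cmod (\<alpha> * F N x + \<beta> * G N x - (\<alpha> * c + \<beta> * d)))\<^sup>2
      \<le> 2 * ((cmod \<alpha>)\<^sup>2 * (cmod (F N x - c))\<^sup>2) + 2 * ((cmod \<beta>)\<^sup>2 * (cmod (G N x - d))\<^sup>2)" for N x
  proof -
    define p where "p = cmod (\<alpha> * (F N x - c))"
    define q where "q = cmod (\<beta> * (G N x - d))"
    have "\<alpha> * F N x + \<beta> * G N x - (\<alpha> * c + \<beta> * d) = \<alpha> * (F N x - c) + \<beta> * (G N x - d)"
      by (simp add: algebra_simps)
    then have "(cmod (\<alpha> * F N x + \<beta> * G N x - (\<alpha> * c + \<beta> * d)))\<^sup>2 \<le> (p + q)\<^sup>2"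
      unfolding p_def q_def by (intro power_mono) (auto intro: norm_triangle_ineq)
    also have "\<dots> \<le> 2 * p\<^sup>2 + 2 * q\<^sup>2"
      using zero_le_power2[of "p - q"] by (simp add: power2_eq_square algebra_simps)
    finally show ?thesis by (simp add: p_def q_def norm_mult power_mult_distrib)
  qed
  have upper: "\<forall>\<^sub>F N in sequentially. (\<integral>x. (cmod (\<alpha> * F N x + \<beta> * G N x - (\<alpha> * c + \<beta> * d)))\<^sup>2 \<partial>M)
      \<le> ?u N"
  proof (intro always_eventually allI)
    fix N
    have "(\<integral>x. (cmod (\<alpha> * F N x + \<beta> * G N x - (\<alpha> * c + \<beta> * d)))\<^sup>2 \<partial>M)
      \<le> (\<integral>x. 2 * ((cmod \<alpha>)\<^sup>2 * (cmod (F N x - c))\<^sup>2) + 2 * ((cmod \<beta>)\<^sup>2 * (cmod (G N x - d))\<^sup>2) \<partial>M)"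
      using i pw by (intro integral_mono) auto
    then show "(\<integral>x. (cmod (\<alpha> * F N x + \<beta> * G N x - (\<alpha> * c + \<beta> * d)))\<^sup>2 \<partial>M) \<le> ?u N"
      using i by simp
  qed
  have "?u \<longlonglongrightarrow> 2 * ((cmod \<alpha>)\<^sup>2 * 0) + 2 * ((cmod \<beta>)\<^sup>2 * 0)"
    using assms(3,4) unfolding l2_lim_def by (intro tendsto_intros)
  then have u0: "?u \<longlonglongrightarrow> 0" by simp
  show "(\<lambda>N. \<integral>x. (cmod (\<alpha> * F N x + \<beta> * G N x - (\<alpha> * c + \<beta> * d)))\<^sup>2 \<partial>M) \<longlonglongrightarrow> 0"
    by (rule tendsto_sandwich[OF _ upper tendsto_const u0]) auto
qed

text \<open>The test functions may vary with \<open>k\<close>; in \<open>l2_lim_zero\<close> they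
  are conjugates of the averages, or cubes of these.\<close>

lemma l2_lim_integral:
  assumes F: "\<And>N. F N \<in> bounded_funs M" and lim: "l2_lim F c" and r: "strict_mono r"
    and u: "\<And>k. u k \<in> unit_funs M"
  shows "(\<lambda>k. (\<integral>x. u k x * F (r k) x \<partial>M) - c * (\<integral>x. u k x \<partial>M)) \<longlonglongrightarrow> 0"
proof (rule LIMSEQ_I)
  fix \<epsilon> :: real assume \<epsilon>: "\<epsilon> > 0"
  have "(\<lambda>k. \<integral>x. (cmod (F (r k) x - c))\<^sup>2 \<partial>M) \<longlonglongrightarrow> 0"
    using LIMSEQ_subseq_LIMSEQ[OF lim[unfolded l2_lim_def] r] by (simp add: o_def)
  then have "\<forall>\<^sub>F k in sequentially. (\<integral>x. (cmod (F (r k) x - c))\<^sup>2 \<partial>M) < \<epsilon>\<^sup>2"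
    using \<epsilon> by (intro order_tendstoD(2)) auto
  then have "\<forall>\<^sub>F k in sequentially. cmod ((\<integral>x. u k x * F (r k) x \<partial>M) - c * (\<integral>x. u k x \<partial>M) - 0) < \<epsilon>"
  proof eventually_elim
    case (elim k)
    have d: "(\<lambda>x. F (r k) x - c) \<in> bounded_funs M" by (intro bounded_funs_diff F bounded_funs_const)
    have i: "integrable M (\<lambda>x. u k x * F (r k) x)" "integrable M (u k)"
      by (intro bounded_funs_integrable bounded_funs_mult F unit_funs_subset[OF u])+
    have "(\<integral>x. u k x * F (r k) x \<partial>M) - c * (\<integral>x. u k x \<partial>M) = (\<integral>x. u k x * (F (r k) x - c) \<partial>M)"
      using i by (simp add: right_diff_distrib mult.commute)
    also have "cmod \<dots> \<le> (\<integral>x. cmod (u k x * (F (r k) x - c)) \<partial>M)" by (rule integral_norm_bound)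
    also have "\<dots> \<le> (\<integral>x. cmod (F (r k) x - c) \<partial>M)"
    proof (rule integral_mono)
      show "integrable M (\<lambda>x. cmod (u k x * (F (r k) x - c)))"
        by (intro integrable_bounded_norm bounded_funs_mult d unit_funs_subset[OF u])
      show "integrable M (\<lambda>x. cmod (F (r k) x - c))" by (intro integrable_bounded_norm d)
      show "cmod (u k x * (F (r k) x - c)) \<le> cmod (F (r k) x - c)" for x
        unfolding norm_mult using unit_funs_le[OF u, of k x] by (intro mult_left_le_one_le) auto
    qed
    also have "\<dots> < \<epsilon>" using elim \<epsilon> by (rule L1_less_of_L2_less[OF d])
    finally show ?case by simp
  qed
  then show "\<exists>N. \<forall>k\<ge>N. cmod ((\<integral>x. u k x * F (r k) x \<partial>M) - c * (\<integral>x. u k x \<partial>M) - 0) < \<epsilon>"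
    by (simp add: eventually_sequentially)
qed

end

lemma not_tendsto_zero_subseq:
  fixes z :: "nat \<Rightarrow> real"
  assumes "\<not> z \<longlonglongrightarrow> 0" "\<And>n. 0 \<le> z n"
  shows "\<exists>c>0. \<exists>r :: nat \<Rightarrow> nat. strict_mono r \<and> (\<forall>k. c \<le> z (r k))"
proof -
  obtain c where c: "c > 0" "\<And>N. \<exists>n\<ge>N. c \<le> dist (z n) 0"
    using assms(1) unfolding lim_sequentially by (meson not_less)
  then have "infinite {n. c \<le> dist (z n) 0}"
    unfolding infinite_nat_iff_unbounded_le by simp
  then obtain r :: "nat \<Rightarrow> nat" where r: "strict_mono r" "\<And>n. r n \<in> {n. c \<le> dist (z n) 0}"
    using infinite_enumerate by blast
  with c(1) assms(2) show ?thesis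
      by (intro exI[of _ c] conjI exI[of _ r]) (auto simp: dist_real_def)
qed

locale action_sequences = ergodic_action M \<tau> for M :: "'a measure" and \<tau> +
  fixes l :: nat and a :: "nat \<Rightarrow> nat \<Rightarrow> int"
begin

definition mult_mean :: "(nat \<Rightarrow> 'a \<Rightarrow> complex) \<Rightarrow> nat \<Rightarrow> 'a \<Rightarrow> complex" where
  "mult_mean f N x = avg {1..N} (\<lambda>n. \<Prod>i=1..l. f i (\<tau> (a i n) x))"

definition admissible :: "nat \<Rightarrow> (nat \<Rightarrow> 'a \<Rightarrow> complex) \<Rightarrow> bool" where
  "admissible m f \<longleftrightarrow> (\<forall>i\<in>{1..l}. f i \<in> unit_funs M) \<and> (\<forall>i\<in>{m<..l}. eigenfun (f i))"

text \<open>The induction statement: \<open>m = 0\<close> is the case of eigenfunctions, and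
  \<open>m = l\<close> is joint ergodicity for functions bounded by one.\<close>

definition converges_at :: "nat \<Rightarrow> bool" where
  "converges_at m \<longleftrightarrow> (\<forall>f. admissible m f \<longrightarrow> l2_lim (mult_mean f) (\<Prod>i=1..l. \<integral>x. f i x \<partial>M))"

text \<open>The index is shifted: \<open>seminorm_pow s\<close> belongs to the seminorm of degree
  \<open>s + 1\<close>.\<close>

definition seminorm_estimates :: "nat \<Rightarrow> bool" where
  "seminorm_estimates s \<longleftrightarrow> (\<forall>f. \<forall>m\<in>{1..l}. admissible m f \<longrightarrow> seminorm_pow s (f m) = 0
      \<longrightarrow> l2_lim (mult_mean f) 0)"

definition equidistribution :: bool where
  "equidistribution \<longleftrightarrow> (\<forall>t f. (\<forall>i\<in>{1..l}. eigenfun (f i) \<and> (AE x in M. f i (\<tau> 1 x)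
      = e (t i) * f i x))
     \<longrightarrow> (\<exists>i\<in>{1..l}. e (t i) \<noteq> 1)
     \<longrightarrow> (\<lambda>N. avg {1..N} (\<lambda>n. e (\<Sum>i=1..l. of_int (a i n) * t i))) \<longlonglongrightarrow> 0)"

lemma mult_mean_unit: "(\<And>i. i \<in> {1..l} \<Longrightarrow> f i \<in> unit_funs M) \<Longrightarrow> mult_mean f N \<in> unit_funs M"
  unfolding mult_mean_def by (intro unit_funs_avg unit_funs_prod unit_funs_action)

lemma mult_mean_linear:
  assumes j: "j \<in> {1..l}" and f: "\<And>x. f j x = \<alpha> * g x + \<beta> * h x"
  shows "mult_mean f N x = \<alpha> * mult_mean (f(j := g)) N x + \<beta> * mult_mean (f(j := h)) N x"
proof -
  have rem: "(\<Prod>i=1..l. (f(j := u)) i (\<tau> (a i n) x))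
      = u (\<tau> (a j n) x) * (\<Prod>i\<in>{1..l} - {j}. f i (\<tau> (a i n) x))" for u n
  proof -
    have "(\<Prod>i=1..l. (f(j := u)) i (\<tau> (a i n) x))
        = u (\<tau> (a j n) x) * (\<Prod>i\<in>{1..l} - {j}. (f(j := u)) i (\<tau> (a i n) x))"
      using j by (subst prod.remove[of _ j]) auto
    also have "(\<Prod>i\<in>{1..l} - {j}. (f(j := u)) i (\<tau> (a i n) x))
        = (\<Prod>i\<in>{1..l} - {j}. f i (\<tau> (a i n) x))"
      by (intro prod.cong) auto
    finally show ?thesis .
  qed
  have "mult_mean f N x = mult_mean (f(j := f j)) N x" by simp
  also have "\<dots> = \<alpha> * mult_mean (f(j := g)) N x + \<beta> * mult_mean (f(j := h)) N x"
    unfolding mult_mean_def rem f avg_def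
    by (simp add: distrib_right sum.distrib add_divide_distrib sum_distrib_left mult.assoc)
  finally show ?thesis .
qed

text \<open>Each summand is translated by \<open>a m n\<close>. Thus pairing \<open>h\<close> with
  the dual function amounts to pairing \<open>u\<close> with the averages that have \<open>h\<close>
  at place \<open>m\<close>.\<close>

lemma dual_identity:
  assumes m: "m \<in> {1..l}" and u: "u \<in> unit_funs M" and h: "h \<in> unit_funs M"
    and f: "\<And>i. i \<in> {1..l} \<Longrightarrow> f i \<in> unit_funs M"
  shows "avg {1..N} (\<lambda>n. \<integral>x. (u (\<tau> (- a m n) x) * (\<Prod>i\<in>{1..l} - {m}. f i (\<tau> (a i n - a m n) x)))
      * h x \<partial>M)
    = (\<integral>x. u x * mult_mean (f(m := h)) N x \<partial>M)"
proof -
  have summand: "(\<integral>x. (u (\<tau> (- a m n) x) * (\<Prod>i\<in>{1..l} - {m}. f i (\<tau> (a i n - a m n) x))) * h x \<partial>M)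
      = (\<integral>x. u x * (\<Prod>i=1..l. (f(m := h)) i (\<tau> (a i n) x)) \<partial>M)" for n
  proof -
    have "(\<integral>x. (u (\<tau> (- a m n) x) * (\<Prod>i\<in>{1..l} - {m}. f i (\<tau> (a i n - a m n) x))) * h x \<partial>M)
      = (\<integral>x. (u (\<tau> (- a m n) (\<tau> (a m n) x)) * (\<Prod>i\<in>{1..l} - {m}. f i (\<tau> (a i n - a m n) (\<tau>
          (a m n) x)))) * h (\<tau> (a m n) x) \<partial>M)"
      by (rule integral_action[symmetric], rule unit_funs_measurable)
         (intro unit_funs_mult unit_funs_prod unit_funs_action u h f, auto)
    also have "\<dots> = (\<integral>x. u x * ((f(m := h)) m (\<tau> (a m n) x)
        * (\<Prod>i\<in>{1..l} - {m}. (f(m := h)) i (\<tau> (a i n) x))) \<partial>M)"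
      by (intro Bochner_Integration.integral_cong refl) (simp add: action_add)
    also have "\<dots> = (\<integral>x. u x * (\<Prod>i=1..l. (f(m := h)) i (\<tau> (a i n) x)) \<partial>M)"
      using m by (subst prod.remove[of "{1..l}" m]) auto
    finally show ?thesis .
  qed
  have i: "integrable M (\<lambda>x. u x * (\<Prod>i=1..l. (f(m := h)) i (\<tau> (a i n) x)))" for n
    by (intro unit_funs_integrable unit_funs_mult unit_funs_prod unit_funs_action u) (auto
        intro: f h)
  show ?thesis unfolding summand mult_mean_def avg_def using i
    by (simp add: sum_distrib_left)
qed

lemma eigenfun_iterate:
  assumes \<xi>: "AE x in M. \<xi> (\<tau> 1 x) = e t * \<xi> x"
  shows "AE x in M. \<xi> (\<tau> n x) = e (of_int n * t) * \<xi> x"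
proof -
  have nat: "AE x in M. \<xi> (\<tau> (int k) x) = e (real k * t) * \<xi> x" for k
  proof (induction k)
    case (Suc k)
    from AE_action[OF \<xi>, of "int k"] Suc show ?case
      by eventually_elim (simp add: action_add distrib_right e_add mult.assoc)
  qed simp
  show ?thesis
  proof (cases "n \<ge> 0")
    case True
    then show ?thesis using nat[of "nat n"] by simp
  next
    case False
    from AE_action[OF nat[of "nat (- n)"], of n] show ?thesis
    proof eventually_elim
      case (elim x)
      then have "\<xi> x = e (- (of_int n * t)) * \<xi> (\<tau> n x)" using False by (simp add: action_add)
      then have "e (of_int n * t) * \<xi> x = (e (of_int n * t) * e (- (of_int n * t))) * \<xi> (\<tau> n x)"
        by (simp add: mult.assoc)
      then show ?case using e_minus_mult[of "of_int n * t"] by (simp add: mult.commute)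
    qed
  qed
qed

lemma mult_mean_eigenfun:
  assumes f: "\<And>i. i \<in> {1..l} \<Longrightarrow> AE x in M. f i (\<tau> 1 x) = e (t i) * f i x"
  shows "AE x in M. mult_mean f N x = avg {1..N} (\<lambda>n. e (\<Sum>i=1..l. of_int (a i n) * t i))
      * (\<Prod>i=1..l. f i x)"
proof -
  have "AE x in M. \<forall>i\<in>{1..l}. \<forall>n. f i (\<tau> (a i n) x) = e (of_int (a i n) * t i) * f i x"
    by (intro AE_finite_allI AE_all_countable[THEN iffD2] allI eigenfun_iterate f) auto
  then show ?thesis
  proof eventually_elim
    case (elim x)
    have prod_e: "(\<Prod>i\<in>A. e (g i)) = e (\<Sum>i\<in>A. g i)" for A and g :: "nat \<Rightarrow> real"
      by (induction A rule: infinite_finite_induct) (auto simp: e_add)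
    have "(\<Prod>i=1..l. f i (\<tau> (a i n) x)) = e (\<Sum>i=1..l. of_int (a i n) * t i) * (\<Prod>i=1..l. f i x)" for n
      using elim by (simp add: prod.distrib prod_e[symmetric])
    then show ?case unfolding mult_mean_def avg_def by (simp add: sum_distrib_right)
  qed
qed

text \<open>An identity for each \<open>N\<close>, so it turns equidistribution into convergence of
  averages and, for the converse implication, back again.\<close>

lemma mult_mean_eigenfun_energy:
  assumes \<xi>: "\<And>i. i \<in> {1..l} \<Longrightarrow> eigenfun (f i)"
    and f: "\<And>i. i \<in> {1..l} \<Longrightarrow> AE x in M. f i (\<tau> 1 x) = e (t i) * f i x"
  shows "(\<integral>x. (cmod (mult_mean f N x))\<^sup>2 \<partial>M)
      = (cmod (avg {1..N} (\<lambda>n. e (\<Sum>i=1..l. of_int (a i n) * t i))))\<^sup>2"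
proof -
  have "AE x in M. mult_mean f N x = avg {1..N} (\<lambda>n. e (\<Sum>i=1..l. of_int (a i n) * t i))
      * (\<Prod>i=1..l. f i x)"
    by (rule mult_mean_eigenfun) (rule f)
  then have "AE x in M. (cmod (mult_mean f N x))\<^sup>2
      = (cmod (avg {1..N} (\<lambda>n. e (\<Sum>i=1..l. of_int (a i n) * t i))))\<^sup>2"
  proof eventually_elim
    case (elim x)
    have "cmod (\<Prod>i=1..l. f i x) = 1" using \<xi> by (simp add: eigenfun_norm flip: prod_norm)
    then show ?case unfolding elim norm_mult by simp
  qed
  moreover have "mult_mean f N \<in> unit_funs M" by (intro mult_mean_unit eigenfun_unit \<xi>)
  ultimately have "(\<integral>x. (cmod (mult_mean f N x))\<^sup>2 \<partial>M)
      = (\<integral>x. (cmod (avg {1..N} (\<lambda>n. e (\<Sum>i=1..l. of_int (a i n) * t i))))\<^sup>2 \<partial>M)"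
    by (intro integral_cong_AE) (auto dest: unit_funs_measurable)
  then show ?thesis by (simp add: prob_space)
qed

lemma mult_mean_AE_const:
  assumes f: "\<And>i. i \<in> {1..l} \<Longrightarrow> AE x in M. f i x = c i" and N: "N \<ge> 1"
  shows "AE x in M. mult_mean f N x = (\<Prod>i=1..l. c i)"
proof -
  have "AE x in M. \<forall>i\<in>{1..l}. \<forall>n. f i (\<tau> (a i n) x) = c i"
    by (intro AE_finite_allI AE_all_countable[THEN iffD2] allI AE_action f) auto
  then show ?thesis
    by eventually_elim (use N in \<open>simp add: mult_mean_def avg_def\<close>)
qed

lemma converges_at_0:
  assumes equidistribution shows "converges_at 0"
  unfolding converges_at_def
proof (intro allI impI)
  fix f assume "admissible 0 f"
  then have \<xi>: "\<And>i. i \<in> {1..l} \<Longrightarrow> eigenfun (f i)" by (auto simp: admissible_def)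
  then have "\<forall>i\<in>{1..l}. \<exists>t. AE x in M. f i (\<tau> 1 x) = e t * f i x" by (auto simp: eigenfun_def)
  from bchoice[OF this] obtain t where t: "\<And>i. i \<in> {1..l} \<Longrightarrow> AE x in M. f i (\<tau> 1 x)
      = e (t i) * f i x"
    by blast
  show "l2_lim (mult_mean f) (\<Prod>i=1..l. \<integral>x. f i x \<partial>M)"
  proof (cases "\<exists>i\<in>{1..l}. e (t i) \<noteq> 1")
    case True
    then obtain i where i: "i \<in> {1..l}" "e (t i) \<noteq> 1" by blast
    have "(\<integral>x. f i x \<partial>M) = 0"
      by (rule eigenfun_const_or_mean_zero(2)[OF \<xi>[OF i(1)] t[OF i(1)] i(2)])
    then have p0: "(\<Prod>i=1..l. \<integral>x. f i x \<partial>M) = 0"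
      using i(1) by (intro prod_zero) auto
    have "(\<lambda>N. avg {1..N} (\<lambda>n. e (\<Sum>i=1..l. of_int (a i n) * t i))) \<longlonglongrightarrow> 0"
      using assms True \<xi> t unfolding equidistribution_def by blast
    then have "(\<lambda>N. (cmod (avg {1..N} (\<lambda>n. e (\<Sum>i=1..l. of_int (a i n) * t i))))\<^sup>2) \<longlonglongrightarrow> (cmod 0)\<^sup>2"
      by (intro tendsto_intros)
    moreover have "(\<integral>x. (cmod (mult_mean f N x))\<^sup>2 \<partial>M)
        = (cmod (avg {1..N} (\<lambda>n. e (\<Sum>i=1..l. of_int (a i n) * t i))))\<^sup>2" for N
      by (rule mult_mean_eigenfun_energy) (erule \<xi>, erule t)
    ultimately show ?thesis
      unfolding l2_lim_def p0 diff_zero by simp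
  next
    case False
    have const: "AE x in M. f i x = (\<integral>x. f i x \<partial>M)" if "i \<in> {1..l}" for i
      using eigenfun_const_or_mean_zero(1)[OF \<xi> t] that False by blast
    \<comment> \<open>\<open>N = 0\<close> is excluded since the empty average is 0 whatever the
      constants are.\<close>
    have "\<forall>\<^sub>F N in sequentially. (\<integral>x. (cmod (mult_mean f N x - (\<Prod>i=1..l. \<integral>x. f i x \<partial>M)))\<^sup>2 \<partial>M) = 0"
      using eventually_ge_at_top[of 1]
    proof eventually_elim
      case (elim N)
      have "AE x in M. mult_mean f N x = (\<Prod>i=1..l. \<integral>x. f i x \<partial>M)"
        by (rule mult_mean_AE_const[OF const elim])
      then have "AE x in M. (cmod (mult_mean f N x - (\<Prod>i=1..l. \<integral>x. f i x \<partial>M)))\<^sup>2 = 0"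
        by eventually_elim simp
      then show ?case by (rule integral_eq_zero_AE)
    qed
    then show ?thesis unfolding l2_lim_def by (rule tendsto_eventually)
  qed
qed

text \<open>The heart of the induction. If the averages did not tend to zero, a weak limit \<open>G\<close> of the
  dual functions would correlate with \<open>f m\<close>; it has mean zero, so by degree lowering all its
  seminorms vanish, and the seminorm estimate forces \<open>\<integral> \<bar>G\<bar>\<^sup>2 = 0\<close>.\<close>
lemma l2_lim_zero:
  assumes conv: "converges_at (m - 1)" and est: "seminorm_estimates s" and m: "m \<in> {1..l}"
    and f: "admissible m f" and mean0: "(\<integral>x. f m x \<partial>M) = 0"
    and prod0: "(\<Prod>i\<in>{1..l} - {m}. \<integral>x. f i x \<partial>M) = 0 \<or> (\<forall>N. (\<integral>x. mult_mean f N x \<partial>M) = 0)"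
  shows "l2_lim (mult_mean f) 0"
proof (rule ccontr)
  assume "\<not> ?thesis"
  then have "\<not> (\<lambda>N. \<integral>x. (cmod (mult_mean f N x))\<^sup>2 \<partial>M) \<longlonglongrightarrow> 0" by (simp add: l2_lim_def)
  then have "\<exists>c>0. \<exists>r :: nat \<Rightarrow> nat. strict_mono r \<and> (\<forall>k. c
      \<le> (\<integral>x. (cmod (mult_mean f (r k) x))\<^sup>2 \<partial>M))"
    by (rule not_tendsto_zero_subseq) simp
  then obtain c and r :: "nat \<Rightarrow> nat" where c: "c > 0" and r: "strict_mono r"
    and large: "\<And>k. c \<le> (\<integral>x. (cmod (mult_mean f (r k) x))\<^sup>2 \<partial>M)" by blast
  have fu: "\<And>i. i \<in> {1..l} \<Longrightarrow> f i \<in> unit_funs M" and f\<xi>: "\<And>i. i \<in> {m<..l} \<Longrightarrow> eigenfun (f i)"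
    using f by (auto simp: admissible_def)
  \<comment> \<open>With this choice the pairing of \<open>F k\<close> with \<open>f m\<close> is
    the energy of the average, which is bounded below.\<close>
  define u where "u k x = cnj (mult_mean f (r k) x)" for k x
  have u: "u k \<in> unit_funs M" for k unfolding u_def by (intro unit_funs_cnj mult_mean_unit fu)
  define \<phi> where "\<phi> k n x = u k (\<tau> (- a m n) x) * (\<Prod>i\<in>{1..l} - {m}. f i (\<tau> (a i n - a m n) x))"
      for k n x
  have \<phi>: "\<phi> k n \<in> unit_funs M" for k n unfolding \<phi>_def
    by (intro unit_funs_mult unit_funs_prod unit_funs_action u fu) auto
  define F where "F k x = avg {1..r k} (\<lambda>n. \<phi> k n x)" for k x
  have F: "F k \<in> unit_funs M" for k unfolding F_def by (intro unit_funs_avg \<phi>)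
  obtain G where G: "weak_cluster F G" using weak_cluster_ex[of F] F by auto
  have Gu: "G \<in> unit_funs M" using G by (rule weak_cluster_unit)
  have pair_F: "(\<integral>x. h x * F k x \<partial>M) = (\<integral>x. u k x * mult_mean (f(m := h)) (r k) x \<partial>M)"
      if h: "h \<in> unit_funs M" for h k
  proof -
    have "integrable M (\<lambda>x. \<phi> k n x * h x)" for n by (intro unit_funs_integrable unit_funs_mult \<phi> h)
    then have "(\<integral>x. h x * F k x \<partial>M) = avg {1..r k} (\<lambda>n. \<integral>x. \<phi> k n x * h x \<partial>M)"
      by (simp add: F_def avg_def sum_distrib_left mult.commute)
    then show ?thesis unfolding \<phi>_def using dual_identity[OF m u h fu] by simp
  qed
  have lim_pair: "(\<lambda>k. \<integral>x. v k x * mult_mean g (r k) x \<partial>M) \<longlonglongrightarrow> 0"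
    if "l2_lim (mult_mean g) 0" "\<And>i. i \<in> {1..l} \<Longrightarrow> g i \<in> unit_funs M" "\<And>k. v k \<in> unit_funs M" for g v
    using l2_lim_integral[OF unit_funs_subset[OF mult_mean_unit[OF that(2)]] that(1) r, of v]
        that(3) by simp
  have m_pos: "m - 1 < m" using m by auto
  have "(\<integral>x. G x \<partial>M) = 0"
  proof -
    \<comment> \<open>The mean of \<open>F k\<close> pairs \<open>u k\<close> with the averages that
      have 1 at place \<open>m\<close>. Since 1 is an eigenfunction, these converge to
      \<open>p\<close> by \<open>conv\<close>; the limit of the pairing is zero because
      \<open>prod0\<close> annihilates either \<open>p\<close> or the mean of
      \<open>u k\<close>.\<close>
    define g where "g = f(m := (\<lambda>_. 1))"
    define p where "p = (\<Prod>i\<in>{1..l} - {m}. \<integral>x. f i x \<partial>M)"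
    have g: "admissible (m - 1) g"
      using fu f\<xi> unfolding admissible_def g_def by (auto intro: eigenfun_const unit_funs_const)
    have "(\<Prod>i=1..l. \<integral>x. g i x \<partial>M) = (\<integral>x. g m x \<partial>M) * (\<Prod>i\<in>{1..l} - {m}. \<integral>x. g i x \<partial>M)"
      using m by (subst prod.remove[of _ m]) auto
    also have "\<dots> = p" unfolding p_def g_def by (auto simp: prob_space intro!: prod.cong)
    finally have "l2_lim (mult_mean g) p" using conv g unfolding converges_at_def by metis
    moreover have "mult_mean g N \<in> bounded_funs M" for N
      using g by (intro unit_funs_subset mult_mean_unit) (auto simp: admissible_def)
    ultimately have "(\<lambda>k. (\<integral>x. u k x * mult_mean g (r k) x \<partial>M) - p * (\<integral>x. u k x \<partial>M)) \<longlonglongrightarrow> 0"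
      by (intro l2_lim_integral r u)
    moreover have "p * (\<integral>x. u k x \<partial>M) = 0" for k
      using prod0 unfolding u_def p_def by auto
    moreover have "(\<integral>x. 1 * F k x \<partial>M) = (\<integral>x. u k x * mult_mean g (r k) x \<partial>M)" for k
      unfolding g_def by (rule pair_F) (simp add: unit_funs_const)
    ultimately have "(\<lambda>k. \<integral>x. 1 * F k x \<partial>M) \<longlonglongrightarrow> 0" by simp
    from weak_cluster_lim[OF G _ this] show ?thesis by simp
  qed
  then have "seminorm_pow 0 G = 0" by simp
  have vanish: "(\<lambda>k. avg {1..r k} (\<lambda>n. \<integral>x. shift_cube ps (\<phi> k n) x * \<xi> x \<partial>M)) \<longlonglongrightarrow> 0"
    if \<xi>: "eigenfun \<xi>" "(\<integral>x. \<xi> x \<partial>M) = 0" for ps \<xi>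
  proof -
    \<comment> \<open>\<open>shift_cube\<close> is multiplicative and commutes with the action, so
      the cube of a dual function is the dual function of the cubes. With \<open>\<xi>\<close> at
      place \<open>m\<close> and cubes of eigenfunctions after it, \<open>conv\<close> applies, and
      the limit is zero because \<open>\<xi>\<close> has mean zero.\<close>
    define g where "g i = shift_cube ps (f i)" for i
    have gu: "g i \<in> unit_funs M" if "i \<in> {1..l}" for i unfolding g_def
        by (intro shift_cube_unit fu that)
    have g\<xi>: "eigenfun (g i)" if "i \<in> {m<..l}" for i unfolding g_def
        by (intro shift_cube_eigenfun f\<xi> that)
    have "admissible (m - 1) (g(m := \<xi>))"
      using gu g\<xi> \<xi>(1) unfolding admissible_def by (auto intro: eigenfun_unit)
    moreover have "(\<Prod>i=1..l. \<integral>x. (g(m := \<xi>)) i x \<partial>M) = 0" using m \<xi>(2) by (auto simp: prod_zero_iff)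
    ultimately have "l2_lim (mult_mean (g(m := \<xi>))) 0" using conv unfolding converges_at_def
        by metis
    then have "(\<lambda>k. \<integral>x. shift_cube ps (u k) x * mult_mean (g(m := \<xi>)) (r k) x \<partial>M) \<longlonglongrightarrow> 0"
      using gu eigenfun_unit[OF \<xi>(1)] by (intro lim_pair shift_cube_unit u) auto
    moreover have "avg {1..r k} (\<lambda>n. \<integral>x. shift_cube ps (\<phi> k n) x * \<xi> x \<partial>M)
        = (\<integral>x. shift_cube ps (u k) x * mult_mean (g(m := \<xi>)) (r k) x \<partial>M)" for k
    proof -
      have "shift_cube ps (\<phi> k n) x
          = shift_cube ps (u k) (\<tau> (- a m n) x) * (\<Prod>i\<in>{1..l} - {m}. g i (\<tau>
              (a i n - a m n) x))" for n x
        unfolding \<phi>_def g_def shift_cube_mult shift_cube_prod shift_cube_action ..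
      then show ?thesis
        using dual_identity[OF m shift_cube_unit[OF u] eigenfun_unit[OF \<xi>(1)] gu] by simp
    qed
    ultimately show ?thesis by simp
  qed
  have all_zero: "seminorm_pow t G = 0" for t
  proof (induction t)
    case (Suc t)
    have "\<not> seminorm_pow (Suc t) G > 0"
      using degree_lowering[of \<phi> r G t, OF \<phi> G[unfolded F_def[abs_def]] vanish] Suc by auto
    then show ?case using seminorm_pow_bounds(1)[OF Gu, of "Suc t"] by simp
  qed fact
  \<comment> \<open>With \<open>cnj G\<close> at place \<open>m\<close> the averages pair with
    \<open>u k\<close> as \<open>F k\<close> pairs with \<open>cnj G\<close>, and in the limit this
    is the squared norm of \<open>G\<close>.\<close>
  have cG: "(\<lambda>x. cnj (G x)) \<in> unit_funs M" by (intro unit_funs_cnj Gu)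
  have "admissible m (f(m := (\<lambda>x. cnj (G x))))"
    using fu f\<xi> cG unfolding admissible_def by auto
  moreover have "seminorm_pow s ((f(m := (\<lambda>x. cnj (G x)))) m) = 0"
    using all_zero[of s] by (simp add: seminorm_pow_cnj)
  ultimately have "l2_lim (mult_mean (f(m := (\<lambda>x. cnj (G x))))) 0"
    using est m unfolding seminorm_estimates_def by blast
  then have "(\<lambda>k. \<integral>x. cnj (G x) * F k x \<partial>M) \<longlonglongrightarrow> 0"
    unfolding pair_F[OF cG] using fu cG by (intro lim_pair u) auto
  from weak_cluster_lim[OF G unit_funs_subset[OF cG] this]
  have "AE x in M. G x = 0" by (rule AE_zero_of_square_integral[OF unit_funs_subset[OF Gu]])
  then have "AE x in M. - f m x * G x = 0" by eventually_elim simp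
  then have zero: "(\<integral>x. - f m x * G x \<partial>M) = 0" by (rule integral_eq_zero_AE)
  \<comment> \<open>The minus sign turns the lower bound on the energies into an upper bound, which
    is what \<open>G\<close> inherits.\<close>
  have "Re (\<integral>x. - f m x * G x \<partial>M) \<le> - c"
  proof (rule weak_cluster_le[OF G])
    show "(\<lambda>x. - f m x) \<in> bounded_funs M"
      using bounded_funs_cmult[OF unit_funs_subset[OF fu[OF m]], of "-1"] by simp
    have "Re (\<integral>x. - f m x * F k x \<partial>M) \<le> - c" for k
    proof -
      have "(\<integral>x. f m x * F k x \<partial>M) = (\<integral>x. complex_of_real ((cmod (mult_mean f (r k) x))\<^sup>2) \<partial>M)"
        unfolding pair_F[OF fu[OF m]] u_def complex_norm_square by (simp add: mult.commute)
      then show ?thesis using large[of k] by (simp del: of_real_power)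
    qed
    then show "\<forall>\<^sub>F k in sequentially. Re (\<integral>x. - f m x * F k x \<partial>M) \<le> - c" by simp
  qed
  with zero c show False by simp
qed

text \<open>Halving keeps the centred function in the unit ball.\<close>

lemma centered:
  assumes "g \<in> unit_funs M"
  defines "h \<equiv> \<lambda>x. (g x - (\<integral>x. g x \<partial>M)) / 2"
  shows "h \<in> unit_funs M" "(\<integral>x. h x \<partial>M) = 0" "\<And>x. g x = (\<integral>x. g x \<partial>M) * 1 + 2 * h x"
proof -
  have "cmod (g x - (\<integral>x. g x \<partial>M)) \<le> 1 + 1" for x
    by (intro order_trans[OF norm_triangle_ineq4] add_mono unit_funs_le[OF assms(1)]
        norm_integral_le)
  then show "h \<in> unit_funs M"
    using assms(1) by (auto simp: h_def unit_funs_def norm_divide)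
  show "(\<integral>x. h x \<partial>M) = 0" using unit_funs_integrable[OF assms(1)] by (simp add: h_def prob_space)
qed (simp add: h_def diff_divide_distrib)

text \<open>Here the functions at the positions before \<open>m\<close> are replaced by their means one after the
  other; \<open>j\<close> is the number of those not yet replaced.\<close>
lemma l2_lim_mean_zero:
  assumes conv: "converges_at (m - 1)" and est: "seminorm_estimates s" and m: "m \<in> {1..l}"
    and f: "admissible m f" and mean0: "(\<integral>x. f m x \<partial>M) = 0"
    and const: "\<And>i. j < i \<Longrightarrow> i < m \<Longrightarrow> f i = (\<lambda>_. 1)" and j: "j < m"
  shows "l2_lim (mult_mean f) 0"
  using f mean0 const j
proof (induction j arbitrary: f)
  case 0
  have fu: "\<And>i. i \<in> {1..l} \<Longrightarrow> f i \<in> unit_funs M" and f\<xi>: "\<And>i. i \<in> {m<..l} \<Longrightarrow> eigenfun (f i)"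
    using 0 by (auto simp: admissible_def)
  \<comment> \<open>If the product of the other means is non-zero, the eigenfunctions after
    \<open>m\<close> are constant, and the functions before \<open>m\<close> are 1. The average is
    then a multiple of an average of translates of \<open>f m\<close>, which has mean zero.\<close>
  have "(\<integral>x. mult_mean f N x \<partial>M) = 0" if nz: "(\<Prod>i\<in>{1..l} - {m}. \<integral>x. f i x \<partial>M) \<noteq> 0" for N
  proof -
    have c: "AE x in M. f i x = (\<integral>x. f i x \<partial>M)" if "i \<in> {1..l} - {m}" for i
    proof (cases "i < m")
      case True
      then have "f i = (\<lambda>_. 1)" using 0(3)[of i] that by auto
      then show ?thesis by (simp add: prob_space)
    next
      case False
      then show ?thesis using that nz by (intro eigenfun_nonzero_mean f\<xi>) (auto simp: prod_zero_iff)
    qed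
    have "AE x in M. \<forall>i\<in>{1..l} - {m}. \<forall>n. f i (\<tau> (a i n) x) = (\<integral>x. f i x \<partial>M)"
      by (intro AE_finite_allI AE_all_countable[THEN iffD2] allI AE_action c) auto
    then have "AE x in M. mult_mean f N x
        = avg {1..N} (\<lambda>n. f m (\<tau> (a m n) x)) * (\<Prod>i\<in>{1..l} - {m}. \<integral>x. f i x \<partial>M)"
    proof eventually_elim
      case (elim x)
      have "(\<Prod>i=1..l. f i (\<tau> (a i n) x)) = f m (\<tau> (a m n) x) * (\<Prod>i\<in>{1..l} - {m}. \<integral>x. f i x \<partial>M)"
          for n
        using m elim by (subst prod.remove[of _ m]) auto
      then show ?case unfolding mult_mean_def avg_def by (simp add: sum_distrib_right)
    qed
    moreover have "(\<lambda>x. avg {1..N} (\<lambda>n. f m (\<tau> (a m n) x))) \<in> unit_funs M"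
      by (intro unit_funs_avg unit_funs_action fu m)
    ultimately have "(\<integral>x. mult_mean f N x \<partial>M)
        = (\<integral>x. avg {1..N} (\<lambda>n. f m (\<tau> (a m n) x)) * (\<Prod>i\<in>{1..l} - {m}. \<integral>x. f i x \<partial>M) \<partial>M)"
      using mult_mean_unit[of f N] fu
      by (intro integral_cong_AE) (auto dest: unit_funs_measurable)
    also have "\<dots> = (\<integral>x. avg {1..N} (\<lambda>n. f m (\<tau> (a m n) x)) \<partial>M) * (\<Prod>i\<in>{1..l} - {m}. \<integral>x. f i x \<partial>M)"
      by simp
    also have "(\<integral>x. avg {1..N} (\<lambda>n. f m (\<tau> (a m n) x)) \<partial>M) = 0"
    proof -
      have "integrable M (\<lambda>x. f m (\<tau> (a m n) x))" for n
          by (intro unit_funs_integrable unit_funs_action fu m)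
      then show ?thesis
        using 0(2) by (simp add: avg_def integral_action[OF unit_funs_measurable[OF fu[OF m]]])
    qed
    finally show ?thesis by simp
  qed
  then show ?case by (intro l2_lim_zero[OF conv est m 0(1,2)]) blast
next
  case (Suc j)
  define q where "q = Suc j"
  have q: "q \<in> {1..l}" "q < m" "q \<noteq> m" using Suc.prems(4) m by (auto simp: q_def)
  have fu: "\<And>i. i \<in> {1..l} \<Longrightarrow> f i \<in> unit_funs M" and f\<xi>: "\<And>i. i \<in> {m<..l} \<Longrightarrow> eigenfun (f i)"
    using Suc.prems by (auto simp: admissible_def)
  define h where "h x = (f q x - (\<integral>x. f q x \<partial>M)) / 2" for x
  have h: "h \<in> unit_funs M" "(\<integral>x. h x \<partial>M) = 0" "\<And>x. f q x = (\<integral>x. f q x \<partial>M) * 1 + 2 * h x"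
    using centered[OF fu[OF q(1)]] unfolding h_def by auto
  have adm: "admissible m (f(q := v))" if "v \<in> unit_funs M" for v
    using fu f\<xi> q that by (auto simp: admissible_def)
  have one: "l2_lim (mult_mean (f(q := (\<lambda>_. 1)))) 0"
  proof (rule Suc.IH)
    show "admissible m (f(q := (\<lambda>_. 1)))" by (intro adm unit_funs_const) simp
    show "(f(q := (\<lambda>_. 1))) i = (\<lambda>_. 1)" if "j < i" "i < m" for i
      using Suc.prems(3)[of i] that by (auto simp: q_def)
  qed (use Suc.prems q in auto)
  \<comment> \<open>The centred function sits at \<open>q \<noteq> m\<close>, so the product of the
    other means vanishes and \<open>l2_lim_zero\<close> applies directly.\<close>
  have zero: "l2_lim (mult_mean (f(q := h))) 0"
  proof (rule l2_lim_zero[OF conv est m adm[OF h(1)]])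
    show "(\<integral>x. (f(q := h)) m x \<partial>M) = 0" using q Suc.prems by auto
    have "(\<Prod>i\<in>{1..l} - {m}. \<integral>x. (f(q := h)) i x \<partial>M) = 0"
      using q h(2) by (intro prod_zero) (auto intro!: bexI[of _ q])
    then show "(\<Prod>i\<in>{1..l} - {m}. \<integral>x. (f(q := h)) i x \<partial>M)
        = 0 \<or> (\<forall>N. (\<integral>x. mult_mean (f(q := h)) N x \<partial>M) = 0)" ..
  qed
  have bounded: "mult_mean (f(q := v)) N \<in> bounded_funs M" if "v \<in> unit_funs M" for v N
    using fu that by (intro unit_funs_subset mult_mean_unit) auto
  have "l2_lim (\<lambda>N x. (\<integral>x. f q x \<partial>M) * mult_mean (f(q := (\<lambda>_. 1))) N x + 2
      * mult_mean (f(q := h)) N x)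
      ((\<integral>x. f q x \<partial>M) * 0 + 2 * 0)"
    by (rule l2_lim_add[OF bounded bounded one zero]) (auto intro: h unit_funs_const)
  moreover have "mult_mean f = (\<lambda>N x. (\<integral>x. f q x \<partial>M) * mult_mean (f(q := (\<lambda>_. 1))) N x + 2
      * mult_mean (f(q := h)) N x)"
    by (intro ext mult_mean_linear[where g = "\<lambda>_. 1" and h = h] q(1) h(3))
  ultimately show ?case by simp
qed

text \<open>The constant part of \<open>f m\<close> is a multiple of an eigenfunction and falls
  under \<open>converges_at (m - 1)\<close>; the centred part is \<open>l2_lim_mean_zero\<close>,
  with \<open>j = m - 1\<close> so that nothing is yet assumed constant.\<close>

lemma converges_at_step:
  assumes conv: "converges_at (m - 1)" and est: "seminorm_estimates s" and m: "m \<in> {1..l}"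
  shows "converges_at m"
  unfolding converges_at_def
proof (intro allI impI)
  fix f assume f: "admissible m f"
  have fu: "\<And>i. i \<in> {1..l} \<Longrightarrow> f i \<in> unit_funs M" and f\<xi>: "\<And>i. i \<in> {m<..l} \<Longrightarrow> eigenfun (f i)"
    using f by (auto simp: admissible_def)
  define h where "h x = (f m x - (\<integral>x. f m x \<partial>M)) / 2" for x
  have h: "h \<in> unit_funs M" "(\<integral>x. h x \<partial>M) = 0" "\<And>x. f m x = (\<integral>x. f m x \<partial>M) * 1 + 2 * h x"
    using centered[OF fu[OF m]] unfolding h_def by auto
  define p where "p = (\<Prod>i\<in>{1..l} - {m}. \<integral>x. f i x \<partial>M)"
  have "admissible (m - 1) (f(m := (\<lambda>_. 1)))"
    using fu f\<xi> unfolding admissible_def by (auto intro: eigenfun_const unit_funs_const)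
  moreover have "(\<Prod>i=1..l. \<integral>x. (f(m := (\<lambda>_. 1))) i x \<partial>M) = p"
    using m unfolding p_def by (subst prod.remove[of _ m]) (auto simp: prob_space intro!: prod.cong)
  ultimately have one: "l2_lim (mult_mean (f(m := (\<lambda>_. 1)))) p"
    using conv unfolding converges_at_def by metis
  have zero: "l2_lim (mult_mean (f(m := h))) 0"
  proof (rule l2_lim_mean_zero[OF conv est m, where j = "m - 1"])
    show "admissible m (f(m := h))" using fu f\<xi> h by (auto simp: admissible_def)
  qed (use h m in auto)
  have bounded: "mult_mean (f(m := v)) N \<in> bounded_funs M" if "v \<in> unit_funs M" for v N
    using fu that by (intro unit_funs_subset mult_mean_unit) auto
  have "l2_lim (\<lambda>N x. (\<integral>x. f m x \<partial>M) * mult_mean (f(m := (\<lambda>_. 1))) N x + 2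
      * mult_mean (f(m := h)) N x)
      ((\<integral>x. f m x \<partial>M) * p + 2 * 0)"
    by (rule l2_lim_add[OF bounded bounded one zero]) (auto intro: h unit_funs_const)
  moreover have "(\<Prod>i=1..l. \<integral>x. f i x \<partial>M) = (\<integral>x. f m x \<partial>M) * p"
    using m unfolding p_def by (subst prod.remove[of _ m]) auto
  moreover have "mult_mean f = (\<lambda>N x. (\<integral>x. f m x \<partial>M) * mult_mean (f(m := (\<lambda>_. 1))) N x + 2
      * mult_mean (f(m := h)) N x)"
    by (intro ext mult_mean_linear[where g = "\<lambda>_. 1" and h = h] m h(3))
  ultimately show "l2_lim (mult_mean f) (\<Prod>i=1..l. \<integral>x. f i x \<partial>M)" by simp
qed

theorem mult_mean_converges:
  assumes equidistribution "seminorm_estimates s" "\<And>i. i \<in> {1..l} \<Longrightarrow> f i \<in> unit_funs M"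
  shows "l2_lim (mult_mean f) (\<Prod>i=1..l. \<integral>x. f i x \<partial>M)"
proof -
  have "m \<le> l \<Longrightarrow> converges_at m" for m
  proof (induction m)
    case (Suc m)
    then show ?case using converges_at_step[of "Suc m" s] assms(2) by simp
  qed (simp add: converges_at_0 assms(1))
  then have "converges_at l" by simp
  then show ?thesis using assms(3) by (auto simp: converges_at_def admissible_def)
qed

end

subsection \<open>Measure preserving systems\<close>

text \<open>Outside the space the action is trivial, so that it is an action of the integers on the
  whole type.\<close>
definition act :: "'a measure \<Rightarrow> ('a \<Rightarrow> 'a) \<Rightarrow> int \<Rightarrow> 'a \<Rightarrow> 'a" where
  "act M T n x = (if x \<in> space M then iter M T n x else x)"

locale ergodic_mp_system =
  fixes M :: "'a measure" and T :: "'a \<Rightarrow> 'a"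
  assumes mp: "mp_system M T" and erg: "ergodic M T"
begin

abbreviation S :: "'a \<Rightarrow> 'a" where "S \<equiv> inv_into (space M) T"

lemma prob: "prob_space M"
  using mp by (simp add: mp_system_def lebesgue_prob_space_def)

lemma bij: "bij_betw T (space M) (space M)"
  and T_measurable: "T \<in> measurable M M" and S_measurable: "S \<in> measurable M M"
  and T_distr: "distr M M T = M"
  using mp by (auto simp: mp_system_def)

lemma T_in: "x \<in> space M \<Longrightarrow> T x \<in> space M"
  using bij by (auto simp: bij_betw_def)

lemma S_in: "x \<in> space M \<Longrightarrow> S x \<in> space M"
  using bij by (metis bij_betw_def inv_into_into)

lemma T_S: "x \<in> space M \<Longrightarrow> T (S x) = x"
  using bij by (metis bij_betw_def f_inv_into_f)

lemma S_T: "x \<in> space M \<Longrightarrow> S (T x) = x"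
  using bij by (simp add: bij_betw_def)

lemma S_distr: "distr M M S = M"
proof -
  have "distr M M S = distr (distr M M T) M S" by (simp add: T_distr)
  also have "\<dots> = distr M M (S \<circ> T)" by (intro distr_distr S_measurable T_measurable)
  also have "\<dots> = distr M M (\<lambda>x. x)" by (intro distr_cong) (auto simp: S_T)
  finally show ?thesis by (simp add: distr_id2)
qed

lemma act_in: "x \<in> space M \<Longrightarrow> act M T n x \<in> space M"
proof -
  assume x: "x \<in> space M"
  have "(T ^^ k) x \<in> space M" "(S ^^ k) x \<in> space M" for k
    by (induction k) (auto intro: x T_in S_in)
  then show ?thesis using x by (simp add: act_def iter_def)
qed

lemma act_0: "act M T 0 x = x"
  by (simp add: act_def iter_def)

lemma act_succ:
  assumes x: "x \<in> space M" shows "act M T (n + 1) x = T (act M T n x)"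
proof (cases "n \<ge> 0")
  case True
  then have "nat (n + 1) = Suc (nat n)" by simp
  with True x show ?thesis by (simp add: act_def iter_def)
next
  case False
  define k where "k = nat (- n) - 1"
  have k: "nat (- n) = Suc k" using False by (simp add: k_def)
  have in_k: "(S ^^ k) x \<in> space M" by (induction k) (auto intro: x S_in)
  have "act M T n x = S ((S ^^ k) x)" using False x by (simp add: act_def iter_def k)
  then have "T (act M T n x) = (S ^^ k) x" using T_S[OF in_k] by simp
  moreover have "act M T (n + 1) x = (S ^^ k) x"
  proof (cases "n = -1")
    case True
    then show ?thesis using x by (simp add: act_def iter_def k_def)
  next
    case n: False
    then have "nat (- (n + 1)) = k" "\<not> 0 \<le> n + 1" using False by (auto simp: k_def)
    then show ?thesis using x by (simp add: act_def iter_def)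
  qed
  ultimately show ?thesis by simp
qed

lemma act_pred:
  assumes x: "x \<in> space M" shows "act M T (n - 1) x = S (act M T n x)"
  using act_succ[OF x, of "n - 1"] S_T[OF act_in[OF x]] by simp

lemma act_1: "x \<in> space M \<Longrightarrow> act M T 1 x = T x"
  using act_succ[of x 0] by (simp add: act_0)

lemma act_add: "act M T m (act M T n x) = act M T (m + n) x"
proof (cases "x \<in> space M")
  case True
  show ?thesis
  proof (induction m rule: int_induct[where k = 0])
    case (step1 i)
    show ?case using act_succ[OF act_in[OF True], of i n] act_succ[OF True, of "i + n"] step1
        by (simp add: algebra_simps)
  next
    case (step2 i)
    show ?case using act_pred[OF act_in[OF True], of i n] act_pred[OF True, of "i + n"] step2
        by (simp add: algebra_simps)
  qed (simp add: act_0)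
qed (simp add: act_def)

lemma act_measurable_distr: "act M T n \<in> measurable M M \<and> distr M M (act M T n) = M"
proof (induction n rule: int_induct[where k = 0])
  case base
  have "act M T 0 = (\<lambda>x. x)" by (auto simp: act_0)
  then show ?case by (simp add: distr_id2)
next
  case (step1 i)
  have meas: "act M T (i + 1) \<in> measurable M M"
    using measurable_comp[of "act M T i" M M T M] step1 T_measurable
    by (subst measurable_cong[of M _ "T \<circ> act M T i"]) (auto simp: act_succ)
  have "distr M M (act M T (i + 1)) = distr M M (T \<circ> act M T i)"
    by (intro distr_cong) (auto simp: act_succ)
  also have "\<dots> = distr (distr M M (act M T i)) M T" using step1 T_measurable
      by (intro distr_distr[symmetric]) auto
  also have "\<dots> = M" using step1 by (simp add: T_distr)
  finally show ?case using meas by simp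
next
  case (step2 i)
  have meas: "act M T (i - 1) \<in> measurable M M"
    using measurable_comp[of "act M T i" M M S M] step2 S_measurable
    by (subst measurable_cong[of M _ "S \<circ> act M T i"]) (auto simp: act_pred)
  have "distr M M (act M T (i - 1)) = distr M M (S \<circ> act M T i)"
    by (intro distr_cong) (auto simp: act_pred)
  also have "\<dots> = distr (distr M M (act M T i)) M S" using step2 S_measurable
      by (intro distr_distr[symmetric]) auto
  also have "\<dots> = M" using step2 by (simp add: S_distr)
  finally show ?case using meas by simp
qed

lemma AE_act_1: "(AE x in M. P (act M T 1 x) x) \<longleftrightarrow> (AE x in M. P (T x) x)"
  by (intro AE_cong) (simp add: act_1)

sublocale ergodic_action M "act M T"
proof -
  interpret prob_space M by (rule prob)
  show "ergodic_action M (act M T)"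
  proof
    fix f :: "'a \<Rightarrow> complex"
    assume f: "f \<in> unit_funs M" and inv: "AE x in M. f (act M T 1 x) = f x"
    have "AE x in M. f (T x) = f x" using inv AE_act_1[of "\<lambda>y x. f y = f x"] by simp
    then show "\<exists>c. AE x in M. f x = c"
      using erg unit_funs_integrable[OF f] unfolding ergodic_def by blast
  qed (use act_add act_0 act_measurable_distr in auto)
qed

text \<open>The function is set to 0 on the null set where the essential bound fails; the maximum
  with 1 keeps \<open>C\<close> positive.\<close>

lemma Linf_scaled:
  assumes "f \<in> Linf M"
  shows "\<exists>C g. C > 0 \<and> g \<in> unit_funs M \<and> (AE x in M. f x = complex_of_real C * g x)"
proof -
  obtain C' where C': "AE x in M. cmod (f x) \<le> C'" and [measurable]: "f \<in> borel_measurable M"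
    using assms by (auto simp: Linf_def)
  define C where "C = max C' 1"
  define g where "g x = (if cmod (f x) \<le> C then f x / C else 0)" for x
  have C: "C > 0" by (simp add: C_def)
  have "cmod (g x) \<le> 1" for x using C by (simp add: g_def norm_divide)
  moreover have "g \<in> borel_measurable M" unfolding g_def by measurable
  moreover have "AE x in M. f x = complex_of_real C * g x"
    using C' by eventually_elim (use C in \<open>auto simp: g_def C_def\<close>)
  ultimately show ?thesis using C unfolding unit_funs_def by blast
qed

lemma unit_funs_Linf: "f \<in> unit_funs M \<Longrightarrow> f \<in> Linf M"
  by (auto simp: unit_funs_def Linf_def)

lemma eigenfun_Eig: "eigenfun \<xi> \<Longrightarrow> \<xi> \<in> Eig M T"
proof -
  assume \<xi>: "eigenfun \<xi>"
  then obtain t where "AE x in M. \<xi> (act M T 1 x) = e t * \<xi> x" by (auto simp: eigenfun_def)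
  then have "AE x in M. \<xi> (T x) = e (frac t) * \<xi> x"
    using AE_act_1[of "\<lambda>y x. \<xi> y = e t * \<xi> x"] by (simp add: e_frac)
  moreover have "frac t \<in> {0..<1}" by (simp add: frac_lt_1)
  ultimately show ?thesis
    using \<xi> unit_funs_Linf[OF eigenfun_unit[OF \<xi>]] unfolding Eig_def by (auto simp: eigenfun_norm)
qed

lemma eigenvalue_Spec:
  assumes \<xi>: "eigenfun \<xi>" and t: "AE x in M. \<xi> (act M T 1 x) = e t * \<xi> x"
  shows "frac t \<in> Spec M T"
proof -
  have "AE x in M. \<xi> (T x) = e (frac t) * \<xi> x"
    using t AE_act_1[of "\<lambda>y x. \<xi> y = e t * \<xi> x"] by (simp add: e_frac)
  moreover have "\<xi> \<in> L2 M"
    using \<xi> by (auto simp: L2_def eigenfun_norm eigenfun_def)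
  moreover have "\<not> (AE x in M. \<xi> x = 0)"
  proof
    assume "AE x in M. \<xi> x = 0"
    then have "AE x in M. False" by eventually_elim
        (metis eigenfun_norm[OF \<xi>] norm_zero zero_neq_one)
    then show False by simp
  qed
  ultimately show ?thesis unfolding Spec_def by (auto simp: frac_lt_1)
qed

text \<open>By ergodicity the modulus of an \<open>L2\<close> eigenfunction is almost everywhere a
  non-zero constant, so dividing by it preserves the eigenvalue relation.\<close>

lemma Spec_eigenfun:
  assumes "t \<in> Spec M T"
  shows "\<exists>\<xi>. eigenfun \<xi> \<and> (AE x in M. \<xi> (act M T 1 x) = e t * \<xi> x)"
proof -
  obtain f where f: "f \<in> L2 M" "\<not> (AE x in M. f x = 0)" and eig: "AE x in M. f (T x) = e t * f x"
    using assms by (auto simp: Spec_def)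
  have [measurable]: "f \<in> borel_measurable M" using f by (simp add: L2_def)
  have "integrable M (\<lambda>x. complex_of_real (cmod (f x)))"
  proof (rule Bochner_Integration.integrable_bound[where f = "\<lambda>x. 1 + (cmod (f x))\<^sup>2"])
    show "integrable M (\<lambda>x. 1 + (cmod (f x))\<^sup>2)" using f by (simp add: L2_def)
    have "y \<le> 1 + y\<^sup>2" for y :: real
    proof -
      have "2 * y \<le> y\<^sup>2 + 1" using zero_le_power2[of "y - 1"] by (simp add: power2_diff)
      moreover have "0 \<le> y\<^sup>2" by simp
      ultimately show ?thesis by linarith
    qed
    then show "AE x in M. norm (complex_of_real (cmod (f x))) \<le> norm (1 + (cmod (f x))\<^sup>2)"
      by (intro AE_I2) (auto intro: order_trans)
  qed measurable
  moreover have "AE x in M. complex_of_real (cmod (f (T x))) = complex_of_real (cmod (f x))"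
    using eig by eventually_elim (simp add: norm_mult)
  ultimately obtain c where c: "AE x in M. complex_of_real (cmod (f x)) = c"
    using erg unfolding ergodic_def by blast
  have "c \<noteq> 0"
  proof
    assume "c = 0"
    have "AE x in M. f x = 0" using c by eventually_elim (use \<open>c = 0\<close> in auto)
    with f(2) show False by simp
  qed
  define \<xi> where "\<xi> x = (if f x = 0 then 1 else f x / cmod (f x))" for x
  have "AE x in M. \<xi> (T x) = e t * \<xi> x"
    using eig c
  proof eventually_elim
    case (elim x)
    then have "f x \<noteq> 0" using \<open>c \<noteq> 0\<close> by auto
    then show ?case using elim(1) by (simp add: \<xi>_def norm_mult)
  qed
  then have "AE x in M. \<xi> (act M T 1 x) = e t * \<xi> x"
    using AE_act_1[of "\<lambda>y x. \<xi> y = e t * \<xi> x"] by simp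
  moreover have "\<xi> \<in> borel_measurable M" unfolding \<xi>_def by measurable
  moreover have "cmod (\<xi> x) = 1" for x by (simp add: \<xi>_def norm_divide)
  ultimately show ?thesis unfolding eigenfun_def by blast
qed

section \<open>Identification of the ergodic seminorms\<close>

lemma erg_seminorm_cong:
  "(\<And>x. x \<in> space M \<Longrightarrow> f x = g x) \<Longrightarrow> erg_seminorm M T s f = erg_seminorm M T s g"
proof (induction s arbitrary: f g)
  case 0
  then show ?case by (auto intro!: Bochner_Integration.integral_cong)
next
  case (Suc s)
  have "iter M T n x \<in> space M" if "x \<in> space M" for n x
    using act_in[OF that, of n] that by (simp add: act_def)
  then have "erg_seminorm M T s (\<lambda>x. f (iter M T n x) * cnj (f x))
      = erg_seminorm M T s (\<lambda>x. g (iter M T n x) * cnj (g x))" for n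
    by (intro Suc.IH) (simp add: Suc.prems)
  then show ?case by simp
qed

text \<open>Once the averages are known to converge to a nonnegative real, the description by
  \<open>THE\<close> has exactly one solution, the root of the limit.\<close>

lemma erg_seminorm_Suc_eq:
  assumes lim: "(\<lambda>N. avg {1..N} (\<lambda>n. erg_seminorm M T s (\<lambda>x. f (iter M T (int n) x)
      * cnj (f x)) ^ (2 ^ s)))
      \<longlonglongrightarrow> complex_of_real L" and L: "0 \<le> L"
  shows "erg_seminorm M T (Suc s) f = complex_of_real (root (2 ^ Suc s) L)"
proof -
  define z where "z N = avg {1..N} (\<lambda>n. erg_seminorm M T s (\<lambda>x. f (iter M T (int n) x)
      * cnj (f x)) ^ (2 ^ s))" for N
  define d :: nat where "d = 2 ^ Suc s"
  have d: "0 < d" by (simp add: d_def)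
  have z: "z \<longlonglongrightarrow> complex_of_real L" using lim unfolding z_def .
  have "(THE r. 0 \<le> r \<and> z \<longlonglongrightarrow> complex_of_real (r ^ d)) = root d L"
  proof (rule the_equality)
    show "0 \<le> root d L \<and> z \<longlonglongrightarrow> complex_of_real (root d L ^ d)"
      using z L d by simp
    fix r assume r: "0 \<le> r \<and> z \<longlonglongrightarrow> complex_of_real (r ^ d)"
    then have "complex_of_real (r ^ d) = complex_of_real L" using LIMSEQ_unique z by blast
    then have "r ^ d = L" by (simp only: of_real_eq_iff)
    then show "r = root d L" using r d by (auto simp: real_root_power_cancel)
  qed
  then show ?thesis unfolding z_def d_def erg_seminorm.simps by (simp only:)
qed

text \<open>The required limits exist by \<open>mean_ergodic\<close> in degree one and by positive
  definiteness in higher degrees. The index is shifted because degree zero is the plain integral,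
  which need not be a nonnegative real.\<close>

lemma erg_seminorm_eq:
  "f \<in> unit_funs M \<Longrightarrow> erg_seminorm M T (Suc s) f
      = complex_of_real (root (2 ^ Suc s) (seminorm_pow s f))"
proof (induction s arbitrary: f)
  case 0
  have "erg_seminorm M T 0 (\<lambda>x. f (iter M T n x) * cnj (f x))
      = (\<integral>x. f (act M T n x) * cnj (f x) \<partial>M)" for n
    by (auto intro!: Bochner_Integration.integral_cong simp: act_def)
  then show ?case using mean_ergodic[OF 0]
      by (intro erg_seminorm_Suc_eq) (simp_all del: erg_seminorm.simps)
next
  case (Suc s)
  have "erg_seminorm M T (Suc s) (\<lambda>x. f (iter M T (int n) x) * cnj (f x)) ^ (2 ^ Suc s)
      = complex_of_real (seminorm_pow s (deriv_by n f))" for n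
  proof -
    have "erg_seminorm M T (Suc s) (\<lambda>x. f (iter M T (int n) x) * cnj (f x))
        = erg_seminorm M T (Suc s) (deriv_by n f)"
      by (rule erg_seminorm_cong) (simp add: deriv_by_def act_def)
    also have "\<dots> = complex_of_real (root (2 ^ Suc s) (seminorm_pow s (deriv_by n f)))"
      by (intro Suc.IH deriv_by_unit Suc.prems)
    finally show ?thesis
      using seminorm_pow_bounds(1)[OF deriv_by_unit[OF Suc.prems], of s n]
      by (simp only: of_real_power[symmetric] real_root_pow_pos2 zero_less_power zero_less_numeral)
  qed
  note terms = this
  have "(\<lambda>N. avg {1..N} (\<lambda>n. erg_seminorm M T (Suc s) (\<lambda>x. f (iter M T (int n) x)
      * cnj (f x)) ^ (2 ^ Suc s)))
      \<longlonglongrightarrow> complex_of_real (seminorm_pow (Suc s) f)"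
    unfolding terms using tendsto_of_real[OF seminorm_pow_lim[OF Suc.prems, of s],
        where 'a = complex]
    by (simp add: avg_def)
  then show ?case by (rule erg_seminorm_Suc_eq) (rule seminorm_pow_bounds(1)[OF Suc.prems])
qed

text \<open>Formulated on \<open>Linf M\<close>, the class in the definition of seminorm estimates.
  Scaling by \<open>C\<close> multiplies the autocorrelations by its square, so the first seminorm
  is \<open>C\<close> times the modulus of the mean of \<open>g\<close>.\<close>

lemma mean_zero_of_erg_seminorm_1:
  assumes f: "f \<in> Linf M" and zero: "erg_seminorm M T 1 f = 0"
  shows "(\<integral>x. f x \<partial>M) = 0"
proof -
  obtain C g where C: "C > 0" and g: "g \<in> unit_funs M"
      and eq: "AE x in M. f x = complex_of_real C * g x"
    using Linf_scaled[OF f] by blast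
  have fm: "f \<in> borel_measurable M" using f by (simp add: Linf_def)
  have gm: "g \<in> borel_measurable M" using g by (rule unit_funs_measurable)
  have "erg_seminorm M T 0 (\<lambda>x. f (iter M T n x) * cnj (f x))
      = complex_of_real (C\<^sup>2) * (\<integral>x. g (act M T n x) * cnj (g x) \<partial>M)" for n
  proof -
    have "erg_seminorm M T 0 (\<lambda>x. f (iter M T n x) * cnj (f x))
        = (\<integral>x. f (act M T n x) * cnj (f x) \<partial>M)"
      by (auto intro!: Bochner_Integration.integral_cong simp: act_def)
    also have "\<dots> = (\<integral>x. complex_of_real (C\<^sup>2) * (g (act M T n x) * cnj (g x)) \<partial>M)"
    proof (rule integral_cong_AE)
      show "AE x in M. f (act M T n x) * cnj (f x)
          = complex_of_real (C\<^sup>2) * (g (act M T n x) * cnj (g x))"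
        using eq AE_action[OF eq, of n] by eventually_elim (simp add: power2_eq_square)
    qed (auto intro!: borel_measurable_times borel_measurable_cnj borel_measurable_const
        measurable_compose[OF action_measurable] fm gm)
    finally show ?thesis by simp
  qed
  note terms = this
  have "(\<lambda>N. avg {1..N} (\<lambda>n. erg_seminorm M T 0 (\<lambda>x. f (iter M T (int n) x) * cnj (f x)) ^ (2 ^ 0)))
      \<longlonglongrightarrow> complex_of_real (C\<^sup>2 * (cmod (\<integral>x. g x \<partial>M))\<^sup>2)"
    unfolding terms using tendsto_mult_left[OF mean_ergodic[OF g], of "complex_of_real (C\<^sup>2)"]
    by (simp add: avg_def sum_distrib_left)
  from erg_seminorm_Suc_eq[OF this] have "root 2 (C\<^sup>2 * (cmod (\<integral>x. g x \<partial>M))\<^sup>2) = 0"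
    using zero by simp
  then have "(\<integral>x. g x \<partial>M) = 0" using C by simp
  moreover have "(\<integral>x. f x \<partial>M) = (\<integral>x. complex_of_real C * g x \<partial>M)"
    using eq fm gm by (intro integral_cong_AE) auto
  ultimately show ?thesis by simp
qed

lemma tendsto_L2_iff:
  assumes F: "\<And>N. AE x in M. F N x = G N x" and G: "\<And>N. G N \<in> bounded_funs M"
  shows "tendsto_L2 M F (\<lambda>_. c) \<longleftrightarrow> l2_lim G c"
proof -
  have "(\<integral>\<^sup>+x. ennreal ((cmod (F N x - c))\<^sup>2) \<partial>M) = ennreal (\<integral>x. (cmod (G N x - c))\<^sup>2 \<partial>M)" for N
  proof -
    have "(\<integral>\<^sup>+x. ennreal ((cmod (F N x - c))\<^sup>2) \<partial>M) = (\<integral>\<^sup>+x. ennreal ((cmod (G N x - c))\<^sup>2) \<partial>M)"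
      using F[of N] by (intro nn_integral_cong_AE) (auto elim: eventually_mono)
    also have "\<dots> = ennreal (\<integral>x. (cmod (G N x - c))\<^sup>2 \<partial>M)"
      by (intro nn_integral_eq_integral integrable_bounded_norm bounded_funs_diff G) auto
    finally show ?thesis .
  qed
  then show ?thesis unfolding tendsto_L2_def l2_lim_def by (simp add: ennreal_tendsto_0_iff)
qed

end

section \<open>Transfer to the notions of the theorem\<close>

locale ergodic_mp_sequences = ergodic_mp_system M T for M :: "'a measure" and T +
  fixes l :: nat and a :: "nat \<Rightarrow> nat \<Rightarrow> int"
begin

sublocale action_sequences M "act M T" l a ..

lemma mult_avg_scaled:
  assumes eq: "\<And>i. i \<in> {1..l} \<Longrightarrow> AE x in M. f i x = complex_of_real (C i) * g i x"
  shows "AE x in M. mult_avg M T l a f N x = complex_of_real (\<Prod>i=1..l. C i) * mult_mean g N x"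
proof -
  have "AE x in M. \<forall>i\<in>{1..l}. \<forall>n. f i (act M T (a i n) x)
      = complex_of_real (C i) * g i (act M T (a i n) x)"
    by (intro AE_finite_allI AE_all_countable[THEN iffD2] allI AE_action eq) auto
  with AE_space show ?thesis
  proof eventually_elim
    case (elim x)
    have "(\<Prod>i=1..l. f i (iter M T (a i n) x))
        = complex_of_real (\<Prod>i=1..l. C i) * (\<Prod>i=1..l. g i (act M T (a i n) x))" for n
      using elim by (simp add: prod.distrib[symmetric] act_def)
    then show ?case unfolding mult_avg_def mult_mean_def avg_def by (simp add: sum_distrib_left)
  qed
qed

lemma tendsto_L2_unit_iff:
  assumes f: "\<And>i. i \<in> {1..l} \<Longrightarrow> f i \<in> unit_funs M"
  shows "tendsto_L2 M (mult_avg M T l a f) (\<lambda>_. c) \<longleftrightarrow> l2_lim (mult_mean f) c"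
proof (rule tendsto_L2_iff)
  show "AE x in M. mult_avg M T l a f N x = mult_mean f N x" for N
    using mult_avg_scaled[of f "\<lambda>_. 1" f N] by simp
  show "mult_mean f N \<in> bounded_funs M" for N by (intro unit_funs_subset mult_mean_unit f)
qed

text \<open>The condition \<open>s \<ge> 1\<close> allows the shift of the index: degree
  \<open>Suc s'\<close> corresponds to \<open>seminorm_pow s'\<close>.\<close>

lemma seminorm_estimates_of_good:
  assumes "good_for_seminorm_estimates M T l a" shows "\<exists>s. seminorm_estimates s"
proof -
  obtain s where s: "s \<ge> 1" and good: "\<And>f m. m \<in> {1..l} \<Longrightarrow> (\<forall>i\<in>{1..l}. f i \<in> Linf M) \<Longrightarrow>
      erg_seminorm M T s (f m) = 0 \<Longrightarrow> (\<forall>i\<in>{m<..l}. f i \<in> Eig M T) \<Longrightarrow> tendsto_L2 M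
          (mult_avg M T l a f) (\<lambda>_. 0)"
    using assms unfolding good_for_seminorm_estimates_def by blast
  obtain s' where s': "s = Suc s'" using s by (cases s) auto
  have "seminorm_estimates s'" unfolding seminorm_estimates_def
  proof (intro allI ballI impI)
    fix f m assume m: "m \<in> {1..l}" and f: "admissible m f" and zero: "seminorm_pow s' (f m) = 0"
    have fu: "\<And>i. i \<in> {1..l} \<Longrightarrow> f i \<in> unit_funs M" using f by (auto simp: admissible_def)
    have "tendsto_L2 M (mult_avg M T l a f) (\<lambda>_. 0)"
    proof (rule good[OF m])
      show "erg_seminorm M T s (f m) = 0" unfolding s' erg_seminorm_eq[OF fu[OF m]] zero by simp
    qed (use f in \<open>auto simp: admissible_def intro: unit_funs_Linf eigenfun_Eig\<close>)
    then show "l2_lim (mult_mean f) 0" using tendsto_L2_unit_iff[of f 0] fu by blast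
  qed
  then show ?thesis ..
qed

lemma equidistribution_of_good:
  assumes "good_for_equidistribution M T l a" shows equidistribution
  unfolding equidistribution_def
proof (intro allI impI)
  fix t :: "nat \<Rightarrow> real" and f
  assume f: "\<forall>i\<in>{1..l}. eigenfun (f i) \<and> (AE x in M. f i (act M T 1 x) = e (t i) * f i x)"
    and nz: "\<exists>i\<in>{1..l}. e (t i) \<noteq> 1"
  have "\<forall>i\<in>{1..l}. frac (t i) \<in> Spec M T" using f eigenvalue_Spec by blast
  moreover have "\<exists>i\<in>{1..l}. frac (t i) \<noteq> 0"
    using nz by (auto simp: e_eq_1_iff frac_eq_0_iff)
  ultimately have "(\<lambda>N. avg {1..N} (\<lambda>n. e (\<Sum>i=1..l. of_int (a i n) * frac (t i)))) \<longlonglongrightarrow> 0"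
    using assms[unfolded good_for_equidistribution_def, rule_format, of "\<lambda>i. frac (t i)"] by blast
  \<comment> \<open>The \<open>a i n\<close> are integers, so passing to fractional parts changes
    the phase by an integer.\<close>
  moreover have "e (\<Sum>i=1..l. of_int (a i n) * frac (t i)) = e (\<Sum>i=1..l. of_int (a i n) * t i)" for n
  proof -
    have "(\<Sum>i=1..l. of_int (a i n) * t i) = (\<Sum>i=1..l. of_int (a i n) * frac (t i))
        + of_int (\<Sum>i=1..l. a i n * \<lfloor>t i\<rfloor>)"
      by (simp add: frac_def sum.distrib[symmetric] algebra_simps)
    then show ?thesis by (simp only: e_add e_of_int mult_1_right)
  qed
  ultimately show "(\<lambda>N. avg {1..N} (\<lambda>n. e (\<Sum>i=1..l. of_int (a i n) * t i))) \<longlonglongrightarrow> 0" by simp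
qed

lemma jointly_ergodic_of_good:
  assumes "good_for_seminorm_estimates M T l a" "good_for_equidistribution M T l a"
  shows "jointly_ergodic M T l a"
  unfolding jointly_ergodic_def
proof (intro allI impI)
  fix f assume f: "\<forall>i\<in>{1..l}. f i \<in> Linf M"
  have "\<forall>i\<in>{1..l}. \<exists>p. fst p > 0 \<and> snd p \<in> unit_funs M \<and> (AE x in M. f i x
      = complex_of_real (fst p) * snd p x)"
    using f Linf_scaled by fastforce
  from bchoice[OF this] obtain p where p: "\<And>i. i \<in> {1..l} \<Longrightarrow> snd (p i) \<in> unit_funs M"
    "\<And>i. i \<in> {1..l} \<Longrightarrow> AE x in M. f i x = complex_of_real (fst (p i)) * snd (p i) x" by blast
  define C where "C i = fst (p i)" for i
  define g where "g i = snd (p i)" for i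
  have g: "g i \<in> unit_funs M" if "i \<in> {1..l}" for i using p that by (simp add: g_def)
  have eq: "AE x in M. f i x = complex_of_real (C i) * g i x" if "i \<in> {1..l}" for i
    using p(2)[OF that] by (simp add: g_def C_def)
  define K where "K = complex_of_real (\<Prod>i=1..l. C i)"
  have bounded: "mult_mean g N \<in> bounded_funs M" for N by (intro unit_funs_subset mult_mean_unit g)
  obtain s where "seminorm_estimates s" using seminorm_estimates_of_good[OF assms(1)] by blast
  then have "l2_lim (mult_mean g) (\<Prod>i=1..l. \<integral>x. g i x \<partial>M)"
    using equidistribution_of_good[OF assms(2)] g by (intro mult_mean_converges)
  \<comment> \<open>With coefficients \<open>K\<close> and 0 the sum rule is multiplication by
    \<open>K\<close>.\<close>
  from l2_lim_add[OF bounded bounded this this, of K 0]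
  have "l2_lim (\<lambda>N x. K * mult_mean g N x) (K * (\<Prod>i=1..l. \<integral>x. g i x \<partial>M))" by simp
  moreover have "K * (\<Prod>i=1..l. \<integral>x. g i x \<partial>M) = (\<Prod>i=1..l. \<integral>x. f i x \<partial>M)"
  proof -
    have "(\<integral>x. f i x \<partial>M) = complex_of_real (C i) * (\<integral>x. g i x \<partial>M)" if i: "i \<in> {1..l}" for i
    proof -
      have "(\<integral>x. f i x \<partial>M) = (\<integral>x. complex_of_real (C i) * g i x \<partial>M)"
        using f i g[OF i] by (intro integral_cong_AE eq) (auto simp: Linf_def
            dest: unit_funs_measurable)
      then show ?thesis by simp
    qed
    then show ?thesis unfolding K_def by (simp add: prod.distrib[symmetric])
  qed
  ultimately show "tendsto_L2 M (mult_avg M T l a f) (\<lambda>_. \<Prod>i=1..l. \<integral>x. f i x \<partial>M)"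
    using tendsto_L2_iff[of "mult_avg M T l a f" "\<lambda>N x. K * mult_mean g N x"
        "\<Prod>i=1..l. \<integral>x. f i x \<partial>M"]
      mult_avg_scaled[of f C g, folded K_def] eq bounded_funs_cmult[OF bounded]
    by metis
qed

text \<open>Already \<open>s = 1\<close> works: a vanishing first seminorm means mean zero, and then
  the product of integrals in the joint limit is zero.\<close>

lemma good_for_seminorm_estimates_of_joint:
  assumes "jointly_ergodic M T l a" shows "good_for_seminorm_estimates M T l a"
  unfolding good_for_seminorm_estimates_def
proof (intro exI[of _ 1] conjI allI ballI impI)
  fix f m assume m: "m \<in> {1..l}" and f: "\<forall>i\<in>{1..l}. f i \<in> Linf M"
      and zero: "erg_seminorm M T 1 (f m) = 0"
  have "(\<integral>x. f m x \<partial>M) = 0" using f m zero by (intro mean_zero_of_erg_seminorm_1) auto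
  then have "(\<Prod>i=1..l. \<integral>x. f i x \<partial>M) = 0" using m by (intro prod_zero) auto
  then show "tendsto_L2 M (mult_avg M T l a f) (\<lambda>_. 0)"
    using assms f unfolding jointly_ergodic_def by metis
qed simp

text \<open>Joint ergodicity is tested on eigenfunctions for the \<open>t i\<close>. One of them has
  mean zero, so the averages tend to zero, and their norms are the moduli of the exponential
  averages.\<close>

lemma good_for_equidistribution_of_joint:
  assumes "jointly_ergodic M T l a" shows "good_for_equidistribution M T l a"
  unfolding good_for_equidistribution_def
proof (intro allI impI)
  fix t :: "nat \<Rightarrow> real"
  assume t: "\<forall>i\<in>{1..l}. t i \<in> Spec M T" and nz: "\<exists>i\<in>{1..l}. t i \<noteq> 0"
  have "\<forall>i\<in>{1..l}. \<exists>\<xi>. eigenfun \<xi> \<and> (AE x in M. \<xi> (act M T 1 x) = e (t i) * \<xi> x)"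
    using t Spec_eigenfun by blast
  from bchoice[OF this] obtain f where f: "\<And>i. i \<in> {1..l} \<Longrightarrow> eigenfun (f i)"
    "\<And>i. i \<in> {1..l} \<Longrightarrow> AE x in M. f i (act M T 1 x) = e (t i) * f i x" by blast
  obtain i where i: "i \<in> {1..l}" "t i \<noteq> 0" using nz by blast
  have "e (t i) \<noteq> 1"
  proof -
    have "0 \<le> t i" "t i < 1" using t i by (auto simp: Spec_def)
    then have "frac (t i) = t i" by (simp add: frac_eq)
    then show ?thesis using i(2) unfolding e_eq_1_iff by (metis frac_eq_0_iff)
  qed
  then have "(\<integral>x. f i x \<partial>M) = 0" using eigenfun_const_or_mean_zero(2)[OF f(1)[OF i(1)] f(2)[OF
      i(1)]] by simp
  then have p0: "(\<Prod>i=1..l. \<integral>x. f i x \<partial>M) = 0" using i by (intro prod_zero) auto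
  have fu: "f i \<in> unit_funs M" if "i \<in> {1..l}" for i by (intro eigenfun_unit f that)
  have "tendsto_L2 M (mult_avg M T l a f) (\<lambda>_. \<Prod>i=1..l. \<integral>x. f i x \<partial>M)"
    using assms fu unit_funs_Linf unfolding jointly_ergodic_def by blast
  then have "l2_lim (mult_mean f) 0" unfolding p0 using tendsto_L2_unit_iff[of f 0] fu by blast
  moreover have "(\<integral>x. (cmod (mult_mean f N x))\<^sup>2 \<partial>M)
      = (cmod (avg {1..N} (\<lambda>n. e (\<Sum>i=1..l. of_int (a i n) * t i))))\<^sup>2" for N
    by (rule mult_mean_eigenfun_energy) (erule f(1), erule f(2))
  ultimately have "(\<lambda>N. (cmod (avg {1..N} (\<lambda>n. e (\<Sum>i=1..l. of_int (a i n) * t i))))\<^sup>2) \<longlonglongrightarrow> 0"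
    by (simp add: l2_lim_def)
  from tendsto_real_sqrt[OF this]
  have "(\<lambda>N. cmod (avg {1..N} (\<lambda>n. e (\<Sum>i=1..l. of_int (a i n) * t i)))) \<longlonglongrightarrow> 0" by simp
  then show "(\<lambda>N. avg {1..N} (\<lambda>n. e (\<Sum>i=1..l. of_int (a i n) * t i))) \<longlonglongrightarrow> 0"
    by (simp add: tendsto_norm_zero_iff)
qed

end

theorem theorem1p1:
  fixes M :: "'a measure" and T :: "'a \<Rightarrow> 'a"
    and l :: nat and a :: "nat \<Rightarrow> nat \<Rightarrow> int"
  assumes "mp_system M T" and "ergodic M T" and "l \<ge> 1"
  shows "jointly_ergodic M T l a \<longleftrightarrow>
    good_for_seminorm_estimates M T l a \<and> good_for_equidistribution M T l a"
proof -
  interpret ergodic_mp_sequences M T l a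
    by unfold_locales (fact assms)+
  show ?thesis
    using jointly_ergodic_of_good good_for_seminorm_estimates_of_joint
        good_for_equidistribution_of_joint
    by blast
qed

end
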